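(* Let $p_1:\mathrm{Sp}(4)//\mathrm{Sp}(4)\to\mathbb{R}^2$, $[[M_{A,B,C}]]\mapsto(\mathrm{tr}A,\det A)$, and $p_2:\mathrm{Sp}^{\mathcal I}(4)//\mathrm{GL}_2(\mathbb{R})\to\mathbb{R}^2$, $[M_{A,B,C}]\mapsto(\mathrm{tr}A,\det A)$. Let $\Gamma_1=\{(\tau,\tau-1):\tau\in\mathbb{R}\}$ and $\Gamma_{-1}=\{(\tau,-\tau-1):\tau\in\mathbb{R}\}$. Then the complement of the bifurcation locus $\big(\mathrm{Sp}(4)//\mathrm{Sp}(4)\big)\setminus p_1^{-1}(\Gamma_1\cup\Gamma_{-1})$ has exactly $8$ connected components, and the complement of the bifurcation locus $\big(\mathrm{Sp}^{\mathcal I}(4)//\mathrm{GL}_2(\mathbb{R})\big)\setminus p_2^{-1}(\Gamma_1\cup\Gamma_{-1})$ has exactly $19$ connected components.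
   Context: $\mathrm{Sp}(2n)$ is the group of real symplectic $2n\times 2n$ matrices, i.e. $M^TJM=J$ with $J=\begin{pmatrix}0&I\\-I&0\end{pmatrix}$; it acts on itself by conjugation. $\mathcal I=\begin{pmatrix}I&0\\0&-I\end{pmatrix}$ and $\mathrm{Sp}^{\mathcal I}(2n)=\{M\in\mathrm{Sp}(2n):M^{-1}=\mathcal I M\mathcal I\}$. Equivalently, $\mathrm{Sp}^{\mathcal I}(2n)$ consists of the matrices $M_{A,B,C}=\begin{pmatrix}A&B\\C&A^T\end{pmatrix}$ with $A,B,C\in \mathrm{M}_{n\times n}(\mathbb{R})$ satisfying $B=B^T$, $C=C^T$, $AB=BA^T$, $A^TC=CA$, $A^2-BC=I$. The group $\mathrm{GL}_n(\mathbb{R})$ acts on $\mathrm{Sp}^{\mathcal I}(2n)$ by $R_*(A,B,C)=(RAR^{-1},RBR^T,(R^T)^{-1}CR^{-1})$. For a Lie group $G$ acting on a manifold $X$, the orbit closure relation is $x\sim y\iff \overline{Gx}\cap\overline{Gy}\neq\emptyset$. When it is transitive (as is the case for the actions here), the GIT quotient is $X//G:=X/\sim$ with the quotient topology. $[M_{A,B,C}]$ denotes the class in $\mathrm{Sp}^{\mathcal I}(2n)//\mathrm{GL}_n(\mathbb{R})$ and $[[M_{A,B,C}]]$ the class in $\mathrm{Sp}(2n)//\mathrm{Sp}(2n)$. Every symplectic matrix is symplectically conjugate to an element of $\mathrm{Sp}^{\mathcal I}(2n)$ (Wonenburger), so every class in $\mathrm{Sp}(2n)//\mathrm{Sp}(2n)$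 is of the form $[[M_{A,B,C}]]$. The characteristic polynomial of $A$ is determined by that of $M_{A,B,C}$, so $p_1$ is well defined. The preimages of $\Gamma_1\cup\Gamma_{-1}$ under $p_1$ and $p_2$ are called the bifurcation loci; they consist of the classes for which $1$ or $-1$ is an eigenvalue of $A$. *)

theory Defs
  imports "HOL-Analysis.Analysis"
begin

section \<open>Symplectic matrices in block form\<close>

text \<open>
  Matrices of size \<open>2n \<times> 2n\<close> are indexed by \<open>'n + 'n\<close> with \<open>n = CARD('n)\<close>;
  the tags \<open>Inl\<close> and \<open>Inr\<close> select the first and second half of the rows or columns.
\<close>

definition block_mat ::
  "real^'n::finite^'n \<Rightarrow> real^'n^'n \<Rightarrow> real^'n^'n \<Rightarrow> real^'n^'n \<Rightarrow> real^('n + 'n)^('n + 'n)" where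
  "block_mat A B C D = (\<chi> i j. case i of
      Inl k \<Rightarrow> (case j of Inl l \<Rightarrow> A $ k $ l | Inr l \<Rightarrow> B $ k $ l)
    | Inr k \<Rightarrow> (case j of Inl l \<Rightarrow> C $ k $ l | Inr l \<Rightarrow> D $ k $ l))"

definition J_mat :: "real^('n::finite + 'n)^('n + 'n)" where
  "J_mat = block_mat 0 (mat 1) (- mat 1) 0"

definition I_mat :: "real^('n::finite + 'n)^('n + 'n)" where
  "I_mat = block_mat (mat 1) 0 0 (- mat 1)"

definition Sp :: "(real^('n::finite + 'n)^('n + 'n)) set" where
  "Sp = {M. transpose M ** J_mat ** M = J_mat}"

definition Sp_I :: "(real^('n::finite + 'n)^('n + 'n)) set" where
  "Sp_I = {M \<in> Sp. matrix_inv M = I_mat ** M ** I_mat}"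

definition M_ABC :: "real^'n::finite^'n \<Rightarrow> real^'n^'n \<Rightarrow> real^'n^'n \<Rightarrow> real^('n + 'n)^('n + 'n)" where
  "M_ABC A B C = block_mat A B C (transpose A)"

definition GL :: "(real^'n::finite^'n) set" where
  "GL = {R. invertible R}"

definition Sp_act ::
  "real^('n::finite + 'n)^('n + 'n) \<Rightarrow> real^('n + 'n)^('n + 'n) \<Rightarrow> real^('n + 'n)^('n + 'n)" where
  "Sp_act S M = S ** M ** matrix_inv S"

text \<open>
  The action \<open>(A, B, C) \<mapsto> (R A R\<^sup>-\<^sup>1, R B R\<^sup>T, (R\<^sup>T)\<^sup>-\<^sup>1 C R\<^sup>-\<^sup>1)\<close>, with \<open>A\<close>, \<open>B\<close>, \<open>C\<close>
  read off from the matrix; it is only meant for matrices of the form \<open>M_ABC A B C\<close>.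
\<close>

definition GL_act :: "real^'n::finite^'n \<Rightarrow> real^('n + 'n)^('n + 'n) \<Rightarrow> real^('n + 'n)^('n + 'n)" where
  "GL_act R M =
    (let A = (\<chi> k l. M $ Inl k $ Inl l);
         B = (\<chi> k l. M $ Inl k $ Inr l);
         C = (\<chi> k l. M $ Inr k $ Inl l)
     in M_ABC (R ** A ** matrix_inv R)
              (R ** B ** transpose R)
              (matrix_inv (transpose R) ** C ** matrix_inv R))"

lemma block_mat_nth [simp]:
  "block_mat A B C D $ Inl k $ Inl l = A $ k $ l"
  "block_mat A B C D $ Inl k $ Inr l = B $ k $ l"
  "block_mat A B C D $ Inr k $ Inl l = C $ k $ l"
  "block_mat A B C D $ Inr k $ Inr l = D $ k $ l"
  by (simp_all add: block_mat_def)

lemma block_matrix_eqI: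
  fixes M N :: "real^('n::finite + 'n)^('n + 'n)"
  assumes "\<And>k l. M $ Inl k $ Inl l = N $ Inl k $ Inl l"
    and "\<And>k l. M $ Inl k $ Inr l = N $ Inl k $ Inr l"
    and "\<And>k l. M $ Inr k $ Inl l = N $ Inr k $ Inl l"
    and "\<And>k l. M $ Inr k $ Inr l = N $ Inr k $ Inr l"
  shows "M = N"
proof -
  have "M $ i $ j = N $ i $ j" for i j
    by (cases i; cases j) (simp_all only: assms)
  then show ?thesis
    unfolding vec_eq_iff by blast
qed

lemma block_mat_eq_iff:
  "block_mat A B C D = block_mat A' B' C' D' \<longleftrightarrow> A = A' \<and> B = B' \<and> C = C' \<and> D = D'"
  (is "?l = ?r")
proof
  assume l: ?l
  have "A $ k $ l = A' $ k $ l" "B $ k $ l = B' $ k $ l" "C $ k $ l = C' $ k $ l"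
    "D $ k $ l = D' $ k $ l" for k l
    using l by (metis block_mat_nth(1), metis block_mat_nth(2), metis block_mat_nth(3),
        metis block_mat_nth(4))
  then show ?r
    unfolding vec_eq_iff by blast
qed simp

lemma block_mat_cases:
  obtains A B C D where "M = block_mat A B C D"
proof
  show "M = block_mat (\<chi> k l. M $ Inl k $ Inl l) (\<chi> k l. M $ Inl k $ Inr l)
                      (\<chi> k l. M $ Inr k $ Inl l) (\<chi> k l. M $ Inr k $ Inr l)"
    by (rule block_matrix_eqI) simp_all
qed

lemma block_mat_mult:
  fixes A B C D :: "real^'n::finite^'n"
  shows "block_mat A B C D ** block_mat A' B' C' D' =
    block_mat (A ** A' + B ** C') (A ** B' + B ** D') (C ** A' + D ** C') (C ** B' + D ** D')"
proof -
  have "(\<Sum>k\<in>UNIV. f k) = (\<Sum>k\<in>UNIV. f (Inl k)) + (\<Sum>k\<in>UNIV. f (Inr k))"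
    for f :: "'n + 'n \<Rightarrow> real"
    using sum.Plus [of "UNIV :: 'n set" "UNIV :: 'n set" f] by (simp add: comp_def)
  then show ?thesis
    by (intro block_matrix_eqI) (simp_all add: matrix_matrix_mult_def)
qed

lemma transpose_block_mat:
  "transpose (block_mat A B C D) =
   block_mat (transpose A) (transpose C) (transpose B) (transpose D)"
  by (rule block_matrix_eqI) (simp_all add: transpose_def)

lemma mat_one_block: "mat 1 = block_mat (mat 1) 0 0 (mat 1)"
  by (rule block_matrix_eqI) (simp_all add: mat_def)

lemma GL_act_M_ABC:
  "GL_act R (M_ABC A B C) =
   M_ABC (R ** A ** matrix_inv R) (R ** B ** transpose R)
         (matrix_inv (transpose R) ** C ** matrix_inv R)"
  by (simp add: GL_act_def M_ABC_def)


lemma Sp_I_iff_M_ABC: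
  "M \<in> Sp_I \<longleftrightarrow>
   (\<exists>A B C. M = M_ABC A B C \<and> B = transpose B \<and> C = transpose C \<and>
            A ** B = B ** transpose A \<and> transpose A ** C = C ** A \<and>
            A ** A - B ** C = mat 1)"
proof -
  have neg: "- X ** Y = - (X ** Y)" "X ** - Y = - (X ** Y)" for X Y :: "real^'a^'a"
    by (simp_all add: matrix_matrix_mult_def vec_eq_iff sum_negf)
  have zero: "0 ** Y = 0" "X ** 0 = 0" for X Y :: "real^'a^'a"
    by (simp_all add: matrix_matrix_mult_def vec_eq_iff)
  obtain A B C D where M: "M = block_mat A B C D"
    by (rule block_mat_cases)
  have IMI: "I_mat ** M ** I_mat = block_mat A (- B) (- C) D"
    by (simp add: M I_mat_def block_mat_mult neg zero)
  have Sp: "M \<in> Sp \<longleftrightarrow>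
      transpose A ** C = transpose C ** A \<and> transpose A ** D - transpose C ** B = mat 1 \<and>
      transpose B ** C - transpose D ** A = - mat 1 \<and> transpose B ** D = transpose D ** B"
    by (auto simp: M Sp_def J_mat_def transpose_block_mat block_mat_mult block_mat_eq_iff neg zero)
  have inv: "matrix_inv M = block_mat (transpose D) (- transpose B) (- transpose C) (transpose A)"
    (is "_ = ?N") if "M \<in> Sp"
  proof -
    have "transpose D ** A - transpose B ** C = mat 1"
      using that Sp by (metis minus_diff_eq minus_minus)
    then have NM: "?N ** M = mat 1"
      using that unfolding Sp
      by (simp add: M block_mat_mult mat_one_block block_mat_eq_iff neg)
    then have "M ** ?N = mat 1"
      by (simp add: matrix_left_right_inverse)
    with NM have "\<exists>N. M ** N = mat 1 \<and> N ** M = mat 1"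
      by blast
    then have "M ** matrix_inv M = mat 1"
      unfolding matrix_inv_def by (rule someI2_ex) blast
    then have "?N ** (M ** matrix_inv M) = ?N"
      by simp
    then show ?thesis
      by (simp add: matrix_mul_assoc NM)
  qed
  have transp: "transpose (X - Y) = transpose X - transpose Y" for X Y :: "real^'a^'a"
    by (simp add: transpose_def vec_eq_iff)
  show ?thesis
  proof
    assume "M \<in> Sp_I"
    then have MSp: "M \<in> Sp" and "matrix_inv M = I_mat ** M ** I_mat"
      by (simp_all add: Sp_I_def)
    then have D: "D = transpose A" and B: "transpose B = B" and C: "transpose C = C"
      by (simp_all add: inv IMI block_mat_eq_iff)
    have eqs: "transpose A ** C = C ** A" "B ** C - A ** A = - mat 1" "B ** transpose A = A ** B"
      using MSp unfolding Sp D B C by simp_all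
    have "A ** A - B ** C = mat 1"
      using eqs(2) by (metis minus_diff_eq minus_minus)
    with eqs B C D show "\<exists>A B C. M = M_ABC A B C \<and> B = transpose B \<and> C = transpose C \<and>
        A ** B = B ** transpose A \<and> transpose A ** C = C ** A \<and> A ** A - B ** C = mat 1"
      unfolding M M_ABC_def by (intro exI [of _ A] exI [of _ B] exI [of _ C]) simp
  next
    assume "\<exists>A B C. M = M_ABC A B C \<and> B = transpose B \<and> C = transpose C \<and>
        A ** B = B ** transpose A \<and> transpose A ** C = C ** A \<and> A ** A - B ** C = mat 1"
    then have D: "D = transpose A" and B: "transpose B = B" and C: "transpose C = C"
      and AB: "A ** B = B ** transpose A" and AC: "transpose A ** C = C ** A"
      and AA: "A ** A - B ** C = mat 1"
      by (auto simp: M M_ABC_def block_mat_eq_iff)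
    have "transpose (A ** A - B ** C) = mat 1"
      by (simp add: AA)
    then have "transpose A ** transpose A - C ** B = mat 1"
      by (simp add: transp matrix_transpose_mul B C)
    moreover have "B ** C - A ** A = - mat 1"
      using AA by (metis minus_diff_eq)
    ultimately have "M \<in> Sp"
      unfolding Sp D B C by (simp add: AB AC)
    then show "M \<in> Sp_I"
      by (simp add: Sp_I_def inv IMI D B C)
  qed
qed


section \<open>GIT quotients\<close>

definition quotient_topology :: "'a topology \<Rightarrow> ('a \<Rightarrow> 'b) \<Rightarrow> 'b topology" where
  "quotient_topology X f =
     topology (\<lambda>U. U \<subseteq> f ` topspace X \<and> openin X {x \<in> topspace X. f x \<in> U})"

lemma openin_quotient_topology:
  "openin (quotient_topology X f) U \<longleftrightarrow>
   U \<subseteq> f ` topspace X \<and> openin X {x \<in> topspace X. f x \<in> U}"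
proof -
  have "istopology (\<lambda>U. U \<subseteq> f ` topspace X \<and> openin X {x \<in> topspace X. f x \<in> U})"
    unfolding istopology_def
  proof (intro conjI allI impI)
    fix S T
    assume "S \<subseteq> f ` topspace X \<and> openin X {x \<in> topspace X. f x \<in> S}"
      and "T \<subseteq> f ` topspace X \<and> openin X {x \<in> topspace X. f x \<in> T}"
    moreover have "{x \<in> topspace X. f x \<in> S \<inter> T} =
        {x \<in> topspace X. f x \<in> S} \<inter> {x \<in> topspace X. f x \<in> T}"
      by auto
    ultimately show "S \<inter> T \<subseteq> f ` topspace X" "openin X {x \<in> topspace X. f x \<in> S \<inter> T}"
      by auto
  next
    fix \<K>
    assume *: "\<forall>K\<in>\<K>. K \<subseteq> f ` topspace X \<and> openin X {x \<in> topspace X. f x \<in> K}"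
    then show "\<Union>\<K> \<subseteq> f ` topspace X"
      by blast
    have "{x \<in> topspace X. f x \<in> \<Union>\<K>} = (\<Union>K\<in>\<K>. {x \<in> topspace X. f x \<in> K})"
      by auto
    with * show "openin X {x \<in> topspace X. f x \<in> \<Union>\<K>}"
      by auto
  qed
  then show ?thesis
    by (simp add: quotient_topology_def topology_inverse')
qed

lemma topspace_quotient_topology [simp]:
  "topspace (quotient_topology X f) = f ` topspace X"
proof
  show "topspace (quotient_topology X f) \<subseteq> f ` topspace X"
    using openin_topspace [of "quotient_topology X f"]
    unfolding openin_quotient_topology by (rule conjunct1)
  have "{x \<in> topspace X. f x \<in> f ` topspace X} = topspace X"
    by auto
  then have "openin (quotient_topology X f) (f ` topspace X)"
    by (simp only: openin_quotient_topology openin_topspace subset_refl simp_thms)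
  then show "f ` topspace X \<subseteq> topspace (quotient_topology X f)"
    by (rule openin_subset)
qed

lemma quotient_map_quotient_topology: "quotient_map X (quotient_topology X f) f"
  by (simp add: quotient_map_def openin_quotient_topology)

definition orbit_closure ::
  "'x topology \<Rightarrow> 'g set \<Rightarrow> ('g \<Rightarrow> 'x \<Rightarrow> 'x) \<Rightarrow> 'x \<Rightarrow> 'x set" where
  "orbit_closure X G act x = X closure_of ((\<lambda>g. act g x) ` G)"

text \<open>
  This is an equivalence relation on \<open>topspace X\<close> only if it is transitive, which holds
  for both actions considered here.
\<close>

definition orbit_closure_rel ::
  "'x topology \<Rightarrow> 'g set \<Rightarrow> ('g \<Rightarrow> 'x \<Rightarrow> 'x) \<Rightarrow> ('x \<times> 'x) set" where
  "orbit_closure_rel X G act =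
     {(x, y). x \<in> topspace X \<and> y \<in> topspace X \<and>
              orbit_closure X G act x \<inter> orbit_closure X G act y \<noteq> {}}"

definition git_class ::
  "'x topology \<Rightarrow> 'g set \<Rightarrow> ('g \<Rightarrow> 'x \<Rightarrow> 'x) \<Rightarrow> 'x \<Rightarrow> 'x set" where
  "git_class X G act x = orbit_closure_rel X G act `` {x}"

definition git_quotient ::
  "'x topology \<Rightarrow> 'g set \<Rightarrow> ('g \<Rightarrow> 'x \<Rightarrow> 'x) \<Rightarrow> 'x set topology" where
  "git_quotient X G act = quotient_topology X (git_class X G act)"

lemma topspace_git_quotient:
  "topspace (git_quotient X G act) = topspace X // orbit_closure_rel X G act"
  by (auto simp: git_quotient_def git_class_def quotient_def)


section \<open>The two quotients and their projections\<close>

definition Sp_class :: "real^('n::finite + 'n)^('n + 'n) \<Rightarrow> (real^('n + 'n)^('n + 'n)) set" where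
  "Sp_class = git_class (top_of_set Sp) Sp Sp_act"

definition Sp_quotient :: "(real^('n::finite + 'n)^('n + 'n)) set topology" where
  "Sp_quotient = git_quotient (top_of_set Sp) Sp Sp_act"

definition Sp_I_class :: "real^('n::finite + 'n)^('n + 'n) \<Rightarrow> (real^('n + 'n)^('n + 'n)) set" where
  "Sp_I_class = git_class (top_of_set Sp_I) (GL :: (real^'n^'n) set) GL_act"

definition Sp_I_quotient :: "(real^('n::finite + 'n)^('n + 'n)) set topology" where
  "Sp_I_quotient = git_quotient (top_of_set Sp_I) (GL :: (real^'n^'n) set) GL_act"

text \<open>
  The descriptions below rely on every class having a representative \<open>M_ABC A B C\<close> in
  \<open>Sp_I\<close> (for \<open>p1\<close> this is Wonenburger's theorem) and on the value not depending on it.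
\<close>

definition p1 :: "(real^(2 + 2)^(2 + 2)) set \<Rightarrow> real \<times> real" where
  "p1 c = (THE v. \<exists>A B C. M_ABC A B C \<in> Sp_I \<and> c = Sp_class (M_ABC A B C) \<and>
                          v = (trace A, det A))"

definition p2 :: "(real^(2 + 2)^(2 + 2)) set \<Rightarrow> real \<times> real" where
  "p2 c = (THE v. \<exists>A B C. M_ABC A B C \<in> Sp_I \<and> c = Sp_I_class (M_ABC A B C) \<and>
                          v = (trace A, det A))"

definition Gamma_plus :: "(real \<times> real) set" where
  "Gamma_plus = {(\<tau>, \<tau> - 1) | \<tau>. True}"

definition Gamma_minus :: "(real \<times> real) set" where
  "Gamma_minus = {(\<tau>, - \<tau> - 1) | \<tau>. True}"

definition bifurcation_locus_1 :: "(real^(2 + 2)^(2 + 2)) set set" where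
  "bifurcation_locus_1 = {c \<in> topspace Sp_quotient. p1 c \<in> Gamma_plus \<union> Gamma_minus}"

definition bifurcation_locus_2 :: "(real^(2 + 2)^(2 + 2)) set set" where
  "bifurcation_locus_2 = {c \<in> topspace Sp_I_quotient. p2 c \<in> Gamma_plus \<union> Gamma_minus}"

end

theory Submission
  imports Defs
begin

text \<open>
  Components of the regular part of a GIT quotient can be counted upstairs: it suffices to separate
  representatives by invariant sets that are clopen in the regular part, and to join every regular point
  to a representative by group elements and paths.

  Off the bifurcation locus \<open>B\<close> is invertible, and \<open>M_ABC A B C\<close> is determined by the symmetric
  matrices \<open>P = B\<close> and \<open>2 Q = (A - 1) B\<close>.  This identifies the regular part of \<open>Sp_I\<close> with the pairs of
  binary forms for which \<open>P\<close>, \<open>Q\<close> and \<open>P + Q\<close> are nondegenerate, on which \<open>GL\<close> acts by congruence.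
  Such a pair is classified, up to congruence and paths, by the signatures of the three
  forms.  Of the 27 sign patterns, 8 contradict the fact that sums of definite forms of one sign are
  definite, which leaves 19.

  Every symplectic \<open>4 \<times> 4\<close> matrix is conjugate to an element of \<open>Sp_I\<close>, so the same 19 patterns
      exhaust the
  other quotient; there a quarter turn in a coordinate plane reverses the signs of the
  hyperbolic blocks, and 8 classes remain.  These are told apart by the position of \<open>(tr A, det A)\<close>
  and by the Krein form \<open>\<omega>(v, (M - M\<^sup>-\<^sup>1) v)\<close>.
\<close>

section \<open>GIT quotients away from an invariant closed locus\<close>

text \<open>Orbits off the bifurcation locus need not be closed, so a class can be larger than an
  orbit. As \<open>tr_inv\<close> and \<open>det_inv\<close> are continuous and invariant, limits of
  a regular orbit stay regular, and an invariant set that is clopen in the regular part contains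
  them; this makes it a union of classes. Conjugating \<open>M\<close> into \<open>Sp_I\<close>
  amounts to finding a symplectic basis adapted to \<open>H\<close> and \<open>Y\<close>. In
  dimension 4 the operator \<open>H\<close>, self-adjoint for an alternating form, satisfies a
  quadratic equation, and the construction splits according to its roots. The forms
  \<open>P\<close>, \<open>Q\<close> and \<open>- (P + Q)\<close> play symmetric parts: a definite
  one can be moved to the first place and used for simultaneous diagonalisation. Only the pattern
  with three indefinite forms has to be contracted directly; it contains hyperbolic, elliptic and
  nonreal spectra at once. Where one eigenvalue of \<open>A\<close> is above \<open>1\<close> and
  the other between \<open>-1\<close> and \<open>1\<close>, the Krein form takes both signs whatever
  the elliptic block is, so the sign has to be read on the elliptic eigenspace alone; this is the
  purpose of \<open>side_form\<close>. The mirror region at \<open>-1\<close> is handled through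
  \<open>- M\<close>.\<close>

locale git_action =
  fixes X :: "'x topology" and G :: "'g set" and act :: "'g \<Rightarrow> 'x \<Rightarrow> 'x"
  assumes G_ne: "G \<noteq> {}"
    and act_in: "g \<in> G \<Longrightarrow> x \<in> topspace X \<Longrightarrow> act g x \<in> topspace X"
    and act_comp: "g \<in> G \<Longrightarrow> h \<in> G \<Longrightarrow> x \<in> topspace X \<Longrightarrow> \<exists>k\<in>G. act g (act h x) = act k x"
    and act_inv: "g \<in> G \<Longrightarrow> x \<in> topspace X \<Longrightarrow> \<exists>k\<in>G. act k (act g x) = x"
begin

abbreviation cls :: "'x \<Rightarrow> 'x set" where "cls \<equiv> git_class X G act"

lemma orbit_act:
  assumes "g \<in> G" "x \<in> topspace X"
  shows "(\<lambda>h. act h (act g x)) ` G = (\<lambda>h. act h x) ` G"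
proof
  show "(\<lambda>h. act h (act g x)) ` G \<subseteq> (\<lambda>h. act h x) ` G"
    using act_comp assms by blast
  obtain k where k: "k \<in> G" "act k (act g x) = x"
    using act_inv assms by blast
  show "(\<lambda>h. act h x) ` G \<subseteq> (\<lambda>h. act h (act g x)) ` G"
  proof
    fix y assume "y \<in> (\<lambda>h. act h x) ` G"
    then obtain h where "h \<in> G" "y = act h (act k (act g x))"
      using k by auto
    then show "y \<in> (\<lambda>h. act h (act g x)) ` G"
      using act_comp [OF \<open>h \<in> G\<close> k(1) act_in [OF assms]] by auto
  qed
qed

lemma cls_act:
  assumes "g \<in> G" "x \<in> topspace X"
  shows "cls (act g x) = cls x"
  using assms act_in [OF assms]
  by (simp add: git_class_def orbit_closure_rel_def orbit_closure_def orbit_act Image_def)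

text \<open>\<open>x\<close> is related to itself, so equality of classes puts \<open>x\<close> into
  the class of \<open>y\<close>, and membership there says that the two orbit closures meet.\<close>

lemma cls_eqD:
  assumes "x \<in> topspace X" "y \<in> topspace X" "cls x = cls y"
  obtains z where "z \<in> orbit_closure X G act x" "z \<in> orbit_closure X G act y"
proof -
  obtain g where "g \<in> G"
    using G_ne by blast
  then have "act g x \<in> orbit_closure X G act x"
    unfolding orbit_closure_def using act_in assms(1)
    by (intro closure_of_subset [THEN subsetD]) auto
  then have "x \<in> cls x"
    using assms by (auto simp: git_class_def orbit_closure_rel_def)
  then have "x \<in> cls y"
    using assms(3) by blast
  then show ?thesis
    using that by (auto simp: git_class_def orbit_closure_rel_def)
qed

text \<open>The fibre of \<open>f\<close> through \<open>x\<close> contains the orbit and is closed,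
  because points of the Hausdorff space \<open>T\<close> are closed.\<close>

lemma invariant_orbit_closure:
  assumes "continuous_map X T f" "Hausdorff_space T"
    and inv: "\<And>g x. g \<in> G \<Longrightarrow> x \<in> topspace X \<Longrightarrow> f (act g x) = f x"
    and x: "x \<in> topspace X" and z: "z \<in> orbit_closure X G act x"
  shows "f z = f x"
proof -
  have "closedin T {f x}"
    using assms by (intro closedin_Hausdorff_singleton) (auto simp: continuous_map_def)
  then have "closedin X {y \<in> topspace X. f y \<in> {f x}}"
    by (rule closedin_continuous_map_preimage [OF assms(1)])
  moreover have "(\<lambda>g. act g x) ` G \<subseteq> {y \<in> topspace X. f y \<in> {f x}}"
    using act_in inv x by auto
  ultimately have "orbit_closure X G act x \<subseteq> {y \<in> topspace X. f y \<in> {f x}}"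
    unfolding orbit_closure_def by (intro closure_of_minimal)
  then show ?thesis
    using z by auto
qed

lemma invariant_cls:
  assumes "continuous_map X T f" "Hausdorff_space T"
    and "\<And>g x. g \<in> G \<Longrightarrow> x \<in> topspace X \<Longrightarrow> f (act g x) = f x"
    and "x \<in> topspace X" "y \<in> topspace X" "cls x = cls y"
  shows "f x = f y"
proof -
  obtain z where z: "z \<in> orbit_closure X G act x" "z \<in> orbit_closure X G act y"
    using cls_eqD [OF assms(4-6)] by blast
  show ?thesis
    using invariant_orbit_closure [OF assms(1-4) z(1)]
      invariant_orbit_closure [OF assms(1-3,5) z(2)] by simp
qed

lemma orbit_closure_meets_open:
  assumes "z \<in> orbit_closure X G act x" "openin X V" "z \<in> V"
  obtains g where "g \<in> G" "act g x \<in> V"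
  using assms unfolding orbit_closure_def in_closure_of by blast

end

locale git_locus = git_action X G act
  for X :: "'x topology" and G :: "'g set" and act +
  fixes T :: "'b topology" and f :: "'x \<Rightarrow> 'b" and U :: "'b set"
  assumes f_cont: "continuous_map X T f" and T_haus: "Hausdorff_space T"
    and f_inv: "\<And>g x. g \<in> G \<Longrightarrow> x \<in> topspace X \<Longrightarrow> f (act g x) = f x"
    and U_open: "openin T U"
begin

definition regular :: "'x set" where "regular = {x \<in> topspace X. f x \<in> U}"

definition regular_quotient :: "'x set topology" where
  "regular_quotient = subtopology (git_quotient X G act) (cls ` regular)"

lemma regular_subset: "regular \<subseteq> topspace X"
  by (auto simp: regular_def)

lemma topspace_regular_quotient: "topspace regular_quotient = cls ` regular"
  using regular_subset by (auto simp: regular_quotient_def git_quotient_def)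

text \<open>\<open>V\<close> is saturated. If \<open>y\<close> in \<open>V\<close> and
  \<open>x\<close> have the same class, take \<open>z\<close> in both orbit closures:
  \<open>f z = f y\<close> keeps \<open>z\<close> regular, and the orbit of \<open>y\<close> never
  meets the open set \<open>regular - V\<close>, so \<open>z\<close> lies in \<open>V\<close>. As
  \<open>V\<close> is open, the orbit of \<open>x\<close> enters it, and invariance brings
  \<open>x\<close> back.\<close>

lemma openin_cls_image:
  assumes V: "openin X V" "V \<subseteq> regular" and compl: "openin X (regular - V)"
    and inv: "\<And>g x. g \<in> G \<Longrightarrow> x \<in> V \<Longrightarrow> act g x \<in> V"
  shows "openin regular_quotient (cls ` V)" "{x \<in> topspace X. cls x \<in> cls ` V} = V"
proof -
  have "x \<in> V" if x: "x \<in> topspace X" and y: "y \<in> V" and eq: "cls x = cls y" for x y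
  proof -
    have y': "y \<in> topspace X" "y \<in> regular"
      using y V regular_subset by auto
    obtain z where z: "z \<in> orbit_closure X G act x" "z \<in> orbit_closure X G act y"
      using cls_eqD x y'(1) eq by metis
    have "f z = f y"
      by (rule invariant_orbit_closure [OF f_cont T_haus f_inv y'(1) z(2)])
    moreover have "z \<in> topspace X"
      using z(1) unfolding orbit_closure_def by (meson closure_of_subset_topspace subsetD)
    ultimately have "z \<in> regular"
      using y'(2) by (simp add: regular_def)
    moreover have "z \<notin> regular - V"
      using orbit_closure_meets_open [OF z(2) compl] inv y by blast
    ultimately have "z \<in> V"
      by blast
    then obtain g where "g \<in> G" "act g x \<in> V"
      using orbit_closure_meets_open [OF z(1) V(1)] by blast
    then show "x \<in> V"
      using act_inv [OF _ x] inv by metis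
  qed
  then show eq: "{x \<in> topspace X. cls x \<in> cls ` V} = V"
    using V regular_subset by auto
  have "openin (git_quotient X G act) (cls ` V)"
    unfolding git_quotient_def openin_quotient_topology eq
    using V regular_subset by blast
  moreover have "cls ` V \<subseteq> cls ` regular"
    using V by blast
  ultimately show "openin regular_quotient (cls ` V)"
    by (auto simp: regular_quotient_def openin_subtopology)
qed

lemma connected_component_cls:
  assumes "connectedin X S" "S \<subseteq> regular" "x \<in> S" "y \<in> S"
  shows "connected_component_of regular_quotient (cls x) (cls y)"
proof -
  have "continuous_map X (git_quotient X G act) cls"
    unfolding git_quotient_def by (rule quotient_imp_continuous_map [OF quotient_map_quotient_topology])
  then have "connectedin (git_quotient X G act) (cls ` S)"
    using assms(1) connectedin_continuous_map_image by blast
  then have "connectedin regular_quotient (cls ` S)"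
    using assms(2) by (auto simp: regular_quotient_def connectedin_subtopology)
  then show ?thesis
    using assms(3,4) unfolding connected_component_of_def by blast
qed

text \<open>\<open>sep\<close> makes the map from representatives to components injective, since a
  separating \<open>V\<close> and its complement in \<open>regular\<close> have disjoint open
  images; \<open>conn\<close> makes it surjective.\<close>

lemma card_components:
  assumes reps: "Reps \<subseteq> regular"
    and sep: "\<And>r s. r \<in> Reps \<Longrightarrow> s \<in> Reps \<Longrightarrow> r \<noteq> s \<Longrightarrow>
      \<exists>V. openin X V \<and> V \<subseteq> regular \<and> openin X (regular - V) \<and>
        (\<forall>g\<in>G. \<forall>x\<in>V. act g x \<in> V) \<and> (r \<in> V \<longleftrightarrow> s \<notin> V)"
    and conn: "\<And>x. x \<in> regular \<Longrightarrow>
      \<exists>r\<in>Reps. connected_component_of regular_quotient (cls x) (cls r)"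
  shows "card (connected_components_of regular_quotient) = card Reps"
proof -
  let ?c = "\<lambda>r. connected_component_of_set regular_quotient (cls r)"
  have "inj_on ?c Reps"
  proof (rule inj_onI, rule ccontr)
    fix r s assume rs: "r \<in> Reps" "s \<in> Reps" "?c r = ?c s" "r \<noteq> s"
    obtain V where V: "openin X V" "V \<subseteq> regular" "openin X (regular - V)"
        "\<And>g x. g \<in> G \<Longrightarrow> x \<in> V \<Longrightarrow> act g x \<in> V" "r \<in> V \<longleftrightarrow> s \<notin> V"
      using sep [OF rs(1,2,4)] by auto
    have inv': "act g x \<in> regular - V" if "g \<in> G" "x \<in> regular - V" for g x
    proof -
      have x: "x \<in> topspace X" "x \<in> regular" "x \<notin> V"
        using that regular_subset by auto
      obtain k where "k \<in> G" "act k (act g x) = x"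
        using act_inv [OF \<open>g \<in> G\<close> x(1)] by blast
      then have "act g x \<notin> V"
        using V(4) x by metis
      then show ?thesis
        using x that act_in f_inv by (auto simp: regular_def)
    qed
    have op: "openin regular_quotient (cls ` V)" "{x \<in> topspace X. cls x \<in> cls ` V} = V"
      "openin regular_quotient (cls ` (regular - V))"
      "{x \<in> topspace X. cls x \<in> cls ` (regular - V)} = regular - V"
      using openin_cls_image [OF V(1-4)] openin_cls_image [OF V(3) Diff_subset _ inv'] V(1,2)
      by (auto simp: double_diff)
    have rs_reg: "r \<in> regular" "s \<in> regular" "r \<in> topspace X" "s \<in> topspace X"
      using rs reps regular_subset by auto
    have "connected_component_of regular_quotient (cls r) (cls s)"
      using rs(3) connected_component_of_refl [of regular_quotient "cls s"] rs_reg
      by (metis (mono_tags) image_eqI mem_Collect_eq topspace_regular_quotient)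
    then obtain C where C: "connectedin regular_quotient C" "cls r \<in> C" "cls s \<in> C"
      unfolding connected_component_of_def by blast
    have "cls ` V \<union> cls ` (regular - V) = cls ` regular"
      using V(2) by blast
    then have "C \<subseteq> cls ` V \<union> cls ` (regular - V)"
      using C(1) by (simp add: connectedin_def topspace_regular_quotient)
    moreover have iff: "cls x \<in> cls ` V \<longleftrightarrow> x \<in> V"
      "cls x \<in> cls ` (regular - V) \<longleftrightarrow> x \<in> regular - V" if "x \<in> topspace X" for x
      using that eqset_imp_iff [OF op(2), of x] eqset_imp_iff [OF op(4), of x] by simp_all
    moreover have "cls ` V \<inter> cls ` (regular - V) \<inter> C = {}"
      using iff(1) regular_subset by auto
    moreover have "cls ` V \<inter> C \<noteq> {}" "cls ` (regular - V) \<inter> C \<noteq> {}"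
      using V(5) C(2,3) rs_reg by (cases "r \<in> V"; auto)+
    ultimately show False
      using C(1) op(1,3) unfolding connectedin by metis
  qed
  moreover have "?c ` Reps = connected_components_of regular_quotient"
  proof
    show "?c ` Reps \<subseteq> connected_components_of regular_quotient"
      using reps by (auto simp: connected_components_of_def topspace_regular_quotient)
    show "connected_components_of regular_quotient \<subseteq> ?c ` Reps"
    proof
      fix C assume "C \<in> connected_components_of regular_quotient"
      then obtain x where x: "x \<in> regular" "C = ?c x"
        by (auto simp: connected_components_of_def topspace_regular_quotient)
      then obtain r where r: "r \<in> Reps" "connected_component_of regular_quotient (cls x) (cls r)"
        using conn by blast
      then have "C = ?c r"
        using x(2) by (simp add: connected_component_of_equiv)
      then show "C \<in> ?c ` Reps"
        using r by blast
    qed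
  qed
  ultimately show ?thesis
    using card_image by metis
qed

end

section \<open>Normal bases for a symplectic endomorphism\<close>

text \<open>The expression is the off-diagonal entry, after a rotation, of the symmetric matrix with
  diagonal \<open>p\<close>, \<open>r\<close> and off-diagonal entry \<open>q\<close>. In the double
  angle it reads \<open>sin x * k + cos x * q\<close>, which vanishes when
  \<open>(cos x, sin x)\<close> points along \<open>(k, - q)\<close>.\<close>

lemma symmetric_form_rotation:
  fixes p q r :: real
  obtains c s where "c\<^sup>2 + s\<^sup>2 = 1" "c * s * (r - p) + (c\<^sup>2 - s\<^sup>2) * q = 0"
proof (cases "q = 0")
  case True
  then show ?thesis
    using that [of 1 0] by simp
next
  case False
  define k where "k = (r - p) / 2"
  define m where "m = sqrt (k\<^sup>2 + q\<^sup>2)"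
  have m: "m > 0" "m\<^sup>2 = k\<^sup>2 + q\<^sup>2"
    using False by (simp_all add: m_def add_nonneg_pos)
  have "(k / m)\<^sup>2 + (- q / m)\<^sup>2 = 1"
    using m False by (simp add: power_divide add_divide_distrib [symmetric])
  then obtain x where x: "k / m = cos x" "- q / m = sin x"
    using sincos_total_2pi by metis
  have h: "cos x = (cos (x/2))\<^sup>2 - (sin (x/2))\<^sup>2" "sin x = 2 * sin (x/2) * cos (x/2)"
    using cos_double [of "x/2"] sin_double [of "x/2"] by simp_all
  have "cos x * q + sin x * k = 0"
    unfolding x [symmetric] by simp
  then have "cos (x/2) * sin (x/2) * (r - p) + ((cos (x/2))\<^sup>2 - (sin (x/2))\<^sup>2) * q = 0"
    unfolding h k_def by (simp add: field_simps)
  then show ?thesis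
    using that [of "cos (x/2)" "sin (x/2)"] by simp
qed

text \<open>
  \<open>H\<close> and \<open>Y\<close> stand for \<open>(M + M\<^sup>-\<^sup>1) / 2\<close> and \<open>M - M\<^sup>-\<^sup>1\<close>.
\<close>

locale symplectic_pencil =
  fixes w :: "'v::euclidean_space \<Rightarrow> 'v \<Rightarrow> real" and H Y :: "'v \<Rightarrow> 'v" and t d :: real
  assumes w: "bilinear w" and alt: "w v v = 0"
    and nondeg: "(\<And>v. w u v = 0) \<Longrightarrow> u = 0"
    and H: "linear H" and Y: "linear Y"
    and H_sym: "w (H u) v = w u (H v)"
    and Y_skew: "w (Y u) v = - w u (Y v)"
    and comm: "H (Y u) = Y (H u)"
    and YY: "Y (Y u) = 4 *\<^sub>R (H (H u) - u)"
    and HH: "H (H u) = t *\<^sub>R H u - d *\<^sub>R u"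
    and dim: "DIM('v) > 2"
begin

lemmas lin = bilinear_ladd [OF w] bilinear_radd [OF w] bilinear_lmul [OF w] bilinear_rmul [OF w]
  bilinear_lneg [OF w] bilinear_rneg [OF w] bilinear_lzero [OF w] bilinear_rzero [OF w]
  bilinear_lsub [OF w] bilinear_rsub [OF w]
  linear_add [OF H] linear_scale [OF H] linear_diff [OF H] linear_neg [OF H] linear_0 [OF H]
  linear_add [OF Y] linear_scale [OF Y] linear_diff [OF Y] linear_neg [OF Y] linear_0 [OF Y]

lemma antisym: "w u v = - w v u"
proof -
  have "w u v + w v u = 0"
    using alt [of "u + v"] by (simp add: lin alt [of u] alt [of v])
  then show ?thesis
    by linarith
qed

lemma w_H [simp]: "w v (H v) = 0"
  using antisym [of v "H v"] by (simp add: H_sym)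

lemmas calc = lin alt H_sym Y_skew comm YY HH

lemma Y_form_sym: "w u (Y v) = w v (Y u)"
  by (metis Y_skew antisym minus_equation_iff)

text \<open>In a basis of this kind the matrix of \<open>M\<close> belongs to \<open>Sp_I\<close>.\<close>

definition good :: "'v \<Rightarrow> 'v \<Rightarrow> 'v \<Rightarrow> 'v \<Rightarrow> bool" where
  "good e1 e2 f1 f2 \<longleftrightarrow>
     w e1 f1 = 1 \<and> w e2 f2 = 1 \<and> w e1 f2 = 0 \<and> w e2 f1 = 0 \<and> w e1 e2 = 0 \<and> w f1 f2 = 0 \<and>
     w e1 (Y f1) = 0 \<and> w e1 (Y f2) = 0 \<and> w e2 (Y f1) = 0 \<and> w e2 (Y f2) = 0 \<and>
     w e1 (H e2) = 0 \<and> w f1 (H f2) = 0"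

text \<open>A rotation in the plane of \<open>e\<close> and \<open>f\<close> preserves
  \<open>w e f\<close>, so the symmetric form \<open>w u (Y v)\<close> can be diagonalised there
  without spoiling a symplectic pair.\<close>

lemma rotate_pair:
  obtains c s where "c\<^sup>2 + s\<^sup>2 = 1"
    "w (c *\<^sub>R e + s *\<^sub>R f) (Y (- s *\<^sub>R e + c *\<^sub>R f)) = 0"
proof -
  obtain c s where cs: "c\<^sup>2 + s\<^sup>2 = 1"
    "c * s * (w f (Y f) - w e (Y e)) + (c\<^sup>2 - s\<^sup>2) * w e (Y f) = 0"
    using symmetric_form_rotation by metis
  have "w (c *\<^sub>R e + s *\<^sub>R f) (Y (- s *\<^sub>R e + c *\<^sub>R f)) =
      c * s * (w f (Y f) - w e (Y e)) + (c\<^sup>2 - s\<^sup>2) * w e (Y f)"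
    by (simp add: lin Y_form_sym [of f e] algebra_simps power2_eq_square)
  then show ?thesis
    using that cs by simp
qed

text \<open>On the kernel of \<open>Y\<close> the relation \<open>YY\<close> becomes
  \<open>H (H v) = v\<close>, so \<open>v\<close> or \<open>H v + v\<close> is an eigenvector of
  \<open>H\<close> for \<open>-1\<close> or \<open>1\<close>. That eigenvalue is then a root of
  \<open>X^2 - t X + d\<close>.\<close>

lemma kernel_Y:
  assumes "Y v = 0" "v \<noteq> 0"
  shows "1 - t + d = 0 \<or> 1 + t + d = 0"
proof -
  have v: "H (H v) = v"
    using YY [of v] assms by (simp add: lin)
  then have eq: "t *\<^sub>R H v = (1 + d) *\<^sub>R v"
    using HH [of v] by (simp add: algebra_simps)
  show ?thesis
  proof (cases "H v + v = 0")
    case True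
    then have "H v = - v"
      by (simp add: add_eq_0_iff2)
    then have "(1 + t + d) *\<^sub>R v = (1 + d) *\<^sub>R v - t *\<^sub>R H v"
      by (simp add: algebra_simps)
    then have "(1 + t + d) *\<^sub>R v = 0"
      using eq by simp
    then show ?thesis
      using assms by simp
  next
    case False
    have "t *\<^sub>R (H v + v) = (1 + d) *\<^sub>R (H v + v)"
    proof -
      have "t *\<^sub>R v = (1 + d) *\<^sub>R H v"
        using arg_cong [OF eq, of H] v by (simp add: lin)
      then show ?thesis
        using eq by (simp add: scaleR_add_right)
    qed
    then have "(1 - t + d) *\<^sub>R (H v + v) = 0"
      by (simp add: algebra_simps)
    then show ?thesis
      using False by simp
  qed
qed

lemma Y_eq_0:
  assumes "\<And>v. w v (Y v) = 0"
  shows "Y u = 0"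
proof (rule nondeg)
  fix v
  have "w (u + v) (Y (u + v)) = 2 * w v (Y u)"
    using assms Y_form_sym [of u v] by (simp add: lin)
  then have "w v (Y u) = 0"
    using assms by simp
  then show "w (Y u) v = 0"
    using antisym [of "Y u" v] by simp
qed

text \<open>The assumption concerns the Gram determinant of the form \<open>w x (Y y)\<close> on
  \<open>v\<close>, \<open>H v\<close>. The spans of \<open>v\<close>, \<open>H v\<close> and of
  \<open>Y v\<close>, \<open>Y (H v)\<close> are isotropic, and inverting the Gram matrix yields in
  the second a basis dual to the first. \<open>Y\<close> maps each span into the other because
  \<open>Y (Y x)\<close> is a polynomial in \<open>H\<close> applied to \<open>x\<close>.\<close>

lemma good_cyclic:
  assumes D: "w v (Y v) * (t * w v (Y (H v)) - d * w v (Y v)) - (w v (Y (H v)))\<^sup>2 \<noteq> 0"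
  shows "\<exists>e1 e2 f1 f2. good e1 e2 f1 f2"
proof -
  define a b g where "a = w v (Y v)" and "b = w v (Y (H v))" and "g = t * b - d * a"
  define D where "D = a * g - b\<^sup>2"
  have D0: "D \<noteq> 0"
    using D by (simp add: D_def a_def b_def g_def)
  have bil: "w v (Y v) = a" "w v (Y (H v)) = b"
    by (simp_all add: a_def b_def)
  have "good v (H v) (inverse D *\<^sub>R (g *\<^sub>R Y v - b *\<^sub>R Y (H v))) (inverse D *\<^sub>R (a *\<^sub>R Y (H v) - b
      *\<^sub>R Y v))"
    unfolding good_def using D0
    by (simp add: calc bil field_simps) (simp add: D_def g_def algebra_simps power2_eq_square)
  then show ?thesis
    by blast
qed

text \<open>With \<open>H\<close> scalar, the conditions on \<open>H\<close> follow from those on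
  \<open>w\<close>. A symplectic plane in which \<open>Y\<close> sends each axis into the other is
  split off, and the Krein form is diagonalised in its orthogonal complement, which is nonzero
  because the dimension exceeds 2.\<close>

lemma good_scalar:
  assumes scal: "\<And>v. H v = h *\<^sub>R v"
  shows "\<exists>e1 e2 f1 f2. good e1 e2 f1 f2"
proof -
  have "\<exists>e f k l. w e f = 1 \<and> Y e = k *\<^sub>R f \<and> Y f = l *\<^sub>R e"
  proof (cases "\<forall>v. w v (Y v) = 0")
    case True
    then have "Y u = 0" for u
      using Y_eq_0 by blast
    moreover obtain e :: 'v where "e \<noteq> 0"
      using nonempty_Basis nonzero_Basis by blast
    then obtain f where "w e f \<noteq> 0"
      using nondeg by blast
    ultimately show ?thesis
      by (intro exI [of _ e] exI [of _ "inverse (w e f) *\<^sub>R f"] exI [of _ 0]) (simp add: lin)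
  next
    case False
    then obtain v where v: "w v (Y v) \<noteq> 0"
      by blast
    show ?thesis
      by (rule exI [of _ v], rule exI [of _ "inverse (w v (Y v)) *\<^sub>R Y v"],
          rule exI [of _ "w v (Y v)"], rule exI [of _ "inverse (w v (Y v)) * (4 * (h\<^sup>2 - 1))"])
        (use v in \<open>simp add: lin YY scal power2_eq_square algebra_simps\<close>)
  qed
  then obtain e f k l where ef: "w e f = 1" "Y e = k *\<^sub>R f" "Y f = l *\<^sub>R e"
    by blast
  have fe: "w f e = - 1"
    using antisym [of f e] ef by simp
  have "span {e, f} \<noteq> UNIV"
  proof
    assume "span {e, f} = UNIV"
    then have "DIM('v) \<le> card {e, f}"
      using dim_le_card [of UNIV "{e, f}"] by simp
    also have "card {e, f} \<le> 2"
      by (simp add: card_insert_le_m1)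
    finally show False
      using dim by simp
  qed
  then obtain u where u: "u \<notin> span {e, f}"
    by blast
  \<comment> \<open>Projection along the plane of \<open>e\<close> and \<open>f\<close> onto its
    \<open>w\<close>-orthogonal complement.\<close>
  define \<pi> where "\<pi> x = x - w x f *\<^sub>R e + w x e *\<^sub>R f" for x
  have \<pi>: "w e (\<pi> x) = 0" "w f (\<pi> x) = 0" for x
    using antisym [of e x] antisym [of f x] by (simp_all add: \<pi>_def lin alt ef fe)
  have "\<pi> u \<noteq> 0"
  proof
    assume "\<pi> u = 0"
    then have "u = w u f *\<^sub>R e - w u e *\<^sub>R f"
      by (simp add: \<pi>_def algebra_simps add_eq_0_iff2)
    then show False
      using u by (metis insertI1 insert_commute span_base span_diff span_scale)
  qed
  then obtain x where x: "w (\<pi> u) x \<noteq> 0"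
    using nondeg by blast
  define a where "a = \<pi> u"
  define b where "b = inverse (w (\<pi> u) x) *\<^sub>R \<pi> x"
  have \<pi>': "w (\<pi> x) e = 0" "w (\<pi> x) f = 0" for x
    using \<pi> antisym by (metis neg_equal_0_iff_equal)+
  have "w (\<pi> u) (\<pi> x) = w (\<pi> u) x"
    by (simp add: \<pi>_def [of x] lin \<pi>')
  then have ab: "w a b = 1" "w e a = 0" "w e b = 0" "w f a = 0" "w f b = 0"
    "w a e = 0" "w b e = 0" "w a f = 0" "w b f = 0"
    using x by (simp_all add: a_def b_def lin \<pi> \<pi>')
  have ba: "w b a = - 1"
    using antisym [of b a] ab by simp
  have Yab: "w e (Y a) = 0" "w e (Y b) = 0" 
    using Y_form_sym [of e a] Y_form_sym [of e b] by (simp_all add: ef lin ab)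
  obtain c s where cs: "c\<^sup>2 + s\<^sup>2 = 1"
    and rot: "w (c *\<^sub>R a + s *\<^sub>R b) (Y (- s *\<^sub>R a + c *\<^sub>R b)) = 0"
    by (rule rotate_pair [of a b])
  have "good e (c *\<^sub>R a + s *\<^sub>R b) f (- s *\<^sub>R a + c *\<^sub>R b)"
    unfolding good_def using cs rot
    by (simp add: scal lin ab ba ef Yab alt power2_eq_square)
  then show ?thesis
    by blast
qed

text \<open>The eigenspaces of \<open>H\<close> for \<open>m1\<close> and \<open>m2\<close> are
  \<open>w\<close>-orthogonal, and stable under \<open>Y\<close> since \<open>Y\<close> commutes
  with \<open>H\<close>. Each contains a symplectic pair on which the Krein form is
  diagonal.\<close>

lemma good_distinct:
  assumes "m1 \<noteq> m2" "t = m1 + m2" "d = m1 * m2" "H u \<noteq> m1 *\<^sub>R u" "H v \<noteq> m2 *\<^sub>R v"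
  shows "\<exists>e1 e2 f1 f2. good e1 e2 f1 f2"
proof -
  have step: "\<exists>e f. w e f = 1 \<and> H e = a *\<^sub>R e \<and> H f = a *\<^sub>R f \<and> w e (Y f) = 0"
    if ab: "a \<noteq> b" "t = a + b" "d = a * b" and u: "H u \<noteq> b *\<^sub>R u" for a b u
  proof -
    \<comment> \<open>By \<open>HH\<close> the product \<open>(H - a) (H - b)\<close> is zero, so
      the image of \<open>\<pi>\<close> lies in the eigenspace of \<open>a\<close>.\<close>
    define \<pi> where "\<pi> x = H x - b *\<^sub>R x" for x
    have H\<pi>: "H (\<pi> x) = a *\<^sub>R \<pi> x" for x
      by (simp add: \<pi>_def calc ab algebra_simps)
    have "\<pi> u \<noteq> 0"
      using u by (simp add: \<pi>_def)
    then obtain x where x: "w (\<pi> u) x \<noteq> 0"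
      using nondeg by blast
    have "w (\<pi> u) (\<pi> x) = (a - b) * w (\<pi> u) x"
    proof -
      have "w (\<pi> u) (H x) = w (H (\<pi> u)) x"
        by (simp add: H_sym)
      then have "w (\<pi> u) (H x) = a * w (\<pi> u) x"
        by (simp add: H\<pi> lin)
      then show ?thesis
        by (simp add: \<pi>_def [of x] lin algebra_simps)
    qed
    then have x': "w (\<pi> u) (\<pi> x) \<noteq> 0"
      using x ab by simp
    define e f where "e = \<pi> u" and "f = inverse (w (\<pi> u) (\<pi> x)) *\<^sub>R \<pi> x"
    have ef: "w e f = 1" "H e = a *\<^sub>R e" "H f = a *\<^sub>R f"
      using x' by (simp_all add: e_def f_def lin H\<pi>)
    then have fe: "w f e = -1"
      using antisym [of f e] by simp
    obtain c s where cs: "c\<^sup>2 + s\<^sup>2 = 1"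
      and rot: "w (c *\<^sub>R e + s *\<^sub>R f) (Y (- s *\<^sub>R e + c *\<^sub>R f)) = 0"
      by (rule rotate_pair [of e f])
    then show ?thesis
      by (intro exI [of _ "c *\<^sub>R e + s *\<^sub>R f"] exI [of _ "- s *\<^sub>R e + c *\<^sub>R f"])
        (simp add: lin ef fe alt power2_eq_square algebra_simps)
  qed
  obtain e1 f1 where 1: "w e1 f1 = 1" "H e1 = m1 *\<^sub>R e1" "H f1 = m1 *\<^sub>R f1" "w e1 (Y f1) = 0"
    using step [of m1 m2 v] assms by auto
  obtain e2 f2 where 2: "w e2 f2 = 1" "H e2 = m2 *\<^sub>R e2" "H f2 = m2 *\<^sub>R f2" "w e2 (Y f2) = 0"
    using step [of m2 m1 u] assms by (auto simp: algebra_simps)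
  have orth: "w x y = 0" if "H x = m1 *\<^sub>R x" "H y = m2 *\<^sub>R y" for x y
    using H_sym [of x y] assms(1) by (simp add: that lin)
  have HY: "H (Y y) = m *\<^sub>R Y y" if "H y = m *\<^sub>R y" for y m
    by (simp add: comm that lin)
  have "w e1 (Y f2) = 0" "w e2 (Y f1) = 0" "w e1 f2 = 0" "w f1 e2 = 0" "w e1 e2 = 0" "w f1 f2 = 0"
    using orth 1 2 HY Y_form_sym [of e2 f1] by simp_all
  then have "good e1 e2 f1 f2"
    unfolding good_def using 1 2 antisym [of e2 f1] by (simp add: lin)
  then show ?thesis
    by blast
qed

text \<open>\<open>N = H - m\<close> squares to zero. If \<open>w v (Y (N v))\<close> is nonzero for
  some \<open>v\<close>, the cyclic construction applies, with Gram determinant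
  \<open>- (w v (Y (N v)))^2\<close>. Otherwise \<open>Y\<close> kills the image of
  \<open>N\<close>, and a basis of the shape \<open>p, N p, N q, q\<close> is built from a pair dual
  under the alternating form \<open>w x (N y)\<close>.\<close>

lemma good_double:
  assumes "t = 2 * m" "d = m\<^sup>2" "H u \<noteq> m *\<^sub>R u"
  shows "\<exists>e1 e2 f1 f2. good e1 e2 f1 f2"
proof -
  define N where "N x = H x - m *\<^sub>R x" for x
  have N_lin: "N (x + y) = N x + N y" "N (x - y) = N x - N y" "N (k *\<^sub>R x) = k *\<^sub>R N x" for x y k
    by (simp_all add: N_def lin algebra_simps)
  have t: "t *\<^sub>R x = m *\<^sub>R x + m *\<^sub>R x" for x :: 'v
    using assms scaleR_add_left [of m m x] by simp
  have NN: "N (N x) = 0" for x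
    by (simp add: N_def calc t assms(2) algebra_simps power2_eq_square)
  have N_sym: "w (N x) y = w x (N y)" for x y
    by (simp add: N_def lin H_sym)
  have HN: "H x = N x + m *\<^sub>R x" for x
    by (simp add: N_def)
  have NYc: "N (Y x) = Y (N x)" for x
    by (simp add: N_def lin comm)
  have wN: "w x (N x) = 0" for x
    by (simp add: N_def lin alt)
  show ?thesis
  proof (cases "\<exists>v. w v (Y (N v)) \<noteq> 0")
    case True
    then obtain v where v: "w v (Y (N v)) \<noteq> 0"
      by blast
    have "w v (Y v) * (t * w v (Y (H v)) - d * w v (Y v)) - (w v (Y (H v)))\<^sup>2 = - (w v (Y (N v)))\<^sup>2"
      by (simp add: HN lin assms algebra_simps power2_eq_square)
    then show ?thesis
      using v by (intro good_cyclic [of v]) simp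
  next
    case False
    have YN: "Y (N x) = 0" for x
    proof (rule nondeg)
      fix y
      have "w y (Y (N x)) = w x (Y (N y))"
        by (metis N_sym NYc Y_form_sym)
      then have "w (x + y) (Y (N (x + y))) = 2 * w y (Y (N x))"
        using False by (simp add: lin N_lin)
      then show "w (Y (N x)) y = 0"
        using False antisym [of "Y (N x)" y] by simp
    qed
    have "N u \<noteq> 0"
      using assms by (simp add: N_def)
    then obtain x where x: "w (N u) x \<noteq> 0"
      using nondeg by blast
    define v where "v = inverse (w (N u) x) *\<^sub>R x"
    have uv: "w u (N v) = 1"
      using x by (simp add: v_def N_sym [symmetric] lin)
    have vu: "w v (N u) = - 1"
      using antisym [of v "N u"] uv by (simp add: N_sym)
    obtain c s where cs: "c\<^sup>2 + s\<^sup>2 = 1"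
      and rot: "w (c *\<^sub>R u + s *\<^sub>R v) (Y (- s *\<^sub>R u + c *\<^sub>R v)) = 0"
      by (rule rotate_pair [of u v])
    define p q where "p = c *\<^sub>R u + s *\<^sub>R v" and "q = - s *\<^sub>R u + c *\<^sub>R v"
    have Npq: "w p (N q) = 1"
      using cs by (simp add: p_def q_def N_lin lin wN uv vu power2_eq_square)
    have pq: "w p (Y q) = 0"
      using rot by (simp add: p_def q_def)
    have "w q (N p) = - 1"
      using antisym [of q "N p"] Npq by (simp add: N_sym)
    \<comment> \<open>Subtracting \<open>w p q\<close> times \<open>N q\<close> makes the last
      vector orthogonal to \<open>p\<close>, because \<open>w p (N q) = 1\<close>.\<close>
    then have "good p (N p) (N q) (q - w p q *\<^sub>R N q)"
      unfolding good_def HN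
      by (simp add: lin N_sym NN N_lin wN Npq pq YN NYc alt)
    then show ?thesis
      by blast
  qed
qed

text \<open>The cases follow the roots of \<open>X^2 - t X + d\<close>. For nonreal roots neither
  \<open>1\<close> nor \<open>-1\<close> is a root, so \<open>Y\<close> is nonzero and a vector with
  nonzero Krein value is available.\<close>

lemma exists_good: "\<exists>e1 e2 f1 f2. good e1 e2 f1 f2"
proof (cases "t\<^sup>2 < 4 * d")
  case True
  have "1 - t + d \<noteq> 0" "1 + t + d \<noteq> 0"
  proof -
    have "(t - 2)\<^sup>2 \<ge> 0" "(t + 2)\<^sup>2 \<ge> 0"
      by simp_all
    then show "1 - t + d \<noteq> 0" "1 + t + d \<noteq> 0"
      using True by (auto simp: power2_eq_square algebra_simps)
  qed
  moreover obtain e :: 'v where "e \<noteq> 0"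
    using nonempty_Basis nonzero_Basis by blast
  ultimately obtain v where v: "w v (Y v) \<noteq> 0"
    using kernel_Y Y_eq_0 by blast
  let ?a = "w v (Y v)" and ?b = "w v (Y (H v))"
  \<comment> \<open>Completing the square shows that the Gram determinant of
    \<open>good_cyclic\<close> is negative once \<open>?a\<close> is nonzero.\<close>
  have "4 * (?a * (t * ?b - d * ?a) - ?b\<^sup>2) = - (2 * ?b - t * ?a)\<^sup>2 - (4 * d - t\<^sup>2) * ?a\<^sup>2"
    by (simp add: power2_eq_square algebra_simps)
  moreover have "(4 * d - t\<^sup>2) * ?a\<^sup>2 > 0"
    using True v by simp
  ultimately have "?a * (t * ?b - d * ?a) - ?b\<^sup>2 \<noteq> 0"
    by (smt (verit) zero_le_power2)
  then show ?thesis
    by (rule good_cyclic)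
next
  case False
  define r where "r = sqrt (t\<^sup>2 - 4 * d)"
  have r: "r\<^sup>2 = t\<^sup>2 - 4 * d"
    using False by (simp add: r_def)
  define m1 m2 where "m1 = (t - r) / 2" and "m2 = (t + r) / 2"
  have m: "t = m1 + m2" "d = m1 * m2"
    using r by (simp_all add: m1_def m2_def power2_eq_square field_simps)
  show ?thesis
  proof (cases "(\<forall>v. H v = m1 *\<^sub>R v) \<or> (\<forall>v. H v = m2 *\<^sub>R v)")
    case True
    then show ?thesis
      using good_scalar by blast
  next
    case F: False
    show ?thesis
    proof (cases "m1 = m2")
      case True
      then show ?thesis
        using good_double [of m1] m F by (auto simp: power2_eq_square)
    next
      case False
      then show ?thesis
        using good_distinct [of m1 m2] m F by blast
    qed
  qed
qed

end

section \<open>Pencils of binary quadratic forms\<close>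

text \<open>\<open>(p, q, r)\<close> encodes the symmetric matrix with diagonal \<open>p\<close>,
  \<open>r\<close> and off-diagonal entry \<open>q\<close>. As triples the forms make up a real
  vector space, in which segments can serve as paths.\<close>

type_synonym sym2 = "real \<times> real \<times> real"

definition det2 :: "sym2 \<Rightarrow> real" where
  "det2 = (\<lambda>(p, q, r). p * r - q\<^sup>2)"

definition posdef :: "sym2 \<Rightarrow> bool" where
  "posdef P \<longleftrightarrow> det2 P > 0 \<and> fst P > 0"

definition negdef :: "sym2 \<Rightarrow> bool" where
  "negdef P \<longleftrightarrow> det2 P > 0 \<and> fst P < 0"

text \<open>The entries of \<open>R P R^T\<close> for \<open>R\<close> with rows
  \<open>(a, b)\<close> and \<open>(c, e)\<close>.\<close>

definition congr :: "real \<Rightarrow> real \<Rightarrow> real \<Rightarrow> real \<Rightarrow> sym2 \<Rightarrow> sym2" where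
  "congr a b c e = (\<lambda>(p, q, r).
     (a\<^sup>2 * p + 2 * a * b * q + b\<^sup>2 * r,
      a * c * p + (a * e + b * c) * q + b * e * r,
      c\<^sup>2 * p + 2 * c * e * q + e\<^sup>2 * r))"

lemma det2_congr: "det2 (congr a b c e P) = (a * e - b * c)\<^sup>2 * det2 P"
  by (cases P) (simp add: det2_def congr_def power2_eq_square algebra_simps)

lemma congr_add: "congr a b c e (P + Q) = congr a b c e P + congr a b c e Q"
  by (cases P; cases Q) (simp add: congr_def algebra_simps)

lemma congr_uminus: "congr a b c e (- P) = - congr a b c e P"
  by (cases P) (simp add: congr_def algebra_simps)

lemma det2_uminus: "det2 (- P) = det2 P" "det2 (- Q - P) = det2 (P + Q)"
proof -
  show *: "det2 (- P) = det2 P" for P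
    by (cases P) (simp add: det2_def)
  show "det2 (- Q - P) = det2 (P + Q)"
    using * [of "P + Q"] by (metis add.commute minus_add_distrib uminus_add_conv_diff)
qed

lemma definite_uminus:
  "posdef (- P) = negdef P" "negdef (- P) = posdef P"
  "posdef (- Q - P) = negdef (P + Q)" "negdef (- Q - P) = posdef (P + Q)"
proof -
  show *: "posdef (- P) = negdef P" "negdef (- P) = posdef P" for P
    by (simp_all add: posdef_def negdef_def det2_uminus)
  show "posdef (- Q - P) = negdef (P + Q)" "negdef (- Q - P) = posdef (P + Q)"
    using * [of "P + Q"] by (metis add.commute minus_add_distrib uminus_add_conv_diff)+
qed

text \<open>Completing the square writes \<open>p\<close> times the new leading entry as a square
  plus \<open>det2 P * b^2\<close>.\<close>

lemma posdef_congr_imp: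
  assumes "a * e - b * c \<noteq> 0" "posdef P"
  shows "posdef (congr a b c e P)"
proof -
  obtain p q r where P: "P = (p, q, r)"
    by (cases P)
  have p: "p > 0" "p * r - q\<^sup>2 > 0"
    using assms by (auto simp: posdef_def P det2_def)
  have "p * (a\<^sup>2 * p + 2 * a * b * q + b\<^sup>2 * r) = (a * p + b * q)\<^sup>2 + (p * r - q\<^sup>2) * b\<^sup>2"
    by (simp add: power2_eq_square algebra_simps)
  also have "\<dots> > 0"
  proof (cases "b = 0")
    case True
    then show ?thesis
      using assms p by simp
  next
    case False
    then show ?thesis
      using p by (intro add_nonneg_pos) simp_all
  qed
  finally have "a\<^sup>2 * p + 2 * a * b * q + b\<^sup>2 * r > 0"
    using p(1) by (simp add: zero_less_mult_iff)
  moreover have "det2 (congr a b c e P) > 0"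
    using assms by (simp add: det2_congr posdef_def)
  ultimately show ?thesis
    by (simp add: posdef_def P congr_def)
qed

lemma not_negdef_posdef: "posdef P \<Longrightarrow> \<not> negdef P"
  by (simp add: posdef_def negdef_def)

lemma definite_iff: "det2 P > 0 \<longleftrightarrow> posdef P \<or> negdef P"
proof -
  have "fst P \<noteq> 0" if "det2 P > 0"
    using that by (cases P) (auto simp: det2_def)
  then show ?thesis
    by (auto simp: posdef_def negdef_def neq_iff)
qed

lemma posdef_congr:
  assumes "a * e - b * c \<noteq> 0"
  shows "posdef (congr a b c e P) \<longleftrightarrow> posdef P"
proof -
  have "negdef (congr a b c e P)" if "negdef P"
    using that posdef_congr_imp [OF assms] by (metis congr_uminus definite_uminus(1))
  moreover have "det2 (congr a b c e P) > 0 \<longleftrightarrow> det2 P > 0"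
    using assms by (simp add: det2_congr zero_less_mult_iff)
  ultimately show ?thesis
    using posdef_congr_imp [OF assms] by (metis definite_iff not_negdef_posdef)
qed

lemma negdef_congr:
  assumes "a * e - b * c \<noteq> 0"
  shows "negdef (congr a b c e P) \<longleftrightarrow> negdef P"
  by (metis assms posdef_congr congr_uminus definite_uminus(1))

section \<open>Joining pencils with the same three signatures\<close>

definition Pencils :: "(sym2 \<times> sym2) set" where
  "Pencils = {(P, Q). det2 P \<noteq> 0 \<and> det2 Q \<noteq> 0 \<and> det2 (P + Q) \<noteq> 0}"

definition pencil_congr :: "real \<Rightarrow> real \<Rightarrow> real \<Rightarrow> real \<Rightarrow> sym2 \<times> sym2 \<Rightarrow> sym2 \<times> sym2" where
  "pencil_congr a b c e = map_prod (congr a b c e) (congr a b c e)"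

text \<open>Congruences are steps in their own right, since the general linear group has two
  components and a congruence need not come from a path; in the quotient it does not move the class
  at all.\<close>

definition pencil_step :: "sym2 \<times> sym2 \<Rightarrow> sym2 \<times> sym2 \<Rightarrow> bool" where
  "pencil_step x y \<longleftrightarrow> x \<in> Pencils \<and> y \<in> Pencils \<and>
     ((\<exists>a b c e. a * e - b * c \<noteq> 0 \<and> y = pencil_congr a b c e x) \<or> closed_segment x y \<subseteq> Pencils)"

text \<open>On \<open>Pencils\<close> a form with both flags false is indefinite, so the six flags
  record exactly the three signatures.\<close>

definition pencil_type :: "sym2 \<times> sym2 \<Rightarrow> bool list" where
  "pencil_type = (\<lambda>(P, Q). [posdef P, negdef P, posdef Q, negdef Q, posdef (P + Q), negdef (P + Q)])"

definition pencil_rel :: "sym2 \<times> sym2 \<Rightarrow> sym2 \<times> sym2 \<Rightarrow> bool" where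
  "pencil_rel x y \<longleftrightarrow> y \<in> Pencils \<and> pencil_type x = pencil_type y \<and> equivclp pencil_step x y"

lemma pencil_rel_trans: "pencil_rel x y \<Longrightarrow> pencil_rel y z \<Longrightarrow> pencil_rel x z"
  by (auto simp: pencil_rel_def intro: equivclp_trans)

lemma pencil_rel_congr:
  assumes "x \<in> Pencils" "a * e - b * c \<noteq> 0"
  shows "pencil_rel x (pencil_congr a b c e x)"
proof -
  obtain P Q where x: "x = (P, Q)"
    by (cases x)
  have "pencil_congr a b c e x \<in> Pencils"
    using assms by (simp add: x Pencils_def pencil_congr_def det2_congr congr_add [symmetric])
  moreover have "pencil_type x = pencil_type (pencil_congr a b c e x)"
    using assms by (simp add: x pencil_type_def pencil_congr_def posdef_congr negdef_congr
        congr_add [symmetric])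
  moreover from this have "pencil_step x (pencil_congr a b c e x)"
    unfolding pencil_step_def using assms \<open>pencil_congr a b c e x \<in> Pencils\<close> by blast
  ultimately show ?thesis
    by (simp add: pencil_rel_def r_into_equivclp)
qed

text \<open>Transports connections along the linear symmetries of \<open>Pencils\<close>: negation,
  exchange of \<open>P\<close> and \<open>Q\<close>, and the shear to
  \<open>(P + Q, - Q)\<close>.\<close>

lemma pencil_step_map:
  assumes "linear F" and F: "\<And>x. x \<in> Pencils \<Longrightarrow> F x \<in> Pencils"
    and comm: "\<And>a b c e x. F (pencil_congr a b c e x) = pencil_congr a b c e (F x)"
    and "equivclp pencil_step x y"
  shows "equivclp pencil_step (F x) (F y)"
  using assms(4)
proof (induction rule: equivclp_induct)
  case (step y z)
  have "pencil_step (F y) (F z)" if "pencil_step y z" for y z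
  proof -
    have yz: "y \<in> Pencils" "z \<in> Pencils"
      using that by (simp_all add: pencil_step_def)
    consider a b c e where "a * e - b * c \<noteq> 0" "z = pencil_congr a b c e y"
      | "closed_segment y z \<subseteq> Pencils"
      using \<open>pencil_step y z\<close> unfolding pencil_step_def by blast
    then show ?thesis
    proof cases
      case 1
      then have "F z = pencil_congr a b c e (F y)"
        by (simp add: comm)
      then show ?thesis
        using F yz 1(1) unfolding pencil_step_def by blast
    next
      case 2
      then have "closed_segment (F y) (F z) \<subseteq> Pencils"
        unfolding closed_segment_linear_image [OF assms(1)] using F by blast
      then show ?thesis
        using F yz unfolding pencil_step_def by blast
    qed
  qed
  then show ?case
    using step by (meson equivclp_into_equivclp)
qed simp

lemma convex_comb_nonzero:
  fixes x y s :: real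
  assumes "x \<noteq> 0" "y \<noteq> 0" "x > 0 \<longleftrightarrow> y > 0" "0 \<le> s" "s \<le> 1"
  shows "(1 - s) * x + s * y \<noteq> 0"
proof (cases "x > 0")
  case True
  then show ?thesis
    using convex_bound_lt [of "- x" 0 "- y" "1 - s" s] assms by auto
next
  case False
  then show ?thesis
    using convex_bound_lt [of x 0 y "1 - s" s] assms by auto
qed

text \<open>Simultaneous diagonalisation: \<open>P\<close> is first turned into the identity, which
  rotations fix, and a rotation then diagonalises \<open>Q\<close>. The order of \<open>u\<close>
  and \<open>v\<close> is what makes their signs readable from the type.\<close>

lemma pencil_diagonalise_posdef:
  assumes "(P, Q) \<in> Pencils" "posdef P"
  obtains u v where "u \<le> v" "pencil_rel (P, Q) ((1, 0, 1), (u, 0, v))"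
proof -
  obtain p q r where P: "P = (p, q, r)"
    by (cases P)
  have p: "p > 0" "p * r - q\<^sup>2 > 0"
    using assms(2) by (auto simp: posdef_def P det2_def)
  define x y where "x = sqrt p" and "y = sqrt (p * r - q\<^sup>2)"
  have xy: "x > 0" "y > 0" "x\<^sup>2 = p" "y\<^sup>2 = p * r - q\<^sup>2"
    using p by (simp_all add: x_def y_def)
  have r: "r = (y\<^sup>2 + q\<^sup>2) / x\<^sup>2"
    using xy p by (simp add: field_simps)
  \<comment> \<open>The coefficients are the inverse of the Cholesky factor of \<open>P\<close> with
    rows \<open>(x, 0)\<close> and \<open>(q / x, y / x)\<close>.\<close>
  have 1: "pencil_rel (P, Q) (pencil_congr (1/x) 0 (- q / (x * y)) (x / y) (P, Q))"
    using assms(1) xy by (intro pencil_rel_congr) simp_all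
  have "congr (1/x) 0 (- q / (x * y)) (x / y) P = (1, 0, 1)"
    using xy(1,2) by (simp add: P congr_def r xy(3) [symmetric] field_simps power2_eq_square)
  then obtain Q1 where Q1: "pencil_rel (P, Q) ((1, 0, 1), Q1)"
    using 1 by (auto simp: pencil_congr_def)
  obtain p1 q1 r1 where Q1': "Q1 = (p1, q1, r1)"
    by (cases Q1)
  obtain c s where cs: "c\<^sup>2 + s\<^sup>2 = 1" "c * s * (r1 - p1) + (c\<^sup>2 - s\<^sup>2) * q1 = 0"
    using symmetric_form_rotation by metis
  have "pencil_rel ((1, 0, 1), Q1) (pencil_congr c s (- s) c ((1, 0, 1), Q1))"
    using Q1 cs(1) by (intro pencil_rel_congr) (simp_all add: pencil_rel_def power2_eq_square)
  moreover have "congr c s (- s) c (1, 0, 1) = (1, 0, 1)"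
    using cs by (simp add: congr_def algebra_simps power2_eq_square)
  moreover have "fst (snd (congr c s (- s) c Q1)) = 0"
    using cs(2) by (simp add: Q1' congr_def algebra_simps power2_eq_square)
  ultimately obtain u v where "pencil_rel ((1, 0, 1), Q1) ((1, 0, 1), (u, 0, v))"
    by (cases "congr c s (- s) c Q1") (simp add: pencil_congr_def)
  then have uv: "pencil_rel (P, Q) ((1, 0, 1), (u, 0, v))"
    using Q1 pencil_rel_trans by blast
  show thesis
  proof (cases "u \<le> v")
    case True
    then show ?thesis
      using that uv by blast
  next
    case False
    have "pencil_rel ((1, 0, 1), (u, 0, v)) (pencil_congr 0 1 1 0 ((1, 0, 1), (u, 0, v)))"
      using uv by (intro pencil_rel_congr) (simp_all add: pencil_rel_def)
    then have "pencil_rel (P, Q) ((1, 0, 1), (v, 0, u))"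
      using uv pencil_rel_trans by (simp add: pencil_congr_def congr_def)
    then show ?thesis
      using that [of v u] False by simp
  qed
qed

text \<open>Once \<open>P\<close> is the identity, the type fixes the signs of the sorted
  eigenvalues \<open>u\<close>, \<open>v\<close> of \<open>Q\<close> and of \<open>1 + u\<close>,
  \<open>1 + v\<close>. Convex combinations keep these signs, so the segment between two diagonal
  pencils avoids degeneration.\<close>

lemma pencil_equiv_posdef:
  assumes "(P, Q) \<in> Pencils" "(P', Q') \<in> Pencils" "posdef P" "posdef P'"
    and type: "pencil_type (P, Q) = pencil_type (P', Q')"
  shows "equivclp pencil_step (P, Q) (P', Q')"
proof -
  obtain u v where uv: "u \<le> v" "pencil_rel (P, Q) ((1, 0, 1), (u, 0, v))"
    using pencil_diagonalise_posdef assms by metis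
  obtain u' v' where uv': "u' \<le> v'" "pencil_rel (P', Q') ((1, 0, 1), (u', 0, v'))"
    using pencil_diagonalise_posdef assms by metis
  let ?x = "((1, 0, 1), (u, 0, v)) :: sym2 \<times> sym2" and ?y = "((1, 0, 1), (u', 0, v')) :: sym2 \<times> sym2"
  have xy: "?x \<in> Pencils" "?y \<in> Pencils" "pencil_type ?x = pencil_type ?y"
    using uv uv' type by (auto simp: pencil_rel_def)
  have nz: "u \<noteq> 0" "v \<noteq> 0" "1 + u \<noteq> 0" "1 + v \<noteq> 0" "u' \<noteq> 0" "v' \<noteq> 0" "1 + u' \<noteq> 0" "1 + v' \<noteq> 0"
    using xy by (auto simp: Pencils_def det2_def)
  have signs: "u > 0 \<longleftrightarrow> u' > 0" "v > 0 \<longleftrightarrow> v' > 0" "1 + u > 0 \<longleftrightarrow> 1 + u' > 0" "1 + v > 0 \<longleftrightarrow> 1 + v' > 0"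
  proof -
    \<comment> \<open>One flag per entry: \<open>posdef\<close> decides the sign of the smaller one,
      \<open>negdef\<close> that of the larger one.\<close>
    have diag: "posdef (x, 0, y) \<longleftrightarrow> x > 0" "negdef (x, 0, y) \<longleftrightarrow> y < 0" if "x \<le> y" for x y
      using that by (auto simp: posdef_def negdef_def det2_def zero_less_mult_iff)
    have "posdef (u, 0, v) = posdef (u', 0, v')" "negdef (u, 0, v) = negdef (u', 0, v')"
      "posdef (1 + u, 0, 1 + v) = posdef (1 + u', 0, 1 + v')"
      "negdef (1 + u, 0, 1 + v) = negdef (1 + u', 0, 1 + v')"
      using xy(3) by (simp_all add: pencil_type_def)
    moreover have "1 + u \<le> 1 + v" "1 + u' \<le> 1 + v'"
      using uv(1) uv'(1) by simp_all
    ultimately have lt: "u > 0 \<longleftrightarrow> u' > 0" "v < 0 \<longleftrightarrow> v' < 0" "1 + u > 0 \<longleftrightarrow> 1 + u' > 0"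
      "1 + v < 0 \<longleftrightarrow> 1 + v' < 0"
      using uv(1) uv'(1) diag by metis+
    have "x > 0 \<longleftrightarrow> y > 0" if "x < 0 \<longleftrightarrow> y < 0" "x \<noteq> 0" "y \<noteq> 0" for x y :: real
      using that by linarith
    then show "u > 0 \<longleftrightarrow> u' > 0" "v > 0 \<longleftrightarrow> v' > 0" "1 + u > 0 \<longleftrightarrow> 1 + u' > 0" "1 + v > 0 \<longleftrightarrow> 1 + v' > 0"
      using lt nz by blast+
  qed
  have "closed_segment ?x ?y \<subseteq> Pencils"
  proof
    fix z assume "z \<in> closed_segment ?x ?y"
    then obtain s where s: "0 \<le> s" "s \<le> 1" "z = (1 - s) *\<^sub>R ?x + s *\<^sub>R ?y"
      unfolding in_segment by blast
    define U V where "U = (1 - s) * u + s * u'" and "V = (1 - s) * v + s * v'"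
    have "1 + U = (1 - s) * (1 + u) + s * (1 + u')" "1 + V = (1 - s) * (1 + v) + s * (1 + v')"
      by (simp_all add: U_def V_def algebra_simps)
    then have "U \<noteq> 0" "V \<noteq> 0" "1 + U \<noteq> 0" "1 + V \<noteq> 0"
      unfolding U_def V_def
      using convex_comb_nonzero [OF nz(1,5) signs(1) s(1,2)] convex_comb_nonzero [OF nz(2,6)
          signs(2) s(1,2)]
        convex_comb_nonzero [OF nz(3,7) signs(3) s(1,2)] convex_comb_nonzero [OF nz(4,8) signs(4)
            s(1,2)]
      by simp_all
    moreover have "z = ((1, 0, 1), (U, 0, V))"
      unfolding s(3) U_def V_def by simp
    ultimately show "z \<in> Pencils"
      by (simp add: Pencils_def det2_def)
  qed
  then have "pencil_step ?x ?y"
    using xy by (simp add: pencil_step_def)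
  then show ?thesis
    using uv(2) uv'(2) unfolding pencil_rel_def
    by (meson equivclp_sym equivclp_trans r_into_equivclp)
qed

text \<open>After \<open>P\<close> has become \<open>(1, 0, -1)\<close>, indefiniteness of
  \<open>Q\<close> and \<open>P + Q\<close> reads \<open>a * c < b^2\<close> and
  \<open>(1 + a) * (c - 1) < b^2\<close>. Enlarging \<open>b\<close> is therefore harmless, and for
  large \<open>b\<close> the entries \<open>a\<close> and \<open>c\<close> can be contracted to
  zero. At the target, \<open>A\<close> has the nonreal eigenvalues \<open>1 + 2 i\<close> and
  \<open>1 - 2 i\<close>.\<close>

lemma pencil_equiv_indefinite:
  assumes "(P, Q) \<in> Pencils" "\<not> det2 P > 0" "\<not> det2 Q > 0" "\<not> det2 (P + Q) > 0"
  shows "equivclp pencil_step (P, Q) ((1, 0, -1), (0, 1, 0))"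
proof -
  obtain p q r where P: "P = (p, q, r)"
    by (cases P)
  have "\<exists>Q'. pencil_rel (P, Q) ((1, 0, -1), Q')"
  proof -
    obtain c s where cs: "c\<^sup>2 + s\<^sup>2 = 1" "c * s * (r - p) + (c\<^sup>2 - s\<^sup>2) * q = 0"
      using symmetric_form_rotation by metis
    have "pencil_rel (P, Q) (pencil_congr c s (- s) c (P, Q))"
      using assms(1) cs(1) by (intro pencil_rel_congr) (simp_all add: pencil_rel_def power2_eq_square)
    moreover have "fst (snd (congr c s (- s) c P)) = 0"
      using cs(2) by (simp add: P congr_def algebra_simps power2_eq_square)
    ultimately obtain u v Q1 where 1: "pencil_rel (P, Q) ((u, 0, v), Q1)"
      by (cases "congr c s (- s) c P") (simp add: pencil_congr_def)
    have "u * v \<noteq> 0"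
      using 1 by (auto simp: pencil_rel_def Pencils_def det2_def)
    moreover have "\<not> u * v > 0"
      using 1 assms(2) definite_iff [of P] definite_iff [of "(u, 0, v)"]
      by (auto simp: pencil_rel_def pencil_type_def det2_def)
    ultimately have "u * v < 0"
      by linarith
    have "\<exists>u v Q1. u > 0 \<and> v < 0 \<and> pencil_rel (P, Q) ((u, 0, v), Q1)"
    proof (cases "u > 0")
      case True
      then show ?thesis
        using 1 \<open>u * v < 0\<close> by (meson mult_less_0_iff order_less_asym)
    next
      case False
      have "pencil_rel ((u, 0, v), Q1) (pencil_congr 0 1 1 0 ((u, 0, v), Q1))"
        using 1 by (intro pencil_rel_congr) (simp_all add: pencil_rel_def)
      moreover have "congr 0 1 1 0 (u, 0, v) = (v, 0, u)"
        by (simp add: congr_def)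
      ultimately have "pencil_rel (P, Q) ((v, 0, u), congr 0 1 1 0 Q1)"
        using pencil_rel_trans [OF 1] by (simp add: pencil_congr_def)
      then show ?thesis
        using False \<open>u * v < 0\<close> by (meson mult_less_0_iff order_less_asym)
    qed
    then obtain u v Q1 where uv: "u > 0" "v < 0" "pencil_rel (P, Q) ((u, 0, v), Q1)"
      by blast
    have "pencil_rel ((u, 0, v), Q1) (pencil_congr (1 / sqrt u) 0 0 (1 / sqrt (- v)) ((u, 0, v), Q1))"
      using uv by (intro pencil_rel_congr) (simp_all add: pencil_rel_def)
    moreover have "congr (1 / sqrt u) 0 0 (1 / sqrt (- v)) (u, 0, v) = (1, 0, -1)"
      using uv by (simp add: congr_def power_divide)
    ultimately have "pencil_rel (P, Q) ((1, 0, -1), congr (1 / sqrt u) 0 0 (1 / sqrt (- v)) Q1)"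
      using pencil_rel_trans [OF uv(3)] by (simp add: pencil_congr_def)
    then show ?thesis
      by blast
  qed
  then obtain a b c where abc: "pencil_rel (P, Q) ((1, 0, -1), (a, b, c))"
    by (metis prod.collapse)
  have "\<exists>b\<ge>0. pencil_rel (P, Q) ((1, 0, -1), (a, b, c))"
  proof (cases "b \<ge> 0")
    case False
    \<comment> \<open>The reflection of the second coordinate fixes \<open>(1, 0, -1)\<close> and
      changes the sign of \<open>b\<close>.\<close>
    have "pencil_rel ((1, 0, -1), (a, b, c)) (pencil_congr 1 0 0 (-1) ((1, 0, -1), (a, b, c)))"
      using abc by (intro pencil_rel_congr) (simp_all add: pencil_rel_def)
    then have "pencil_rel (P, Q) ((1, 0, -1), (a, - b, c))"
      using abc pencil_rel_trans by (simp add: pencil_congr_def congr_def)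
    then show ?thesis
      using False by (intro exI [of _ "- b"]) simp
  qed (use abc in blast)
  then obtain b where b: "b \<ge> 0" and abc: "pencil_rel (P, Q) ((1, 0, -1), (a, b, c))"
    by blast
  have reg: "((1, 0, -1), (a, b, c)) \<in> Pencils"
    using abc by (simp add: pencil_rel_def)
  have le: "\<not> det2 (a, b, c) > 0" "\<not> det2 ((1, 0, -1) + (a, b, c)) > 0"
    using abc assms(3,4) definite_iff [of Q] definite_iff [of "P + Q"]
      definite_iff [of "(a, b, c)"] definite_iff [of "(1, 0, -1) + (a, b, c)"]
    by (auto simp: pencil_rel_def pencil_type_def)
  have lt: "a * c < b\<^sup>2" "(1 + a) * (c - 1) < b\<^sup>2"
    using reg le by (auto simp: Pencils_def det2_def)
  \<comment> \<open>Larger than \<open>1 + \<bar>a\<bar>\<close> and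
    \<open>1 + \<bar>c\<bar>\<close>, so that \<open>B^2\<close> dominates both products during the
    whole contraction.\<close>
  define B where "B = b + \<bar>a\<bar> + \<bar>c\<bar> + 2"
  have mem: "((1, 0, -1), (x, y, z)) \<in> Pencils" if "x * z < y\<^sup>2" "(1 + x) * (z - 1) < y\<^sup>2" for x y z
      :: real
    using that by (auto simp: Pencils_def det2_def)
  have B: "B \<ge> 2" "b \<le> B"
    using b by (simp_all add: B_def)
  have big: "(s * a) * (s * c) < B\<^sup>2" "(1 + s * a) * (s * c - 1) < B\<^sup>2" if "0 \<le> s" "s \<le> 1" for s
  proof -
    have sa: "\<bar>s * a\<bar> \<le> \<bar>a\<bar>" "\<bar>s * c\<bar> \<le> \<bar>c\<bar>"
      using that by (simp_all add: abs_mult mult_left_le_one_le)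
    have *: "x * y < B\<^sup>2" if "\<bar>x\<bar> < B" "\<bar>y\<bar> < B" for x y
    proof -
      have "\<bar>x\<bar> * \<bar>y\<bar> < B * B"
        using that by (intro mult_strict_mono') auto
      then show ?thesis
        unfolding power2_eq_square abs_mult [symmetric] by linarith
    qed
    show "(s * a) * (s * c) < B\<^sup>2" "(1 + s * a) * (s * c - 1) < B\<^sup>2"
      using sa b by (intro *; simp add: B_def)+
  qed
  have "closed_segment ((1, 0, -1), (a, b, c)) ((1, 0, -1), (a, B, c)) \<subseteq> Pencils"
  proof
    fix z :: "sym2 \<times> sym2" assume "z \<in> closed_segment ((1, 0, -1), (a, b, c)) ((1, 0, -1), (a, B, c))"
    then obtain s where s: "0 \<le> s" "s \<le> 1" 
      "z = (1 - s) *\<^sub>R ((1, 0, -1), (a, b, c)) + s *\<^sub>R ((1, 0, -1), (a, B, c))"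
      unfolding in_segment by blast
    then have z: "z = ((1, 0, -1), (a, b + s * (B - b), c))"
      by (simp add: algebra_simps)
    have "b\<^sup>2 \<le> (b + s * (B - b))\<^sup>2"
      using b B s by (intro power_mono) simp_all
    then show "z \<in> Pencils"
      unfolding z using lt by (intro mem) simp_all
  qed
  moreover have "closed_segment ((1, 0, -1), (0, B, 0)) ((1, 0, -1), (a, B, c)) \<subseteq> Pencils"
  proof
    fix z :: "sym2 \<times> sym2" assume "z \<in> closed_segment ((1, 0, -1), (0, B, 0)) ((1, 0, -1), (a, B, c))"
    then obtain s where s: "0 \<le> s" "s \<le> 1" 
      "z = (1 - s) *\<^sub>R ((1, 0, -1), (0, B, 0)) + s *\<^sub>R ((1, 0, -1), (a, B, c))"
      unfolding in_segment by blast
    then have z: "z = ((1, 0, -1), (s * a, B, s * c))"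
      by (simp add: algebra_simps)
    show "z \<in> Pencils"
      unfolding z using big s by (intro mem) simp_all
  qed
  moreover have "closed_segment ((1, 0, -1), (0, B, 0)) ((1, 0, -1), (0, 1, 0)) \<subseteq> Pencils"
  proof
    fix z :: "sym2 \<times> sym2" assume "z \<in> closed_segment ((1, 0, -1), (0, B, 0)) ((1, 0, -1), (0, 1, 0))"
    then obtain s where s: "0 \<le> s" "s \<le> 1" 
      "z = (1 - s) *\<^sub>R ((1, 0, -1), (0, B, 0)) + s *\<^sub>R ((1, 0, -1), (0, 1, 0))"
      unfolding in_segment by blast
    then have z: "z = ((1, 0, -1), (0, (1 - s) * B + s * 1, 0))"
      by (simp add: algebra_simps)
    have "(1 - s) * B + s * 1 \<noteq> 0"
      using s B by (intro convex_comb_nonzero) auto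
    then have "((1 - s) * B + s * 1)\<^sup>2 > 0"
      by simp
    moreover from this have "((1 - s) * B + s * 1)\<^sup>2 > - 1"
      by linarith
    ultimately show "z \<in> Pencils"
      unfolding z by (intro mem) simp_all
  qed
  ultimately have "pencil_step ((1, 0, -1), (a, b, c)) ((1, 0, -1), (a, B, c))"
    "pencil_step ((1, 0, -1), (0, B, 0)) ((1, 0, -1), (a, B, c))"
    "pencil_step ((1, 0, -1), (0, B, 0)) ((1, 0, -1), (0, 1, 0))"
    unfolding pencil_step_def by (meson ends_in_segment subsetD)+
  then show ?thesis
    using abc unfolding pencil_rel_def
    by (meson equivclp_sym equivclp_trans r_into_equivclp)
qed

text \<open>If one of the three forms is definite, exchange or shear brings it to the first place
  and negation makes it positive. Otherwise all three are indefinite, and both pencils reach the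
  same normal form.\<close>

lemma pencil_equiv:
  assumes "x \<in> Pencils" "y \<in> Pencils" "pencil_type x = pencil_type y"
  shows "equivclp pencil_step x y"
proof -
  obtain P Q P' Q' where x: "x = (P, Q)" and y: "y = (P', Q')"
    by (cases x; cases y)
  have neg: "equivclp pencil_step (P, Q) (P', Q')"
    if "equivclp pencil_step (- P, - Q) (- P', - Q')" for P Q P' Q'
  proof -
    have "equivclp pencil_step (- (- P, - Q)) (- (- P', - Q'))"
    proof (rule pencil_step_map [OF linear_uminus _ _ that])
      show "- x \<in> Pencils" if "x \<in> Pencils" for x
        using that by (cases x rule: prod.exhaust) (simp add: Pencils_def det2_uminus)
      show "- pencil_congr a b c e x = pencil_congr a b c e (- x)" for a b c e x
        by (cases x rule: prod.exhaust) (simp add: pencil_congr_def congr_uminus)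
    qed
    then show ?thesis
      by simp
  qed
  have posdef: "equivclp pencil_step (P, Q) (P', Q')"
    if "(P, Q) \<in> Pencils" "(P', Q') \<in> Pencils" "pencil_type (P, Q) = pencil_type (P', Q')" "det2 P > 0"
    for P Q P' Q'
  proof (cases "posdef P")
    case True
    then show ?thesis
      using that pencil_equiv_posdef [OF that(1,2)] by (auto simp: pencil_type_def)
  next
    case False
    have "equivclp pencil_step (- P, - Q) (- P', - Q')"
      using that False definite_iff [of P]
      by (intro pencil_equiv_posdef)
        (auto simp: pencil_type_def Pencils_def det2_uminus definite_uminus)
    then show ?thesis
      by (rule neg)
  qed
  have swap: "equivclp pencil_step (P, Q) (P', Q')"
    if "equivclp pencil_step (Q, P) (Q', P')" for P Q P' Q'
  proof -
    have "equivclp pencil_step (prod.swap (Q, P)) (prod.swap (Q', P'))"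
    proof (rule pencil_step_map [OF _ _ _ that])
      show "linear (prod.swap :: sym2 \<times> sym2 \<Rightarrow> _)"
        by (rule linearI) (simp_all add: prod.swap_def)
      show "prod.swap x \<in> Pencils" if "x \<in> Pencils" for x
        using that by (cases x rule: prod.exhaust) (simp add: Pencils_def add.commute)
      show "prod.swap (pencil_congr a b c e x) = pencil_congr a b c e (prod.swap x)" for a b c e x
        by (cases x rule: prod.exhaust) (simp add: pencil_congr_def)
    qed
    then show ?thesis
      by simp
  qed
  have shear: "equivclp pencil_step (P, Q) (P', Q')"
    if "equivclp pencil_step (P + Q, - Q) (P' + Q', - Q')" for P Q P' Q'
  proof -
    let ?F = "\<lambda>x :: sym2 \<times> sym2. (fst x + snd x, - snd x)"
    have "equivclp pencil_step (?F (P + Q, - Q)) (?F (P' + Q', - Q'))"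
    proof (rule pencil_step_map [OF _ _ _ that])
      show "linear ?F"
        by (rule linearI) (simp_all add: algebra_simps)
      show "?F x \<in> Pencils" if "x \<in> Pencils" for x
        using that by (cases x rule: prod.exhaust) (simp add: Pencils_def det2_uminus)
      show "?F (pencil_congr a b c e x) = pencil_congr a b c e (?F x)" for a b c e x
        by (cases x rule: prod.exhaust) (simp add: pencil_congr_def congr_uminus congr_add)
    qed
    then show ?thesis
      by simp
  qed
  consider "det2 P > 0" | "det2 Q > 0" | "det2 (P + Q) > 0" |
    "\<not> det2 P > 0" "\<not> det2 Q > 0" "\<not> det2 (P + Q) > 0"
    by blast
  then show ?thesis
  proof cases
    case 1
    then show ?thesis
      using posdef assms unfolding x y by blast
  next
    case 2
    show ?thesis
      unfolding x y
      by (rule swap, rule posdef) (use assms 2 in \<open>simp_all add: x y pencil_type_def Pencils_def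
          add.commute [of Q P] add.commute [of Q' P']\<close>)
  next
    case 3
    show ?thesis
      unfolding x y
      by (rule shear, rule posdef) (use assms 3 in \<open>simp_all add: x y pencil_type_def Pencils_def
          det2_uminus definite_uminus\<close>)
  next
    case 4
    then have "\<not> det2 P' > 0" "\<not> det2 Q' > 0" "\<not> det2 (P' + Q') > 0"
      using assms(3) by (auto simp: x y pencil_type_def definite_iff)
    then show ?thesis
      using pencil_equiv_indefinite [of P Q] pencil_equiv_indefinite [of P' Q'] 4 assms
      unfolding x y by (meson equivclp_sym equivclp_trans)
  qed
qed

section \<open>Symplectic matrices\<close>

lemma matrix_minus_mult:
  fixes A :: "real^'m^'n" and B :: "real^'k^'m"
  shows "(- A) ** B = - (A ** B)" "A ** (- B) = - (A ** B)"
  by (simp_all add: matrix_matrix_mult_def vec_eq_iff sum_negf)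

lemma matrix_diff_mult:
  fixes A A' :: "real^'m^'n" and B B' :: "real^'k^'m"
  shows "(A - A') ** B = A ** B - A' ** B" "A ** (B - B') = A ** B - A ** B'"
  by (simp_all add: matrix_matrix_mult_def vec_eq_iff sum_subtractf algebra_simps)

lemma matrix_zero_mult:
  fixes A :: "real^'m^'n"
  shows "(0 :: real^'n^'k) ** A = 0" "A ** (0 :: real^'k^'m) = 0"
  by (simp_all add: matrix_matrix_mult_def vec_eq_iff)

lemma matrix_add_rdistrib: "((A :: real^'m^'n) + B) ** C = A ** C + B ** C"
  by (simp add: matrix_matrix_mult_def vec_eq_iff sum.distrib algebra_simps)

lemma transpose_minus: "transpose (- A) = - transpose (A :: real^'m^'n)"
  by (simp add: transpose_def vec_eq_iff)

lemma transpose_diff: "transpose (A - B) = transpose A - transpose (B :: real^'m^'n)"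
  by (simp add: transpose_def vec_eq_iff)

lemma transpose_zero: "transpose (0 :: real^'m^'n) = 0"
  by (simp add: transpose_def vec_eq_iff)

lemma matrix_vector_minus: "(- A) *v x = - (A *v (x :: real^'m))"
  by (simp add: matrix_vector_mult_def vec_eq_iff sum_negf)

lemmas matrix_calc = matrix_minus_mult matrix_zero_mult transpose_minus transpose_zero
  matrix_transpose_mul

lemma matrix_inv_unique:
  fixes A B :: "real^'n^'n"
  assumes "A ** B = mat 1"
  shows "matrix_inv A = B"
proof -
  have BA: "B ** A = mat 1"
    using assms matrix_left_right_inverse by blast
  have "\<exists>A'. A ** A' = mat 1 \<and> A' ** A = mat 1"
    using assms BA by blast
  then have "A ** matrix_inv A = mat 1"
    unfolding matrix_inv_def by (rule someI2_ex) blast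
  then have "B ** (A ** matrix_inv A) = B"
    by simp
  then show ?thesis
    by (simp add: matrix_mul_assoc BA)
qed

lemma matrix_inv_inverse:
  fixes A :: "real^'n^'n"
  assumes "invertible A"
  shows "A ** matrix_inv A = mat 1" "matrix_inv A ** A = mat 1"
  using assms by (auto simp: invertible_def dest: matrix_inv_unique)

lemma block_mat_uminus: "- block_mat A B C D = block_mat (- A) (- B) (- C) (- D)"
  by (rule block_matrix_eqI) simp_all

lemma block_mat_add:
  "block_mat A B C D + block_mat A' B' C' D' = block_mat (A + A') (B + B') (C + C') (D + D')"
  by (rule block_matrix_eqI) simp_all

lemma block_mat_diff:
  "block_mat A B C D - block_mat A' B' C' D' = block_mat (A - A') (B - B') (C - C') (D - D')"
  by (rule block_matrix_eqI) simp_all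

lemma block_mat_scaleR:
  "k *\<^sub>R block_mat A B C D = block_mat (k *\<^sub>R A) (k *\<^sub>R B) (k *\<^sub>R C) (k *\<^sub>R D)"
  by (rule block_matrix_eqI) simp_all

lemma trace_block_mat: "trace (block_mat A B C D) = trace A + trace (D :: real^'n::finite^'n)"
proof -
  have "(\<Sum>k\<in>UNIV. f k) = (\<Sum>k\<in>UNIV. f (Inl k)) + (\<Sum>k\<in>UNIV. f (Inr k))"
    for f :: "'n + 'n \<Rightarrow> real"
    using sum.Plus [of "UNIV :: 'n set" "UNIV :: 'n set" f] by (simp add: comp_def)
  then show ?thesis
    by (simp add: trace_def)
qed

lemma transpose_J: "transpose J_mat = - J_mat"
  by (simp add: J_mat_def transpose_block_mat block_mat_uminus matrix_calc)

lemma J_J: "J_mat ** J_mat = - mat 1"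
  by (simp add: J_mat_def block_mat_mult mat_one_block block_mat_uminus matrix_calc)

lemma J_I: "J_mat ** I_mat = - (I_mat ** J_mat)"
  by (simp add: I_mat_def J_mat_def block_mat_mult mat_one_block block_mat_uminus matrix_calc)

lemma JJ_cancel: "J_mat ** (J_mat ** X) = - X" "X ** J_mat ** J_mat = - X"
  by (simp_all add: matrix_mul_assoc J_J matrix_calc)
    (simp add: matrix_mul_assoc [symmetric] J_J matrix_calc)

text \<open>Agrees with the inverse on symplectic matrices, but is continuous everywhere.\<close>

definition sinv :: "real^('n::finite + 'n)^('n + 'n) \<Rightarrow> real^('n + 'n)^('n + 'n)" where
  "sinv M = - (J_mat ** transpose M ** J_mat)"

lemma sinv_block_mat:
  "sinv (block_mat A B C D) = block_mat (transpose D) (- transpose B) (- transpose C) (transpose A)"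
  by (simp add: sinv_def J_mat_def transpose_block_mat block_mat_mult block_mat_uminus matrix_calc)

lemma sinv_mult: "sinv (M ** N) = sinv N ** sinv M"
  by (simp add: sinv_def matrix_calc matrix_mul_assoc)
    (simp add: matrix_mul_assoc [symmetric] JJ_cancel matrix_calc)

lemma sinv_sinv: "sinv (sinv M) = M"
  by (cases M rule: block_mat_cases) (simp add: sinv_block_mat matrix_calc)

lemma Sp_iff_sinv: "M \<in> Sp \<longleftrightarrow> sinv M ** M = mat 1"
proof
  assume "M \<in> Sp"
  then have "transpose M ** J_mat ** M = J_mat"
    by (simp add: Sp_def)
  then show "sinv M ** M = mat 1"
    by (simp add: sinv_def matrix_calc matrix_mul_assoc [symmetric] J_J)
next
  assume "sinv M ** M = mat 1"
  then have "J_mat ** (sinv M ** M) = J_mat"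
    by simp
  then show "M \<in> Sp"
    by (simp add: Sp_def sinv_def matrix_calc matrix_mul_assoc J_J)
qed

lemma Sp_sinv: "M \<in> Sp \<Longrightarrow> sinv M ** M = mat 1" "M \<in> Sp \<Longrightarrow> M ** sinv M = mat 1"
  using Sp_iff_sinv matrix_left_right_inverse by blast+

lemma Sp_matrix_inv: "M \<in> Sp \<Longrightarrow> matrix_inv M = sinv M"
  by (simp add: Sp_sinv matrix_inv_unique)

lemma Sp_one: "mat 1 \<in> Sp"
  by (simp add: Sp_def)

lemma Sp_mult: "M \<in> Sp \<Longrightarrow> N \<in> Sp \<Longrightarrow> M ** N \<in> Sp"
  unfolding Sp_iff_sinv sinv_mult
  by (metis matrix_mul_assoc matrix_mul_lid)

lemma Sp_sinv_in: "M \<in> Sp \<Longrightarrow> sinv M \<in> Sp"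
  by (simp add: Sp_iff_sinv [of "sinv M"] sinv_sinv Sp_sinv)

lemma Sp_uminus: "M \<in> Sp \<Longrightarrow> - M \<in> Sp"
  by (simp add: Sp_def matrix_calc)

lemma Sp_act_sinv: "S \<in> Sp \<Longrightarrow> Sp_act S M = S ** M ** sinv S"
  by (simp add: Sp_act_def Sp_matrix_inv)

lemma Sp_act_in: "S \<in> Sp \<Longrightarrow> M \<in> Sp \<Longrightarrow> Sp_act S M \<in> Sp"
  by (simp add: Sp_act_sinv Sp_mult Sp_sinv_in)

lemma Sp_act_comp: "S \<in> Sp \<Longrightarrow> T \<in> Sp \<Longrightarrow> Sp_act S (Sp_act T M) = Sp_act (S ** T) M"
  by (simp add: Sp_act_sinv Sp_mult sinv_mult matrix_mul_assoc)

lemma Sp_act_one: "Sp_act (mat 1) M = M"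
proof -
  have "sinv (mat 1) ** mat 1 = (mat 1 :: real^('a + 'a)^('a + 'a))"
    by (rule Sp_sinv(1) [OF Sp_one])
  then show ?thesis
    by (simp add: Sp_act_sinv Sp_one)
qed

lemma Sp_act_inverse: "S \<in> Sp \<Longrightarrow> Sp_act (sinv S) (Sp_act S M) = M"
  by (simp add: Sp_act_comp Sp_sinv_in Sp_sinv Sp_act_one)

lemma Sp_act_eqI:
  assumes "S \<in> Sp" "S ** M = N ** S"
  shows "Sp_act S M = N"
  using assms by (simp add: Sp_act_sinv matrix_mul_assoc [symmetric] Sp_sinv)

lemma sinv_Sp_act: "S \<in> Sp \<Longrightarrow> sinv (Sp_act S M) = Sp_act S (sinv M)"
  by (simp add: Sp_act_sinv sinv_mult sinv_sinv matrix_mul_assoc)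

interpretation Sp: git_action "top_of_set Sp" Sp Sp_act
proof
  show "Sp \<noteq> {}"
    using Sp_one by blast
  show "\<exists>k\<in>Sp. Sp_act k (Sp_act g x) = x" if "g \<in> Sp" for g x :: "real^('a + 'a)^('a + 'a)"
    using that Sp_sinv_in Sp_act_inverse by blast
qed (auto simp: Sp_act_in Sp_act_comp intro: Sp_mult)

definition tr_inv :: "real^('n::finite + 'n)^('n + 'n) \<Rightarrow> real" where
  "tr_inv M = trace M / 2"

text \<open>The determinant of \<open>A\<close> when \<open>M = M_ABC A B C\<close> and \<open>n = 2\<close>.\<close>

definition det_inv :: "real^('n::finite + 'n)^('n + 'n) \<Rightarrow> real" where
  "det_inv M = (tr_inv M)\<^sup>2 / 2 - trace (M ** M) / 8 - 1 / 2"

lemma inv_Sp_act: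
  assumes "S \<in> Sp"
  shows "tr_inv (Sp_act S M) = tr_inv M" "det_inv (Sp_act S M) = det_inv M"
proof -
  have *: "trace (Sp_act S N) = trace N" for N
    using assms trace_mul_sym [of "S ** N" "sinv S"]
    by (simp add: Sp_act_sinv matrix_mul_assoc Sp_sinv)
  have "Sp_act S M ** Sp_act S M = S ** M ** (sinv S ** S) ** M ** sinv S"
    using assms by (simp add: Sp_act_sinv matrix_mul_assoc)
  also have "\<dots> = Sp_act S (M ** M)"
    using assms by (simp add: Sp_sinv Sp_act_sinv matrix_mul_assoc)
  finally show "tr_inv (Sp_act S M) = tr_inv M" "det_inv (Sp_act S M) = det_inv M"
    by (simp_all add: tr_inv_def det_inv_def *)
qed

definition m2 :: "real \<Rightarrow> real \<Rightarrow> real \<Rightarrow> real \<Rightarrow> real^2^2" where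
  "m2 a b c d = vector [vector [a, b], vector [c, d]]"

lemma m2_nth [simp]:
  "m2 a b c d $ 1 $ 1 = a" "m2 a b c d $ 1 $ 2 = b" "m2 a b c d $ 2 $ 1 = c" "m2 a b c d $ 2 $ 2 = d"
  by (simp_all add: m2_def)

lemma m2_cases: obtains a b c d where "A = m2 a b c d"
proof
  show "A = m2 (A $ 1 $ 1) (A $ 1 $ 2) (A $ 2 $ 1) (A $ 2 $ 2)"
    by (simp add: vec_eq_iff forall_2)
qed

lemma m2_eq_iff: "m2 a b c d = m2 a' b' c' d' \<longleftrightarrow> a = a' \<and> b = b' \<and> c = c' \<and> d = d'"
  by (auto simp: vec_eq_iff forall_2)

lemma m2_simps:
  "m2 a b c d ** m2 a' b' c' d' = m2 (a * a' + b * c') (a * b' + b * d') (c * a' + d * c') (c * b' +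
      d * d')"
  "m2 a b c d + m2 a' b' c' d' = m2 (a + a') (b + b') (c + c') (d + d')"
  "m2 a b c d - m2 a' b' c' d' = m2 (a - a') (b - b') (c - c') (d - d')"
  "- m2 a b c d = m2 (- a) (- b) (- c) (- d)"
  "k *\<^sub>R m2 a b c d = m2 (k * a) (k * b) (k * c) (k * d)"
  "transpose (m2 a b c d) = m2 a c b d"
  "trace (m2 a b c d) = a + d"
  "det (m2 a b c d) = a * d - b * c"
  by (simp_all add: vec_eq_iff forall_2 matrix_matrix_mult_def sum_2 transpose_def trace_def det_2)

lemma m2_one: "mat 1 = m2 1 0 0 1" and m2_zero: "0 = m2 0 0 0 0"
  by (simp_all add: vec_eq_iff forall_2 mat_def)

text \<open>From \<open>A^2 - B C = 1\<close> the trace of \<open>B C\<close> is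
  \<open>trace (A^2) - 2\<close>, so \<open>trace (M^2) = 4 * trace (A^2) - 4\<close>. With
  \<open>trace (A^2) = (trace A)^2 - 2 * det A\<close> this is solved for \<open>det A\<close>,
  which explains the formula of \<open>det_inv\<close>.\<close>

lemma inv_M_ABC:
  fixes A :: "real^2^2"
  assumes "M_ABC A B C \<in> Sp_I"
  shows "tr_inv (M_ABC A B C) = trace A" "det_inv (M_ABC A B C) = det A"
proof -
  have tt: "trace (transpose X) = trace X" for X :: "real^2^2"
    by (simp add: trace_def transpose_def)
  show t: "tr_inv (M_ABC A B C) = trace A"
    by (simp add: tr_inv_def M_ABC_def trace_block_mat tt)
  have "A ** A - B ** C = mat 1"
    using assms unfolding Sp_I_iff_M_ABC by (auto simp: M_ABC_def block_mat_eq_iff)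
  then have "trace (A ** A) - trace (B ** C) = 2"
    by (simp add: trace_sub [symmetric] trace_I)
  moreover have "trace (M_ABC A B C ** M_ABC A B C) =
      trace (A ** A) + trace (B ** C) + (trace (C ** B) + trace (transpose A ** transpose A))"
    by (simp add: M_ABC_def block_mat_mult trace_block_mat trace_add)
  moreover have "trace (C ** B) = trace (B ** C)"
    by (rule trace_mul_sym)
  moreover have "trace (transpose A ** transpose A) = trace (A ** A)"
    using tt [of "A ** A"] by (simp add: matrix_transpose_mul)
  moreover have "trace (A ** A) = (trace A)\<^sup>2 - 2 * det A"
    by (cases A rule: m2_cases) (simp add: m2_simps power2_eq_square algebra_simps)
  ultimately show "det_inv (M_ABC A B C) = det A"
    unfolding det_inv_def t by (simp add: field_simps)
qed

section \<open>The symplectic form and conjugation into \<open>Sp_I\<close>\<close>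

definition omega :: "real^('n::finite + 'n) \<Rightarrow> real^('n + 'n) \<Rightarrow> real" where
  "omega u v = u \<bullet> (J_mat *v v)"

lemma omega_bilinear: "bilinear omega"
  unfolding bilinear_def omega_def
  by (auto intro!: linearI simp: inner_add_left inner_add_right matrix_vector_right_distrib
      matrix_vector_mult_scaleR)

lemma inner_matrix_transpose: "(A *v u) \<bullet> v = u \<bullet> (transpose A *v (v :: real^'n))"
  by (metis dot_lmul_matrix inner_commute vector_transpose_matrix)

lemma omega_sinv: "omega (M *v u) v = omega u (sinv M *v v)"
  by (simp add: omega_def inner_matrix_transpose sinv_def matrix_vector_mul_assoc matrix_calc
      matrix_mul_assoc J_J)

lemma omega_antisym: "omega u v = - omega v u"
proof -
  have "omega u v = (J_mat *v v) \<bullet> u"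
    by (simp add: omega_def inner_commute)
  also have "\<dots> = - omega v u"
    by (simp add: inner_matrix_transpose transpose_J matrix_vector_minus omega_def)
  finally show ?thesis .
qed

lemma omega_nondegenerate:
  assumes "\<And>v. omega u v = 0"
  shows "u = 0"
  using assms [of "J_mat *v u"]
  by (simp add: omega_def matrix_vector_mul_assoc J_J matrix_vector_minus)

lemma omega_Sp: "S \<in> Sp \<Longrightarrow> omega (S *v u) (S *v v) = omega u v"
  by (simp add: omega_sinv matrix_vector_mul_assoc Sp_sinv)

text \<open>\<open>M + sinv M\<close> is self-adjoint for \<open>omega\<close>, so its
  characteristic polynomial is the square of a Pfaffian quadratic, which already annihilates it. In
  blocks the constant term \<open>p\<close> is \<open>det (A + D^T) + (b2 - b3) * (c2 - c3)\<close>;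
  the identity is checked entrywise.\<close>

lemma pfaffian_Cayley_Hamilton:
  fixes M :: "real^(2+2)^(2+2)"
  obtains p where "(M + sinv M) ** (M + sinv M) = trace M *\<^sub>R (M + sinv M) - p *\<^sub>R mat 1"
proof -
  obtain A B C D where M: "M = block_mat A B C D"
    by (rule block_mat_cases)
  obtain a1 a2 a3 a4 where A: "A = m2 a1 a2 a3 a4" by (rule m2_cases)
  obtain b1 b2 b3 b4 where B: "B = m2 b1 b2 b3 b4" by (rule m2_cases)
  obtain c1 c2 c3 c4 where C: "C = m2 c1 c2 c3 c4" by (rule m2_cases)
  obtain d1 d2 d3 d4 where D: "D = m2 d1 d2 d3 d4" by (rule m2_cases)
  show ?thesis
    by (rule that [of "(a1 + d1) * (a4 + d4) - (a2 + d3) * (a3 + d2) + (b2 - b3) * (c2 - c3)"])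
      (simp add: M A B C D sinv_block_mat block_mat_add block_mat_mult block_mat_diff block_mat_scaleR
        mat_one_block m2_simps trace_block_mat m2_one m2_zero block_mat_eq_iff m2_eq_iff algebra_simps)
qed

lemma trace_sinv: "trace (sinv M) = trace M"
proof -
  have tt: "trace (transpose X) = trace X" for X :: "real^'a^'a"
    by (simp add: trace_def transpose_def)
  show ?thesis
    by (cases M rule: block_mat_cases) (simp add: sinv_block_mat trace_block_mat tt)
qed

text \<open>Taking traces in the quadratic relation identifies its constant term as
  \<open>4 * det_inv M\<close>. Halving \<open>M + sinv M\<close> then turns the coefficients into
  \<open>tr_inv M\<close> and \<open>det_inv M\<close>.\<close>

lemma symplectic_pencil_Sp:
  fixes M :: "real^(2+2)^(2+2)"
  assumes "M \<in> Sp"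
  shows "symplectic_pencil omega (\<lambda>v. (1/2) *\<^sub>R ((M + sinv M) *v v)) (\<lambda>v. (M - sinv M) *v v)
    (tr_inv M) (det_inv M)"
proof -
  obtain p where p: "(M + sinv M) ** (M + sinv M) = trace M *\<^sub>R (M + sinv M) - p *\<^sub>R mat 1"
    by (rule pfaffian_Cayley_Hamilton)
  have MM: "M ** sinv M = mat 1" "sinv M ** M = mat 1"
    using assms by (simp_all add: Sp_sinv)
  have tr_one: "trace (mat 1 :: real^(2+2)^(2+2)) = 4"
    by (simp add: trace_I)
  have trs: "trace (k *\<^sub>R X) = k * trace X" for k and X :: "real^(2+2)^(2+2)"
    by (simp add: trace_def sum_distrib_left)
  have "(M + sinv M) ** (M + sinv M) = (M ** M + mat 1) + (mat 1 + sinv (M ** M))"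
    unfolding matrix_add_ldistrib matrix_add_rdistrib sinv_mult MM by (simp add: algebra_simps)
  then have "trace ((M + sinv M) ** (M + sinv M)) = 2 * trace (M ** M) + 8"
    by (simp only: trace_add tr_one trace_sinv)
  moreover have "trace ((M + sinv M) ** (M + sinv M)) = 2 * (trace M)\<^sup>2 - 4 * p"
    unfolding p by (simp add: trace_sub trace_add trs trace_sinv tr_one power2_eq_square)
  ultimately have p': "p = 4 * det_inv M"
    by (simp add: det_inv_def tr_inv_def power2_eq_square)
  show ?thesis
  proof (rule symplectic_pencil.intro)
    show "bilinear omega"
      by (rule omega_bilinear)
    show "omega v v = 0" for v :: "real^(2+2)"
      using omega_antisym [of v v] by simp
    show "u = 0" if "\<And>v. omega u v = 0" for u :: "real^(2+2)"
      using that by (rule omega_nondegenerate)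
    show "linear (\<lambda>v. (1/2) *\<^sub>R ((M + sinv M) *v v))" "linear (\<lambda>v. (M - sinv M) *v v)"
      by (auto intro!: linearI simp: matrix_vector_right_distrib matrix_vector_mult_scaleR
          algebra_simps)
    note bil = bilinear_ladd [OF omega_bilinear] bilinear_radd [OF omega_bilinear]
      bilinear_lmul [OF omega_bilinear] bilinear_rmul [OF omega_bilinear]
      bilinear_lsub [OF omega_bilinear] bilinear_rsub [OF omega_bilinear]
    show "omega ((1/2) *\<^sub>R ((M + sinv M) *v u)) v = omega u ((1/2) *\<^sub>R ((M + sinv M) *v v))" for u v
      by (simp add: bil matrix_vector_mult_add_rdistrib omega_sinv sinv_sinv)
    show "omega ((M - sinv M) *v u) v = - omega u ((M - sinv M) *v v)" for u v
      by (simp add: bil matrix_vector_mult_diff_rdistrib omega_sinv sinv_sinv)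
    show "(1/2) *\<^sub>R ((M + sinv M) *v ((M - sinv M) *v u)) = (M - sinv M) *v ((1/2) *\<^sub>R ((M + sinv M)
        *v u))" for u
      by (simp add: matrix_vector_mul_assoc matrix_vector_mult_scaleR matrix_add_ldistrib
          matrix_add_rdistrib
          matrix_diff_mult MM)
    show "(M - sinv M) *v ((M - sinv M) *v u) =
        4 *\<^sub>R ((1/2) *\<^sub>R ((M + sinv M) *v ((1/2) *\<^sub>R ((M + sinv M) *v u))) - u)" for u
    proof -
      have "(M - sinv M) ** (M - sinv M) = (M + sinv M) ** (M + sinv M) - 4 *\<^sub>R mat 1"
        unfolding matrix_add_ldistrib matrix_add_rdistrib matrix_diff_mult MM by (simp add: vec_eq_iff)
      then have "(M - sinv M) *v ((M - sinv M) *v u) = (M + sinv M) ** (M + sinv M) *v u - 4 *\<^sub>R u"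
        unfolding matrix_vector_mul_assoc
        by (simp add: matrix_vector_mult_diff_rdistrib scaleR_matrix_vector_assoc [symmetric])
      then show ?thesis
        by (simp add: matrix_vector_mul_assoc matrix_vector_mult_scaleR scaleR_diff_right)
    qed
    show "(1/2) *\<^sub>R ((M + sinv M) *v ((1/2) *\<^sub>R ((M + sinv M) *v u))) =
        tr_inv M *\<^sub>R ((1/2) *\<^sub>R ((M + sinv M) *v u)) - det_inv M *\<^sub>R u" for u
      by (simp add: matrix_vector_mul_assoc matrix_vector_mult_scaleR p p' tr_inv_def
          matrix_vector_mult_diff_rdistrib scaleR_matrix_vector_assoc [symmetric] scaleR_diff_right)
    show "DIM(real^(2+2)) > 2"
      by simp
  qed
qed

lemma Sp_I_iff_sinv: "M \<in> Sp_I \<longleftrightarrow> M \<in> Sp \<and> sinv M = I_mat ** M ** I_mat"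
  by (auto simp: Sp_I_def Sp_matrix_inv)

text \<open>Wonenburger's theorem for \<open>n = 2\<close>. \<open>G\<close> is the matrix of
  \<open>omega u (M v)\<close> in a \<open>good\<close> basis. Its part from
  \<open>M + sinv M\<close> is antisymmetric and its part from \<open>M - sinv M\<close> symmetric;
  \<open>good\<close> removes the former from the diagonal blocks and the latter from the others,
  which is \<open>transpose G = I_mat ** G ** I_mat\<close>. The conjugate
  \<open>- (J_mat ** G)\<close> then lies in \<open>Sp_I\<close>.\<close>

lemma Sp_conjugate_Sp_I:
  fixes M :: "real^(2+2)^(2+2)"
  assumes M: "M \<in> Sp"
  shows "\<exists>S\<in>Sp. Sp_act S M \<in> Sp_I"
proof -
  interpret symplectic_pencil omega "\<lambda>v. (1/2) *\<^sub>R ((M + sinv M) *v v)" "\<lambda>v. (M - sinv M) *v v"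
    "tr_inv M" "det_inv M"
    using M by (rule symplectic_pencil_Sp)
  obtain e1 e2 f1 f2 where good: "good e1 e2 f1 f2"
    using exists_good by blast
  define col where "col = (\<lambda>j :: 2 + 2. case j of Inl k \<Rightarrow> (if k = 1 then e1 else e2) | Inr k \<Rightarrow> (if k
      = 1 then f1 else f2))"
  define P :: "real^(2+2)^(2+2)" where "P = (\<chi> i j. col j $ i)"
  have Pnth: "(transpose P ** J_mat ** N ** P) $ i $ j = omega (col i) (N *v col j)" for N i j
  proof -
    have "(transpose P ** (J_mat ** N ** P)) $ i $ j = col i \<bullet> (\<chi> k. (J_mat ** N ** P) $ k $ j)"
      by (simp add: matrix_matrix_mult_def P_def transpose_def inner_vec_def)
    also have "(\<chi> k. (J_mat ** N ** P) $ k $ j) = J_mat ** N *v col j"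
      by (simp add: matrix_matrix_mult_def matrix_vector_mult_def P_def vec_eq_iff)
    finally show ?thesis
      by (simp add: omega_def matrix_vector_mul_assoc matrix_mul_assoc)
  qed
  have col: "col (Inl 1) = e1" "col (Inl 2) = e2" "col (Inr 1) = f1" "col (Inr 2) = f2"
    by (simp_all add: col_def)
  have "transpose P ** J_mat ** mat 1 ** P = J_mat"
  proof (rule block_matrix_eqI)
    show "(transpose P ** J_mat ** mat 1 ** P) $ Inl k $ Inl l = J_mat $ Inl k $ Inl l" for k l
      using good exhaust_2 [of k] exhaust_2 [of l] antisym [of e2 e1] unfolding Pnth
          matrix_vector_mul_lid
      by (auto simp: col J_mat_def mat_def good_def alt)
    show "(transpose P ** J_mat ** mat 1 ** P) $ Inl k $ Inr l = J_mat $ Inl k $ Inr l" for k l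
      using good exhaust_2 [of k] exhaust_2 [of l] unfolding Pnth matrix_vector_mul_lid
      by (auto simp: col J_mat_def mat_def good_def alt)
    show "(transpose P ** J_mat ** mat 1 ** P) $ Inr k $ Inl l = J_mat $ Inr k $ Inl l" for k l
      using good exhaust_2 [of k] exhaust_2 [of l] antisym [of f1 e1] antisym [of f1 e2]
        antisym [of f2 e1] antisym [of f2 e2] unfolding Pnth matrix_vector_mul_lid
      by (auto simp: col J_mat_def mat_def good_def alt)
    show "(transpose P ** J_mat ** mat 1 ** P) $ Inr k $ Inr l = J_mat $ Inr k $ Inr l" for k l
      using good exhaust_2 [of k] exhaust_2 [of l] antisym [of f2 f1] unfolding Pnth
          matrix_vector_mul_lid
      by (auto simp: col J_mat_def mat_def good_def alt)
  qed
  then have P: "P \<in> Sp"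
    by (simp add: Sp_def)
  define G where "G = transpose P ** J_mat ** M ** P"
  have conj: "Sp_act (sinv P) M = - (J_mat ** G)"
    using P by (simp add: Sp_act_sinv Sp_sinv_in sinv_sinv G_def)
      (simp add: sinv_def matrix_calc matrix_mul_assoc)
  have G: "G $ j $ i = - omega (col i) (sinv M *v col j)" for i j
    unfolding G_def Pnth using omega_sinv [of "sinv M" "col j" "col i"]
      antisym [of "sinv M *v col j" "col i"] by (simp add: sinv_sinv)
  have G': "G $ i $ j = omega (col i) (M *v col j)" for i j
    unfolding G_def Pnth ..
  have sym: "G $ j $ i = G $ i $ j" if "omega (col i) ((1/2) *\<^sub>R ((M + sinv M) *v col j)) = 0" for i j
    using that G [of j i] G' [of i j] by (simp add: lin matrix_vector_mult_add_rdistrib)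
  have skew: "G $ j $ i = - G $ i $ j" if "omega (col i) ((M - sinv M) *v col j) = 0" for i j
    using that G [of j i] G' [of i j] by (simp add: lin matrix_vector_mult_diff_rdistrib)
  have "transpose G = I_mat ** G ** I_mat"
  proof -
    obtain A B C D where blk: "G = block_mat A B C D"
      by (rule block_mat_cases)
    have "A $ 2 $ 1 = A $ 1 $ 2" "D $ 2 $ 1 = D $ 1 $ 2"
      using sym [of "Inl 2" "Inl 1"] sym [of "Inr 2" "Inr 1"] good
        sym [of "Inl 1" "Inl 2"] sym [of "Inr 1" "Inr 2"]
      by (simp_all add: col good_def blk)
    moreover have "C $ j $ i = - B $ i $ j" for i j
      using skew [of "Inl i" "Inr j"] good exhaust_2 [of i] exhaust_2 [of j]
      by (auto simp: col good_def blk)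
    ultimately have "transpose A = A" "transpose D = D" "transpose C = - B" "transpose B = - C"
      by (simp_all add: vec_eq_iff forall_2 transpose_def)
    then show ?thesis
      by (simp add: blk transpose_block_mat I_mat_def block_mat_mult matrix_calc block_mat_eq_iff)
  qed
  then have "sinv (- (J_mat ** G)) = I_mat ** (- (J_mat ** G)) ** I_mat"
    by (simp add: sinv_def matrix_calc transpose_J matrix_mul_assoc J_I)
      (simp add: matrix_mul_assoc [symmetric] J_J matrix_calc)
  then have "Sp_act (sinv P) M \<in> Sp_I"
    unfolding Sp_I_iff_sinv using Sp_act_in [OF Sp_sinv_in [OF P] M] by (simp add: conj)
  then show ?thesis
    using Sp_sinv_in [OF P] by blast
qed

section \<open>The two actions\<close>

lemma matrix_inv_transpose:
  fixes R :: "real^'n^'n"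
  assumes "invertible R"
  shows "matrix_inv (transpose R) = transpose (matrix_inv R)"
  using assms by (intro matrix_inv_unique) (simp add: matrix_transpose_mul [symmetric]
      matrix_inv_inverse)

text \<open>Conjugation by these block-diagonal symplectic matrices is the given action on
  \<open>Sp_I\<close>, so invariance under \<open>GL\<close> can be inherited from
  \<open>Sp\<close>.\<close>

definition GL_embed :: "real^'n::finite^'n \<Rightarrow> real^('n + 'n)^('n + 'n)" where
  "GL_embed R = block_mat R 0 0 (transpose (matrix_inv R))"

lemma sinv_GL_embed: "sinv (GL_embed R) = block_mat (matrix_inv R) 0 0 (transpose R)"
  by (simp add: GL_embed_def sinv_block_mat matrix_calc)

lemma GL_embed_in: "R \<in> GL \<Longrightarrow> GL_embed R \<in> Sp"
  by (simp add: Sp_iff_sinv sinv_GL_embed)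
    (simp add: GL_embed_def block_mat_mult GL_def matrix_inv_inverse matrix_calc mat_one_block
      matrix_transpose_mul [symmetric] del: matrix_transpose_mul)

lemma GL_mult: "R \<in> GL \<Longrightarrow> T \<in> GL \<Longrightarrow> R ** T \<in> (GL :: (real^'n::finite^'n) set)"
  by (simp add: GL_def invertible_mult)

lemma GL_inv: "R \<in> GL \<Longrightarrow> matrix_inv R \<in> (GL :: (real^'n::finite^'n) set)"
  using matrix_inv_inverse by (fastforce simp: GL_def invertible_def)

lemma GL_act_eq_Sp_act:
  assumes "R \<in> GL" "M \<in> Sp_I"
  shows "GL_act R M = Sp_act (GL_embed R) M"
proof -
  obtain A B C where M: "M = M_ABC A B C"
    using assms(2) unfolding Sp_I_iff_M_ABC by blast
  show ?thesis
    unfolding M GL_act_M_ABC Sp_act_sinv [OF GL_embed_in [OF assms(1)]] sinv_GL_embed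
    using assms(1)
    by (simp add: M_ABC_def GL_embed_def block_mat_mult matrix_calc matrix_mul_assoc GL_def
        matrix_inv_transpose)
qed

lemma GL_act_in:
  assumes "R \<in> GL" "M \<in> Sp_I"
  shows "GL_act R M \<in> Sp_I"
proof -
  have M: "M \<in> Sp" "sinv M = I_mat ** M ** I_mat"
    using assms(2) by (simp_all add: Sp_I_iff_sinv)
  have E: "GL_embed R \<in> Sp"
    using assms(1) by (rule GL_embed_in)
  have comm: "I_mat ** GL_embed R = GL_embed R ** I_mat" "I_mat ** sinv (GL_embed R) = sinv
      (GL_embed R) ** I_mat"
    by (simp_all add: sinv_GL_embed)
      (simp_all add: GL_embed_def I_mat_def block_mat_mult matrix_calc)
  have "sinv (GL_act R M) = GL_embed R ** (I_mat ** M ** I_mat) ** sinv (GL_embed R)"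
    using sinv_Sp_act [OF E, of M] M(2) by (simp add: GL_act_eq_Sp_act [OF assms] Sp_act_sinv [OF E])
  also have "\<dots> = (GL_embed R ** I_mat) ** M ** (I_mat ** sinv (GL_embed R))"
    by (simp add: matrix_mul_assoc)
  also have "\<dots> = I_mat ** GL_act R M ** I_mat"
    unfolding GL_act_eq_Sp_act [OF assms] Sp_act_sinv [OF E]
    unfolding comm(2) comm(1) [symmetric] by (simp add: matrix_mul_assoc)
  finally show ?thesis
    using Sp_act_in [OF E M(1)] by (simp add: Sp_I_iff_sinv GL_act_eq_Sp_act [OF assms])
qed

lemma GL_embed_mult:
  "R \<in> GL \<Longrightarrow> T \<in> GL \<Longrightarrow> GL_embed R ** GL_embed T = GL_embed (R ** T)"
proof -
  assume RT: "R \<in> GL" "T \<in> GL"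
  then have "R ** T ** (matrix_inv T ** matrix_inv R) = R ** (T ** matrix_inv T) ** matrix_inv R"
    by (simp add: matrix_mul_assoc)
  also have "\<dots> = mat 1"
    using RT by (simp add: GL_def matrix_inv_inverse)
  finally have "matrix_inv (R ** T) = matrix_inv T ** matrix_inv R"
    by (rule matrix_inv_unique)
  then show ?thesis
    by (simp add: GL_embed_def block_mat_mult matrix_calc)
qed

lemma GL_act_comp:
  assumes "R \<in> GL" "T \<in> GL" "M \<in> Sp_I"
  shows "GL_act R (GL_act T M) = GL_act (R ** T) M"
  using assms GL_act_in [OF assms(2,3)]
  by (simp add: GL_act_eq_Sp_act GL_mult Sp_act_comp GL_embed_in GL_embed_mult)

lemma GL_act_one: "M \<in> Sp_I \<Longrightarrow> GL_act (mat 1) M = M"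
proof -
  assume "M \<in> Sp_I"
  then obtain A B C where M: "M = M_ABC A B C"
    unfolding Sp_I_iff_M_ABC by blast
  have "matrix_inv (mat 1) = (mat 1 :: real^'a^'a)"
    by (rule matrix_inv_unique) simp
  then show ?thesis
    by (simp add: M GL_act_M_ABC)
qed

interpretation GL: git_action "top_of_set Sp_I" GL GL_act
proof
  show "GL \<noteq> {}"
    by (auto simp: GL_def invertible_def intro!: exI [of _ "mat 1"])
  show "\<exists>k\<in>GL. GL_act k (GL_act g x) = x" if "g \<in> GL" "x \<in> topspace (top_of_set Sp_I)" for g and x
      :: "real^('a + 'a)^('a + 'a)"
    using that GL_inv [OF that(1)]
    by (intro bexI [of _ "matrix_inv g"]) (simp_all add: GL_act_comp GL_act_one GL_def
        matrix_inv_inverse)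
qed (auto simp: GL_act_in GL_act_comp intro: GL_mult)

section \<open>The regular parts of the two quotients\<close>

definition invariants :: "real^('n::finite + 'n)^('n + 'n) \<Rightarrow> real \<times> real" where
  "invariants M = (tr_inv M, det_inv M)"

definition off_Gamma :: "(real \<times> real) set" where
  "off_Gamma = - (Gamma_plus \<union> Gamma_minus)"

lemma in_off_Gamma: "x \<in> off_Gamma \<longleftrightarrow> x \<notin> Gamma_plus \<union> Gamma_minus"
  by (simp add: off_Gamma_def)

lemma off_Gamma_iff: "(t, d) \<in> off_Gamma \<longleftrightarrow> 1 - t + d \<noteq> 0 \<and> 1 + t + d \<noteq> 0"
  by (auto simp: off_Gamma_def Gamma_plus_def Gamma_minus_def)

lemma continuous_on_matrix_mult [continuous_intros]:
  fixes f :: "'a::topological_space \<Rightarrow> real^'m^'n" and g :: "'a \<Rightarrow> real^'k^'m"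
  assumes "continuous_on S f" "continuous_on S g"
  shows "continuous_on S (\<lambda>x. f x ** g x)"
  unfolding matrix_matrix_mult_def using assms by (intro continuous_intros)

lemma continuous_on_transpose [continuous_intros]:
  fixes f :: "'a::topological_space \<Rightarrow> real^'m^'n"
  assumes "continuous_on S f"
  shows "continuous_on S (\<lambda>x. transpose (f x))"
  unfolding transpose_def using assms by (intro continuous_intros)

lemma continuous_on_block_mat [continuous_intros]:
  fixes A B C D :: "'a::topological_space \<Rightarrow> real^'n::finite^'n"
  assumes "continuous_on S A" "continuous_on S B" "continuous_on S C" "continuous_on S D"
  shows "continuous_on S (\<lambda>x. block_mat (A x) (B x) (C x) (D x))"
proof -
  have "continuous_on S (\<lambda>x. block_mat (A x) (B x) (C x) (D x) $ i $ j)" for i j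
    using assms by (cases i; cases j) (auto intro!: continuous_intros)
  then have "continuous_on S (\<lambda>x. \<chi> i j. block_mat (A x) (B x) (C x) (D x) $ i $ j)"
    by (intro continuous_on_vec_lambda)
  then show ?thesis
    by simp
qed

lemma continuous_on_tr_inv [continuous_intros]: "continuous_on S tr_inv"
  and continuous_on_det_inv [continuous_intros]: "continuous_on S det_inv"
  unfolding det_inv_def tr_inv_def trace_def by (auto intro!: continuous_intros)

lemma continuous_on_invariants: "continuous_on S invariants"
  unfolding invariants_def by (intro continuous_intros)

lemma open_off_Gamma: "open off_Gamma"
proof -
  have eq: "off_Gamma = {x. 1 - fst x + snd x \<noteq> 0} \<inter> {x. 1 + fst x + snd x \<noteq> 0}"
    using off_Gamma_iff by auto
  show ?thesis
    unfolding eq by (intro open_Int open_Collect_neq continuous_intros)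
qed

lemma invariants_Sp_act: "S \<in> Sp \<Longrightarrow> invariants (Sp_act S M) = invariants M"
  by (simp add: invariants_def inv_Sp_act)

interpretation Sp: git_locus "top_of_set (Sp :: (real^(2+2)^(2+2)) set)" Sp Sp_act euclidean
    invariants off_Gamma
  by unfold_locales (auto simp: continuous_on_invariants open_off_Gamma invariants_Sp_act
      open_openin [symmetric])

lemma invariants_GL_act: "R \<in> GL \<Longrightarrow> M \<in> Sp_I \<Longrightarrow> invariants (GL_act R M) = invariants M"
  by (simp add: GL_act_eq_Sp_act invariants_def inv_Sp_act GL_embed_in)

interpretation GL: git_locus "top_of_set (Sp_I :: (real^(2+2)^(2+2)) set)" GL GL_act euclidean
    invariants off_Gamma
  by unfold_locales (auto simp: continuous_on_invariants open_off_Gamma invariants_GL_act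
      open_openin [symmetric])

text \<open>The description in \<open>p1\<close> is satisfied through conjugation into
  \<open>Sp_I\<close>, and uniquely so because a continuous invariant takes a single value on a
  class.\<close>

lemma p1_Sp_class:
  assumes M: "M \<in> Sp"
  shows "p1 (Sp_class M) = invariants M"
proof -
  obtain S where S: "S \<in> Sp" "Sp_act S M \<in> Sp_I"
    using Sp_conjugate_Sp_I [OF M] by blast
  then obtain A B C where ABC: "Sp_act S M = M_ABC A B C"
    unfolding Sp_I_iff_M_ABC by blast
  have "M_ABC A B C \<in> Sp_I" "Sp_class M = Sp_class (M_ABC A B C)"
    "invariants M = (trace A, det A)"
    using S ABC Sp.cls_act [of S M] M inv_M_ABC [of A B C] inv_Sp_act [of S M]
    by (simp_all add: Sp_class_def invariants_def)
  moreover have "v = invariants M"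
    if v: "M_ABC A' B' C' \<in> Sp_I" "Sp_class M = Sp_class (M_ABC A' B' C')" "v = (trace A', det A')"
    for A' B' C' v
  proof -
    have "M_ABC A' B' C' \<in> Sp"
      using v(1) by (simp add: Sp_I_def)
    then have "invariants M = invariants (M_ABC A' B' C')"
      using Sp.invariant_cls [OF Sp.f_cont Sp.T_haus Sp.f_inv, of M "M_ABC A' B' C'"] M v(2)
      by (simp add: Sp_class_def)
    then show ?thesis
      using v by (simp add: invariants_def inv_M_ABC)
  qed
  ultimately show ?thesis
    unfolding p1_def by (intro the_equality) blast+
qed

lemma p2_Sp_I_class:
  assumes M: "M \<in> Sp_I"
  shows "p2 (Sp_I_class M) = invariants M"
proof -
  obtain A B C where ABC: "M = M_ABC A B C"
    using M unfolding Sp_I_iff_M_ABC by blast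
  have "M_ABC A B C \<in> Sp_I" "Sp_I_class M = Sp_I_class (M_ABC A B C)"
    "invariants M = (trace A, det A)"
    using M ABC by (simp_all add: inv_M_ABC invariants_def)
  moreover have "v = invariants M"
    if v: "M_ABC A' B' C' \<in> Sp_I" "Sp_I_class M = Sp_I_class (M_ABC A' B' C')" "v = (trace A', det A')"
    for A' B' C' v
  proof -
    have "invariants M = invariants (M_ABC A' B' C')"
      using GL.invariant_cls [OF GL.f_cont GL.T_haus GL.f_inv, of M "M_ABC A' B' C'"] M v(1,2)
      by (simp add: Sp_I_class_def)
    then show ?thesis
      using v by (simp add: invariants_def inv_M_ABC)
  qed
  ultimately show ?thesis
    unfolding p2_def by (intro the_equality) blast+
qed

lemma Sp_quotient_regular:
  "subtopology Sp_quotient (topspace Sp_quotient - bifurcation_locus_1) = Sp.regular_quotient"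
proof -
  have "topspace Sp_quotient - bifurcation_locus_1 = Sp.cls ` Sp.regular"
    using p1_Sp_class
    by (auto simp: Sp_quotient_def git_quotient_def bifurcation_locus_1_def Sp.regular_def in_off_Gamma
        Sp_class_def)
  then show ?thesis
    by (simp add: Sp.regular_quotient_def Sp_quotient_def)
qed

lemma Sp_I_quotient_regular:
  "subtopology Sp_I_quotient (topspace Sp_I_quotient - bifurcation_locus_2) = GL.regular_quotient"
proof -
  have "topspace Sp_I_quotient - bifurcation_locus_2 = GL.cls ` GL.regular"
    using p2_Sp_I_class
    by (auto simp: Sp_I_quotient_def git_quotient_def bifurcation_locus_2_def GL.regular_def
        in_off_Gamma
        Sp_I_class_def)
  then show ?thesis
    by (simp add: GL.regular_quotient_def Sp_I_quotient_def)
qed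

section \<open>Pencils and involutive symplectic matrices\<close>

definition symm :: "sym2 \<Rightarrow> real^2^2" where
  "symm = (\<lambda>(p, q, r). m2 p q q r)"

definition symm_inv :: "sym2 \<Rightarrow> real^2^2" where
  "symm_inv P = (case P of (p, q, r) \<Rightarrow> m2 (r / det2 P) (- q / det2 P) (- q / det2 P) (p / det2 P))"

lemma symm_inv:
  assumes "det2 P \<noteq> 0"
  shows "symm P ** symm_inv P = mat 1" "symm_inv P ** symm P = mat 1"
proof -
  obtain p q r where P: "P = (p, q, r)"
    by (cases P)
  have D: "p * r / det2 P - q * q / det2 P = 1"
    using assms by (simp add: diff_divide_distrib [symmetric]) (simp add: P det2_def power2_eq_square)
  show "symm P ** symm_inv P = mat 1"
    using D by (simp add: symm_def symm_inv_def P m2_simps m2_one m2_eq_iff mult.commute)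
  then show "symm_inv P ** symm P = mat 1"
    using matrix_left_right_inverse by blast
qed

lemma transpose_symm: "transpose (symm P) = symm P" "transpose (symm_inv P) = symm_inv P"
  by (simp_all add: symm_def symm_inv_def m2_simps split: prod.split)

lemma symm_add: "symm (P + Q) = symm P + symm Q"
  by (simp add: symm_def m2_simps split: prod.split)

lemma symm_scaleR: "symm (k *\<^sub>R P) = k *\<^sub>R symm P"
  by (simp add: symm_def m2_simps split: prod.split)

lemma det_symm: "det (symm P) = det2 P"
  by (simp add: symm_def det2_def m2_simps power2_eq_square split: prod.split)

lemma symm_congr: "symm (congr a b c e P) = m2 a b c e ** symm P ** transpose (m2 a b c e)"
proof -
  obtain p q r where P: "P = (p, q, r)"
    by (cases P)
  have "m2 (a\<^sup>2 * p + 2 * a * b * q + b\<^sup>2 * r) (a * c * p + (a * e + b * c) * q + b * e * r)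
      (a * c * p + (a * e + b * c) * q + b * e * r) (c\<^sup>2 * p + 2 * c * e * q + e\<^sup>2 * r) =
      m2 a b c e ** m2 p q q r ** transpose (m2 a b c e)"
    unfolding m2_simps m2_eq_iff
    by (intro conjI) (simp_all add: power2_eq_square algebra_simps)
  then show ?thesis
    by (simp add: P symm_def congr_def)
qed

lemma symm_surj:
  assumes "transpose A = A"
  shows "\<exists>P. A = symm P"
proof -
  obtain a b c d where A: "A = m2 a b c d"
    by (rule m2_cases)
  have "c = b"
    using assms unfolding A m2_simps m2_eq_iff by blast
  then have "A = symm (a, b, d)"
    by (simp add: A symm_def)
  then show ?thesis ..
qed

text \<open>
  The element of \<open>Sp_I\<close> with \<open>B = P\<close>, \<open>(A - 1) B = 2 Q\<close> and hence \<open>(A + 1) B = 2 (P + Q)\<close>.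
\<close>

definition pencil_mat :: "sym2 \<times> sym2 \<Rightarrow> real^(2+2)^(2+2)" where
  "pencil_mat x = (case x of (P, Q) \<Rightarrow>
     let K = symm (P + 2 *\<^sub>R Q); N = symm_inv P
     in M_ABC (K ** N) (symm P) (N ** K ** N ** K ** N - N))"

text \<open>With \<open>B\<close> invertible, \<open>A\<close> is recovered from \<open>A B\<close>,
  and \<open>A^2 - B C = 1\<close> is solved for \<open>C\<close>.\<close>

lemma pencil_mat_eqI:
  assumes M: "M_ABC A B C \<in> Sp_I" and B: "B = symm P" and P: "det2 P \<noteq> 0" and K: "A ** B = symm (P +
      2 *\<^sub>R Q)"
  shows "M_ABC A B C = pencil_mat (P, Q)"
proof -
  define N where "N = symm_inv P"
  have BN: "B ** N = mat 1" "N ** B = mat 1"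
    using symm_inv [OF P] by (simp_all add: B N_def)
  have "A ** A - B ** C = mat 1"
    using M unfolding Sp_I_iff_M_ABC by (auto simp: M_ABC_def block_mat_eq_iff)
  moreover have "B ** C = A ** A - (A ** A - B ** C)"
    by simp
  ultimately have "B ** C = A ** A - mat 1"
    by simp
  then have "N ** (B ** C) = N ** A ** A - N"
    by (simp add: matrix_diff_mult matrix_mul_assoc)
  then have C: "C = N ** A ** A - N"
    by (simp add: matrix_mul_assoc BN)
  have A: "A = symm (P + 2 *\<^sub>R Q) ** N"
    using BN by (simp add: K [symmetric] matrix_mul_assoc [symmetric])
  show ?thesis
    unfolding pencil_mat_def by (simp add: C B [symmetric] N_def [symmetric] A [symmetric] Let_def)
      (simp add: matrix_mul_assoc A)
qed

lemma pencil_mat_in: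
  assumes "det2 P \<noteq> 0"
  shows "pencil_mat (P, Q) \<in> Sp_I"
proof -
  define B N K where "B = symm P" and "N = symm_inv P" and "K = symm (P + 2 *\<^sub>R Q)"
  have BN: "B ** N = mat 1" "N ** B = mat 1"
    using symm_inv [OF assms] by (simp_all add: B_def N_def)
  have canc: "X ** N ** B = X" "X ** B ** N = X" for X :: "real^2^2"
    using BN by (simp_all add: matrix_mul_assoc [symmetric])
  have tr: "transpose B = B" "transpose N = N" "transpose K = K"
    by (simp_all add: B_def N_def K_def transpose_symm)
  show ?thesis
    unfolding Sp_I_iff_M_ABC pencil_mat_def
    by (intro exI [of _ "K ** N"] exI [of _ B] exI [of _ "N ** K ** N ** K ** N - N"])
      (simp add: B_def [symmetric] N_def [symmetric] K_def [symmetric] tr transpose_diff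
          matrix_transpose_mul
        matrix_diff_mult matrix_mul_assoc canc BN)
qed

text \<open>The left sides are \<open>det (1 - A)\<close> and \<open>det (1 + A)\<close>, while
  \<open>(A - 1) B = 2 Q\<close> and \<open>(A + 1) B = 2 (P + Q)\<close>. The factor 4 is the
  determinant of twice the identity.\<close>

lemma invariants_pencil_mat:
  assumes "det2 P \<noteq> 0"
  shows "1 - tr_inv (pencil_mat (P, Q)) + det_inv (pencil_mat (P, Q)) = 4 * det2 Q / det2 P"
    "1 + tr_inv (pencil_mat (P, Q)) + det_inv (pencil_mat (P, Q)) = 4 * det2 (P + Q) / det2 P"
proof -
  obtain p q r where P: "P = (p, q, r)"
    by (cases P)
  obtain x y z where Q: "Q = (x, y, z)"
    by (cases Q)
  define D where "D = det2 P"
  have D: "p * r = D + q * q" "D \<noteq> 0"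
    using assms by (simp_all add: P det2_def D_def power2_eq_square)
  have eq: "tr_inv (pencil_mat (P, Q)) = trace (symm (P + 2 *\<^sub>R Q) ** symm_inv P)"
    "det_inv (pencil_mat (P, Q)) = det (symm (P + 2 *\<^sub>R Q) ** symm_inv P)"
    using pencil_mat_in [OF assms, of Q] by (simp_all add: pencil_mat_def inv_M_ABC Let_def)
  have inv: "symm_inv P = m2 (r / D) (- q / D) (- q / D) (p / D)"
    by (simp add: symm_inv_def P D_def)
  have det: "det (symm_inv P) = 1 / D"
    using D(2) by (simp add: inv m2_simps D(1) field_simps)
  have K: "det (symm (P + 2 *\<^sub>R Q)) = D + 2 * (p * z + r * x - 2 * q * y) + 4 * det2 Q"
    by (simp add: P Q det_symm det2_def D_def power2_eq_square algebra_simps)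
  have tr: "trace (symm (P + 2 *\<^sub>R Q) ** symm_inv P) = 2 + 2 * (p * z + r * x - 2 * q * y) / D"
  proof -
    have "trace (symm (P + 2 *\<^sub>R Q) ** symm_inv P) =
        ((p + 2 * x) * r - 2 * ((q + 2 * y) * q) + (r + 2 * z) * p) / D"
      by (simp add: inv [unfolded P] P Q symm_def m2_simps diff_divide_distrib add_divide_distrib)
    also have "(p + 2 * x) * r - 2 * ((q + 2 * y) * q) + (r + 2 * z) * p =
        2 * D + 2 * (p * z + r * x - 2 * q * y)"
      using D(1) by (simp add: algebra_simps)
    finally show ?thesis
      using D(2) by (simp add: add_divide_distrib)
  qed
  have PQ: "det2 (P + Q) = D + (p * z + r * x - 2 * q * y) + det2 Q"
    by (simp add: P Q det2_def D_def power2_eq_square algebra_simps)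
  show "1 - tr_inv (pencil_mat (P, Q)) + det_inv (pencil_mat (P, Q)) = 4 * det2 Q / det2 P"
    "1 + tr_inv (pencil_mat (P, Q)) + det_inv (pencil_mat (P, Q)) = 4 * det2 (P + Q) / det2 P"
    unfolding eq det_mul det K tr PQ D_def [symmetric] using D(2)
    by (simp_all add: field_simps)
qed

lemma pencil_mat_regular:
  assumes "x \<in> Pencils"
  shows "pencil_mat x \<in> GL.regular"
proof -
  obtain P Q where x: "x = (P, Q)"
    by (cases x)
  have "det2 P \<noteq> 0" "det2 Q \<noteq> 0" "det2 (P + Q) \<noteq> 0"
    using assms by (auto simp: x Pencils_def)
  then show ?thesis
    using pencil_mat_in [of P Q] invariants_pencil_mat [of P Q]
    by (simp add: GL.regular_def invariants_def off_Gamma_iff x)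
qed

text \<open>\<open>det (B C) = det (A^2 - 1)\<close> factors into the two quantities that do not
  vanish on the regular part, so \<open>B\<close> is invertible. Symmetry of \<open>A B\<close>,
  from \<open>A B = B A^T\<close>, supplies \<open>Q\<close>.\<close>

lemma regular_pencil_mat:
  assumes "M \<in> GL.regular"
  obtains x where "x \<in> Pencils" "M = pencil_mat x"
proof -
  have M: "M \<in> Sp_I" "1 - tr_inv M + det_inv M \<noteq> 0" "1 + tr_inv M + det_inv M \<noteq> 0"
    using assms by (simp_all add: GL.regular_def invariants_def off_Gamma_iff)
  then obtain A B C where ABC: "M = M_ABC A B C" "B = transpose B" "A ** B = B ** transpose A"
      "A ** A - B ** C = mat 1"
    unfolding Sp_I_iff_M_ABC by blast
  obtain P where P: "B = symm P"
    using symm_surj ABC(2) by metis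
  have "transpose (A ** B) = A ** B"
    using ABC(2,3) by (simp add: matrix_transpose_mul)
  then obtain K where K: "A ** B = symm K"
    using symm_surj by metis
  have "det (A ** A - mat 1) = (1 - trace A + det A) * (1 + trace A + det A)"
    by (cases A rule: m2_cases) (simp add: m2_simps m2_one algebra_simps)
  also have "\<dots> \<noteq> 0"
    using M by (simp add: ABC(1) inv_M_ABC)
  also have "A ** A - mat 1 = B ** C"
    by (simp add: ABC(4) [symmetric])
  finally have "det B \<noteq> 0"
    by (simp add: det_mul)
  then have P0: "det2 P \<noteq> 0"
    by (simp add: P det_symm)
  define Q where "Q = (1/2) *\<^sub>R (K - P)"
  have "A ** B = symm (P + 2 *\<^sub>R Q)"
    by (simp add: K Q_def)
  then have eq: "M = pencil_mat (P, Q)"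
    using pencil_mat_eqI [of A B C P Q] M(1) ABC(1) P P0 by simp
  then have "(P, Q) \<in> Pencils"
    using invariants_pencil_mat [OF P0, of Q] M P0 by (auto simp: Pencils_def)
  then show ?thesis
    using that eq by blast
qed

lemma GL_act_pencil_mat:
  assumes "x \<in> Pencils" "a * e - b * c \<noteq> 0"
  shows "m2 a b c e \<in> GL" "GL_act (m2 a b c e) (pencil_mat x) = pencil_mat (pencil_congr a b c e x)"
proof -
  obtain P Q where x: "x = (P, Q)"
    by (cases x)
  have P: "det2 P \<noteq> 0"
    using assms by (auto simp: x Pencils_def)
  let ?R = "m2 a b c e"
  show R: "?R \<in> GL"
    using assms by (simp add: GL_def invertible_det_nz m2_simps)
  then have inv: "matrix_inv ?R ** ?R = mat 1"
    by (simp add: GL_def matrix_inv_inverse)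
  obtain A B C where M: "pencil_mat (P, Q) = M_ABC A B C" "B = symm P" "A = symm (P + 2 *\<^sub>R Q) **
      symm_inv P"
    by (simp add: pencil_mat_def Let_def)
  have AB: "A ** B = symm (P + 2 *\<^sub>R Q)"
    using symm_inv(2) [OF P] by (simp add: M(2,3) matrix_mul_assoc [symmetric])
  have in_I: "GL_act ?R (pencil_mat x) \<in> Sp_I"
    using GL_act_in [OF R] pencil_mat_in [OF P] by (simp add: x)
  have "?R ** A ** matrix_inv ?R ** (?R ** B ** transpose ?R) =
      ?R ** A ** (matrix_inv ?R ** ?R) ** B ** transpose ?R"
    by (simp only: matrix_mul_assoc)
  also have "\<dots> = ?R ** (A ** B) ** transpose ?R"
    by (simp add: inv matrix_mul_assoc)
  also have "\<dots> = symm (congr a b c e P + 2 *\<^sub>R congr a b c e Q)"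
    by (simp add: AB symm_congr symm_add symm_scaleR matrix_add_ldistrib matrix_add_rdistrib
        scalar_matrix_assoc matrix_scalar_ac)
  finally show "GL_act ?R (pencil_mat x) = pencil_mat (pencil_congr a b c e x)"
    using in_I assms(2) P unfolding x pencil_congr_def map_prod_simp M(1) GL_act_M_ABC
    by (intro pencil_mat_eqI) (simp_all add: M(2) symm_congr det2_congr)
qed

lemma continuous_on_m2 [continuous_intros]:
  assumes "continuous_on S a" "continuous_on S b" "continuous_on S c" "continuous_on S d"
  shows "continuous_on S (\<lambda>x. m2 (a x) (b x) (c x) (d x))"
proof -
  have "continuous_on S (\<lambda>x. m2 (a x) (b x) (c x) (d x) $ i $ j)" for i j
    using assms exhaust_2 [of i] exhaust_2 [of j] by auto
  then have "continuous_on S (\<lambda>x. \<chi> i j. m2 (a x) (b x) (c x) (d x) $ i $ j)"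
    by (intro continuous_on_vec_lambda)
  then show ?thesis
    by simp
qed

lemma continuous_on_pencil_mat: "continuous_on Pencils pencil_mat"
  unfolding pencil_mat_def M_ABC_def symm_def symm_inv_def det2_def Let_def case_prod_beta
  by (intro continuous_intros) (auto simp: Pencils_def det2_def)

section \<open>Components of the quotient by the general linear group\<close>

lemma equivclp_connected_component:
  assumes step: "\<And>x y. pencil_step x y \<Longrightarrow> connected_component_of T (h x) (h y)"
    and "equivclp pencil_step x y" "h x \<in> topspace T"
  shows "connected_component_of T (h x) (h y)"
  using assms(2)
proof (induction rule: equivclp_induct)
  case base
  then show ?case
    using assms(3) by (simp add: connected_component_of_refl)
next
  case (step y z)
  then show ?case
    using assms(1) by (metis connected_component_of_sym connected_component_of_trans)
qed

lemma connected_pencil_segment: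
  assumes "closed_segment x y \<subseteq> Pencils"
  shows "connected (pencil_mat ` closed_segment x y)"
  by (intro connected_continuous_image continuous_on_subset [OF continuous_on_pencil_mat assms]
      connected_segment)

lemma GL_pencil_component:
  assumes "x \<in> Pencils" "equivclp pencil_step x y"
  shows "connected_component_of GL.regular_quotient (GL.cls (pencil_mat x)) (GL.cls (pencil_mat y))"
proof (rule equivclp_connected_component [OF _ assms(2)])
  show top: "GL.cls (pencil_mat x) \<in> topspace GL.regular_quotient"
    using pencil_mat_regular [OF assms(1)] by (simp add: GL.topspace_regular_quotient)
  show "connected_component_of GL.regular_quotient (GL.cls (pencil_mat x)) (GL.cls (pencil_mat y))"
    if "pencil_step x y" for x y
  proof -
    have xy: "x \<in> Pencils" "y \<in> Pencils"
      using that by (simp_all add: pencil_step_def)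
    consider a b c e where "a * e - b * c \<noteq> 0" "y = pencil_congr a b c e x" | "closed_segment x y \<subseteq>
        Pencils"
      using \<open>pencil_step x y\<close> unfolding pencil_step_def by blast
    then show ?thesis
    proof cases
      case 1
      have "pencil_mat x \<in> topspace (top_of_set Sp_I)"
        using pencil_mat_regular [OF xy(1)] GL.regular_subset by blast
      then have "GL.cls (pencil_mat y) = GL.cls (pencil_mat x)"
        using GL.cls_act GL_act_pencil_mat [OF xy(1) 1(1)] 1(2) by metis
      then show ?thesis
        using pencil_mat_regular [OF xy(1)] 
        by (simp add: connected_component_of_refl GL.topspace_regular_quotient)
    next
      case 2
      have "pencil_mat ` closed_segment x y \<subseteq> GL.regular"
        using 2 pencil_mat_regular by blast
      moreover from this have "connectedin (top_of_set Sp_I) (pencil_mat ` closed_segment x y)"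
        using connected_pencil_segment [OF 2] GL.regular_subset
        by (auto simp: connectedin_subtopology)
      ultimately show ?thesis
        using GL.connected_component_cls [of "pencil_mat ` closed_segment x y" "pencil_mat x"
            "pencil_mat y"]
        by simp
    qed
  qed
qed

lemma Sp_I_subset_Sp: "Sp_I \<subseteq> Sp"
  by (auto simp: Sp_I_def)

lemma GL_regular_subset_Sp_regular: "GL.regular \<subseteq> Sp.regular"
  using Sp_I_subset_Sp by (auto simp: GL.regular_def Sp.regular_def)

lemma Sp_pencil_component:
  assumes "x \<in> Pencils" "equivclp pencil_step x y"
  shows "connected_component_of Sp.regular_quotient (Sp.cls (pencil_mat x)) (Sp.cls (pencil_mat y))"
proof (rule equivclp_connected_component [OF _ assms(2)])
  have reg: "pencil_mat x \<in> Sp.regular" if "x \<in> Pencils" for x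
    using pencil_mat_regular [OF that] GL_regular_subset_Sp_regular by blast
  then show top: "Sp.cls (pencil_mat x) \<in> topspace Sp.regular_quotient"
    using assms(1) by (simp add: Sp.topspace_regular_quotient)
  show "connected_component_of Sp.regular_quotient (Sp.cls (pencil_mat x)) (Sp.cls (pencil_mat y))"
    if "pencil_step x y" for x y
  proof -
    have xy: "x \<in> Pencils" "y \<in> Pencils"
      using that by (simp_all add: pencil_step_def)
    consider a b c e where "a * e - b * c \<noteq> 0" "y = pencil_congr a b c e x" | "closed_segment x y \<subseteq>
        Pencils"
      using \<open>pencil_step x y\<close> unfolding pencil_step_def by blast
    then show ?thesis
    proof cases
      case 1
      have x: "pencil_mat x \<in> Sp_I"
        using pencil_mat_regular [OF xy(1)] by (simp add: GL.regular_def)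
      have R: "m2 a b c e \<in> GL" "pencil_mat y = Sp_act (GL_embed (m2 a b c e)) (pencil_mat x)"
        using GL_act_pencil_mat [OF xy(1) 1(1)] 1(2) GL_act_eq_Sp_act [OF _ x] by simp_all
      then have "Sp.cls (pencil_mat y) = Sp.cls (pencil_mat x)"
        using Sp.cls_act [OF GL_embed_in [OF R(1)], of "pencil_mat x"] x Sp_I_subset_Sp by auto
      then show ?thesis
        using reg [OF xy(1)] by (simp add: connected_component_of_refl Sp.topspace_regular_quotient)
    next
      case 2
      have "pencil_mat ` closed_segment x y \<subseteq> Sp.regular"
        using 2 reg by blast
      moreover from this have "connectedin (top_of_set Sp) (pencil_mat ` closed_segment x y)"
        using connected_pencil_segment [OF 2] Sp.regular_subset
        by (auto simp: connectedin_subtopology)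
      ultimately show ?thesis
        using Sp.connected_component_cls [of "pencil_mat ` closed_segment x y" "pencil_mat x"
            "pencil_mat y"]
        by simp
    qed
  qed
qed

text \<open>
  \<open>A = diag (1 + k1, 1 + k2)\<close> and \<open>B = diag (2 s1, 2 s2)\<close>; the values \<open>k = 2, -1, -4\<close> put the
  eigenvalue \<open>1 + k\<close> of \<open>A\<close> above \<open>1\<close>, between \<open>-1\<close> and \<open>1\<close>, and below \<open>-1\<close>.
\<close>

definition diag_pencil :: "real \<Rightarrow> real \<Rightarrow> real \<Rightarrow> real \<Rightarrow> sym2 \<times> sym2" where
  "diag_pencil s1 k1 s2 k2 = ((2 * s1, 0, 2 * s2), (s1 * k1, 0, s2 * k2))"

text \<open>Two eigenvalues in the same one of the three ranges leave 3 choices of signs, in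
  different ranges 4, which makes 21 diagonal cases. Opposite signs with \<open>k1 = k2 = 2\<close>
  or \<open>k1 = k2 = -4\<close> are left out: like \<open>diag_pencil 1 (-1) (-1) (-1)\<close> they
  have three indefinite forms.\<close>

definition GL_reps :: "(sym2 \<times> sym2) list" where
  "GL_reps =
    [diag_pencil 1 2 1 2, diag_pencil (-1) 2 (-1) 2,
     diag_pencil 1 (-4) 1 (-4), diag_pencil (-1) (-4) (-1) (-4),
     diag_pencil 1 (-1) 1 (-1), diag_pencil (-1) (-1) (-1) (-1), diag_pencil 1 (-1) (-1) (-1),
     diag_pencil 1 2 1 (-1), diag_pencil 1 2 (-1) (-1), diag_pencil (-1) 2 1 (-1), diag_pencil (-1)
         2 (-1) (-1),
     diag_pencil 1 2 1 (-4), diag_pencil 1 2 (-1) (-4), diag_pencil (-1) 2 1 (-4), diag_pencil (-1)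
         2 (-1) (-4),
     diag_pencil 1 (-1) 1 (-4), diag_pencil 1 (-1) (-1) (-4), diag_pencil (-1) (-1) 1 (-4),
         diag_pencil (-1) (-1) (-1) (-4)]"

lemma diag_pencil_in:
  assumes "s1 \<noteq> 0" "s2 \<noteq> 0" "k1 \<noteq> 0" "k2 \<noteq> 0" "k1 \<noteq> -2" "k2 \<noteq> -2"
  shows "diag_pencil s1 k1 s2 k2 \<in> Pencils"
proof -
  have "2 * s1 + s1 * k1 = s1 * (k1 + 2)" "2 * s2 + s2 * k2 = s2 * (k2 + 2)"
    by (simp_all add: algebra_simps)
  then show ?thesis
    using assms by (simp add: diag_pencil_def Pencils_def det2_def)
qed

lemma GL_reps_subset: "set GL_reps \<subseteq> Pencils"
  by (simp add: GL_reps_def diag_pencil_in)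

lemma GL_reps_types:
  "map pencil_type GL_reps =
    [[True, False, True, False, True, False], [False, True, False, True, False, True],
     [True, False, False, True, False, True], [False, True, True, False, True, False],
     [True, False, False, True, True, False], [False, True, True, False, False, True],
     [False, False, False, False, False, False],
     [True, False, False, False, True, False], [False, False, True, False, False, False],
     [False, False, False, True, False, False], [False, True, False, False, False, True],
     [True, False, False, False, False, False], [False, False, True, False, True, False],
     [False, False, False, True, False, True], [False, True, False, False, False, False],
     [True, False, False, True, False, False], [False, False, False, False, True, False],
     [False, False, False, False, False, True], [False, True, True, False, False, False]]"
  by (simp add: GL_reps_def diag_pencil_def pencil_type_def posdef_def negdef_def det2_def)

text \<open>The mixed term of \<open>det2 (P + Q)\<close>, multiplied by \<open>p * x\<close>, is a
  sum of two positive terms and a square.\<close>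

lemma posdef_add:
  assumes "posdef P" "posdef Q"
  shows "posdef (P + Q)"
proof -
  obtain p q r x y z where PQ: "P = (p, q, r)" "Q = (x, y, z)"
    by (cases P; cases Q)
  have h: "p > 0" "x > 0" "p * r > q\<^sup>2" "x * z > y\<^sup>2"
    using assms by (auto simp: PQ posdef_def det2_def)
  have "p * (x * (p * z + x * r - 2 * q * y)) = p\<^sup>2 * (x * z - y\<^sup>2) + x\<^sup>2 * (p * r - q\<^sup>2) + (p * y -
      x * q)\<^sup>2"
    by (simp add: power2_eq_square algebra_simps)
  also have "\<dots> > 0"
    using h by (intro add_pos_nonneg add_pos_pos mult_pos_pos) simp_all
  finally have "p * z + x * r - 2 * q * y > 0"
    using h by (simp add: zero_less_mult_iff)
  then show ?thesis
    using h by (simp add: PQ posdef_def det2_def power2_eq_square algebra_simps)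
qed

text \<open>The propositional core of the count. The last three assumptions allow 27 patterns; the
  first six, which express additivity of definiteness among the three forms, exclude 8 of
  them.\<close>

lemma type_list_in_GL_reps:
  assumes "p \<longrightarrow> p' \<longrightarrow> p''" "n \<longrightarrow> n' \<longrightarrow> n''" "p'' \<longrightarrow> n' \<longrightarrow> p" "n'' \<longrightarrow> p' \<longrightarrow> n"
    "p'' \<longrightarrow> n \<longrightarrow> p'" "n'' \<longrightarrow> p \<longrightarrow> n'" "p \<longrightarrow> \<not> n" "p' \<longrightarrow> \<not> n'" "p'' \<longrightarrow> \<not> n''"
  shows "[p, n, p', n', p'', n''] \<in> set (map pencil_type GL_reps)"
  using assms unfolding GL_reps_types list.set insert_iff list.inject empty_iff simp_thms by argo

lemma pencil_type_in:
  assumes "x \<in> Pencils"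
  obtains y where "y \<in> set GL_reps" "pencil_type x = pencil_type y"
proof -
  obtain P Q where x: "x = (P, Q)"
    by (cases x)
  have negdef_add: "negdef (P + Q)" if "negdef P" "negdef Q" for P Q
    using posdef_add [of "- P" "- Q"] that definite_uminus(3) [of P Q]
    by (simp add: definite_uminus add.commute)
  have "posdef P \<Longrightarrow> posdef Q \<Longrightarrow> posdef (P + Q)" "negdef P \<Longrightarrow> negdef Q \<Longrightarrow> negdef (P + Q)"
    "posdef (P + Q) \<Longrightarrow> negdef Q \<Longrightarrow> posdef P" "negdef (P + Q) \<Longrightarrow> posdef Q \<Longrightarrow> negdef P"
    "posdef (P + Q) \<Longrightarrow> negdef P \<Longrightarrow> posdef Q" "negdef (P + Q) \<Longrightarrow> posdef P \<Longrightarrow> negdef Q"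
    using posdef_add [of P Q] negdef_add [of P Q] posdef_add [of "P + Q" "- Q"] negdef_add [of "P +
        Q" "- Q"]
      posdef_add [of "P + Q" "- P"] negdef_add [of "P + Q" "- P"]
    by (simp_all add: definite_uminus)
  then have "[posdef P, negdef P, posdef Q, negdef Q, posdef (P + Q), negdef (P + Q)] \<in>
      set (map pencil_type GL_reps)"
    using not_negdef_posdef by (intro type_list_in_GL_reps; blast)
  moreover have "pencil_type x = [posdef P, negdef P, posdef Q, negdef Q, posdef (P + Q), negdef (P
      + Q)]"
    by (simp add: x pencil_type_def)
  ultimately have "pencil_type x \<in> set (map pencil_type GL_reps)"
    by (simp only:)
  then show ?thesis
    using that by auto
qed

lemma GL_reps_distinct: "distinct (map pencil_type GL_reps)"
  unfolding GL_reps_types by simp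

text \<open>Inverts \<open>pencil_mat\<close> on \<open>Pencils\<close> by reading off
  \<open>B\<close> and \<open>A B\<close>. Only products of entries occur, so it is continuous on
  all matrices.\<close>

definition mat_pencil :: "real^(2+2)^(2+2) \<Rightarrow> sym2 \<times> sym2" where
  "mat_pencil M =
    (let A = (\<chi> k l. M $ Inl k $ Inl l); B = (\<chi> k l. M $ Inl k $ Inr l);
         s = (\<lambda>X :: real^2^2. (X $ 1 $ 1, X $ 1 $ 2, X $ 2 $ 2))
     in (s B, (1/2) *\<^sub>R (s (A ** B) - s B)))"

lemma mat_pencil_pencil_mat:
  assumes "x \<in> Pencils"
  shows "mat_pencil (pencil_mat x) = x"
proof -
  obtain P Q where x: "x = (P, Q)"
    by (cases x)
  have "det2 P \<noteq> 0"
    using assms by (auto simp: x Pencils_def)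
  then have "symm (P + 2 *\<^sub>R Q) ** symm_inv P ** symm P = symm (P + 2 *\<^sub>R Q)"
    by (simp add: matrix_mul_assoc [symmetric] symm_inv)
  then show ?thesis
    by (cases P; cases Q) (simp add: x mat_pencil_def pencil_mat_def M_ABC_def Let_def symm_def)
qed

lemma continuous_on_mat_pencil: "continuous_on S mat_pencil"
  unfolding mat_pencil_def Let_def by (intro continuous_intros)

lemma open_Pencils: "open Pencils"
proof -
  have "Pencils = {x. det2 (fst x) \<noteq> 0} \<inter> {x. det2 (snd x) \<noteq> 0} \<inter> {x. det2 (fst x + snd x) \<noteq> 0}"
    by (auto simp: Pencils_def)
  moreover have "open \<dots>"
    unfolding det2_def case_prod_beta by (intro open_Int open_Collect_neq continuous_intros)
  ultimately show ?thesis
    by simp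
qed

text \<open>On \<open>Pencils\<close> the determinant of \<open>f x\<close> does not vanish, and
  where it is positive neither does the leading entry. Each flag and its negation are therefore
  given by strict inequalities.\<close>

lemma open_definite:
  fixes f :: "sym2 \<times> sym2 \<Rightarrow> sym2"
  assumes f: "continuous_on UNIV f" and nz: "\<And>x. x \<in> Pencils \<Longrightarrow> det2 (f x) \<noteq> 0"
  shows "open {x \<in> Pencils. posdef (f x) = b}" "open {x \<in> Pencils. negdef (f x) = b}"
proof -
  have det: "continuous_on UNIV (\<lambda>x. det2 (f x))"
    unfolding det2_def case_prod_beta using f by (intro continuous_intros)
  have fst: "continuous_on UNIV (\<lambda>x. fst (f x))"
    using f by (intro continuous_intros)
  let ?neg = "{x. det2 (f x) < 0}" and ?p = "{x. det2 (f x) > 0} \<inter> {x. fst (f x) > 0}"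
    and ?n = "{x. det2 (f x) > 0} \<inter> {x. fst (f x) < 0}"
  have op: "open ?neg" "open ?p" "open ?n"
    using det fst by (auto intro!: open_Int open_Collect_less continuous_intros)
  have fst_nz: "fst (f x) \<noteq> 0" if "det2 (f x) > 0" for x
    using that by (cases "f x") (auto simp: det2_def)
  have "(posdef (f x) = b) = (x \<in> (if b then ?p else ?neg \<union> ?n))"
    "(negdef (f x) = b) = (x \<in> (if b then ?n else ?neg \<union> ?p))" if "x \<in> Pencils" for x
    using nz [OF that] fst_nz [of x] by (auto simp: posdef_def negdef_def neq_iff)
  then have "{x \<in> Pencils. posdef (f x) = b} = Pencils \<inter> (if b then ?p else ?neg \<union> ?n)"
    "{x \<in> Pencils. negdef (f x) = b} = Pencils \<inter> (if b then ?n else ?neg \<union> ?p)"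
    by blast+
  then show "open {x \<in> Pencils. posdef (f x) = b}" "open {x \<in> Pencils. negdef (f x) = b}"
    using op open_Pencils by (auto intro!: open_Int open_Un)
qed

lemma open_pencil_type: "open {x \<in> Pencils. pencil_type x = \<tau>}"
proof (cases "\<exists>b1 b2 b3 b4 b5 b6. \<tau> = [b1, b2, b3, b4, b5, b6]")
  case True
  then obtain b1 b2 b3 b4 b5 b6 where \<tau>: "\<tau> = [b1, b2, b3, b4, b5, b6]"
    by blast
  have "{x \<in> Pencils. pencil_type x = \<tau>} =
    {x \<in> Pencils. posdef (fst x) = b1} \<inter> {x \<in> Pencils. negdef (fst x) = b2} \<inter>
    ({x \<in> Pencils. posdef (snd x) = b3} \<inter> {x \<in> Pencils. negdef (snd x) = b4}) \<inter>
    ({x \<in> Pencils. posdef (fst x + snd x) = b5} \<inter> {x \<in> Pencils. negdef (fst x + snd x) = b6})"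
    by (rule set_eqI) (simp add: \<tau> pencil_type_def case_prod_beta, blast)
  moreover have "open \<dots>"
    by (intro open_Int open_definite) (auto simp: Pencils_def intro!: continuous_intros)
  ultimately show ?thesis
    by simp
next
  case False
  then have "pencil_type x \<noteq> \<tau>" for x
    by (cases x rule: prod.exhaust) (auto simp: pencil_type_def)
  then have "{x \<in> Pencils. pencil_type x = \<tau>} = {}"
    by blast
  then show ?thesis
    by (simp only: open_empty)
qed

lemma mat_pencil_in: "M \<in> GL.regular \<Longrightarrow> mat_pencil M \<in> Pencils"
  by (elim regular_pencil_mat) (simp add: mat_pencil_pencil_mat)

theorem card_components_Sp_I: "card (connected_components_of GL.regular_quotient) = 19"
proof -
  let ?Reps = "pencil_mat ` set GL_reps"
  have "card (connected_components_of GL.regular_quotient) = card ?Reps"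
  proof (rule GL.card_components)
    show "?Reps \<subseteq> GL.regular"
      using GL_reps_subset pencil_mat_regular by blast
    show "\<exists>r\<in>?Reps. connected_component_of GL.regular_quotient (GL.cls M) (GL.cls r)" if "M \<in>
        GL.regular" for M
    proof -
      obtain x where x: "x \<in> Pencils" "M = pencil_mat x"
        using regular_pencil_mat [OF \<open>M \<in> GL.regular\<close>] .
      obtain y where y: "y \<in> set GL_reps" "pencil_type x = pencil_type y"
        using pencil_type_in [OF x(1)] .
      have "equivclp pencil_step x y"
        using pencil_equiv [OF x(1) _ y(2)] y(1) GL_reps_subset by blast
      then show ?thesis
        using GL_pencil_component [OF x(1)] x(2) y(1) by blast
    qed
    show "\<exists>V. openin (top_of_set Sp_I) V \<and> V \<subseteq> GL.regular \<and> openin (top_of_set Sp_I) (GL.regular - V) \<and>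
        (\<forall>g\<in>GL. \<forall>x\<in>V. GL_act g x \<in> V) \<and> (r \<in> V \<longleftrightarrow> s \<notin> V)"
      if "r \<in> ?Reps" "s \<in> ?Reps" "r \<noteq> s" for r s
    proof -
      obtain x y where xy: "x \<in> set GL_reps" "y \<in> set GL_reps" "r = pencil_mat x" "s = pencil_mat y"
          "x \<noteq> y"
        using \<open>r \<in> ?Reps\<close> \<open>s \<in> ?Reps\<close> \<open>r \<noteq> s\<close> by blast
      have P: "x \<in> Pencils" "y \<in> Pencils"
        using xy GL_reps_subset by auto
      have ne: "pencil_type x \<noteq> pencil_type y"
        using GL_reps_distinct xy by (auto simp: distinct_map inj_on_def)
      \<comment> \<open>\<open>V\<close> and its complement in the regular part are preimages of
        unions of open type sets, and congruences preserve the type.\<close>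
      define V where "V = {M \<in> GL.regular. pencil_type (mat_pencil M) = pencil_type x}"
      have reg: "GL.regular \<subseteq> Sp_I"
        using GL.regular_subset by simp
      have open_reg: "openin (top_of_set Sp_I) GL.regular"
        using openin_continuous_map_preimage [OF GL.f_cont GL.U_open] by (simp add: GL.regular_def)
      have *: "openin (top_of_set Sp_I) {M \<in> GL.regular. mat_pencil M \<in> W}" if "open W" for W
      proof -
        have "openin (top_of_set Sp_I) (Sp_I \<inter> mat_pencil -` W)"
          using that continuous_on_mat_pencil by (simp add: continuous_openin_preimage_gen)
        then have "openin (top_of_set Sp_I) (GL.regular \<inter> (Sp_I \<inter> mat_pencil -` W))"
          using open_reg by blast
        moreover have "GL.regular \<inter> (Sp_I \<inter> mat_pencil -` W) = {M \<in> GL.regular. mat_pencil M \<in> W}"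
          using reg by auto
        ultimately show ?thesis
          by simp
      qed
      have "V = {M \<in> GL.regular. mat_pencil M \<in> {z \<in> Pencils. pencil_type z = pencil_type x}}"
        using mat_pencil_in by (auto simp: V_def)
      then have "openin (top_of_set Sp_I) V"
        using * [OF open_pencil_type] by simp
      moreover have "GL.regular - V =
          {M \<in> GL.regular. mat_pencil M \<in> (\<Union>\<tau>\<in>{\<tau>. \<tau> \<noteq> pencil_type x}. {z \<in> Pencils. pencil_type z =
              \<tau>})}"
        using mat_pencil_in by (auto simp: V_def)
      then have "openin (top_of_set Sp_I) (GL.regular - V)"
        using * [OF open_UN, of "{\<tau>. \<tau> \<noteq> pencil_type x}" "\<lambda>\<tau>. {z \<in> Pencils. pencil_type z = \<tau>}"]
            open_pencil_type
        by simp
      moreover have "GL_act R M \<in> V" if R: "R \<in> GL" and M: "M \<in> V" for R M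
      proof -
        obtain a b c e where abce: "R = m2 a b c e"
          by (rule m2_cases)
        have det: "a * e - b * c \<noteq> 0"
          using R by (simp add: abce GL_def invertible_det_nz m2_simps)
        obtain z where z: "z \<in> Pencils" "M = pencil_mat z"
          using regular_pencil_mat [of M] M unfolding V_def by blast
        have rel: "pencil_rel z (pencil_congr a b c e z)"
          by (rule pencil_rel_congr [OF z(1) det])
        then have "pencil_congr a b c e z \<in> Pencils" "pencil_type (pencil_congr a b c e z) =
            pencil_type z"
          by (simp_all add: pencil_rel_def)
        then show ?thesis
          using M z GL_act_pencil_mat(2) [OF z(1) det]
          by (simp add: V_def abce mat_pencil_pencil_mat pencil_mat_regular)
      qed
      moreover have "r \<in> V" "s \<notin> V"
        using xy P ne by (auto simp: V_def mat_pencil_pencil_mat pencil_mat_regular)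
      ultimately show ?thesis
        by (intro exI [of _ V]) (auto simp: V_def)
    qed
  qed
  also have "card ?Reps = card (set GL_reps)"
  proof (rule card_image, rule inj_onI)
    fix x y assume "x \<in> set GL_reps" "y \<in> set GL_reps" "pencil_mat x = pencil_mat y"
    then show "x = y"
      using GL_reps_subset mat_pencil_pencil_mat by (metis subsetD)
  qed
  also have "\<dots> = length GL_reps"
    using GL_reps_distinct by (simp add: distinct_card distinct_map)
  also have "\<dots> = 19"
    by (simp add: GL_reps_def)
  finally show ?thesis .
qed

section \<open>Clopen invariants of symplectic conjugation\<close>

lemma continuous_on_matrix_vector [continuous_intros]:
  fixes f :: "'a::topological_space \<Rightarrow> real^'m^'n" and g :: "'a \<Rightarrow> real^'m"
  assumes "continuous_on S f" "continuous_on S g"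
  shows "continuous_on S (\<lambda>x. f x *v g x)"
  unfolding matrix_vector_mult_def using assms by (intro continuous_intros)

lemma continuous_on_omega [continuous_intros]:
  assumes "continuous_on S f" "continuous_on S g"
  shows "continuous_on S (\<lambda>x. omega (f x) (g x))"
  unfolding omega_def using assms by (intro continuous_intros)

lemma continuous_on_sinv [continuous_intros]:
  assumes "continuous_on S f"
  shows "continuous_on S (\<lambda>x. sinv (f x))"
  unfolding sinv_def using assms by (intro continuous_intros)

lemma matrix_scaleR_mult:
  fixes A :: "real^'m^'n" and B :: "real^'k^'m"
  shows "(k *\<^sub>R A) ** B = k *\<^sub>R (A ** B)" "A ** (k *\<^sub>R B) = k *\<^sub>R (A ** B)"
  by (simp_all add: matrix_matrix_mult_def vec_eq_iff sum_distrib_left mult.assoc mult.left_commute)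

text \<open>For \<open>M_ABC A B C\<close> in \<open>Sp_I\<close> this is
  \<open>det (1 - A)\<close>, the characteristic polynomial of \<open>A\<close> at \<open>1\<close>.
  \<open>gap_plus\<close> is its counterpart at \<open>-1\<close>.\<close>

definition gap_minus :: "real^(2+2)^(2+2) \<Rightarrow> real" where
  "gap_minus M = 1 - tr_inv M + det_inv M"

definition gap_plus :: "real^(2+2)^(2+2) \<Rightarrow> real" where
  "gap_plus M = 1 + tr_inv M + det_inv M"

lemma Sp_regular_iff: "M \<in> Sp.regular \<longleftrightarrow> M \<in> Sp \<and> gap_minus M \<noteq> 0 \<and> gap_plus M \<noteq> 0"
  by (auto simp: Sp.regular_def invariants_def off_Gamma_iff gap_minus_def gap_plus_def)

definition krein :: "real^(2+2)^(2+2) \<Rightarrow> real^(2+2) \<Rightarrow> real" where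
  "krein M v = omega v ((M - sinv M) *v v)"

text \<open>
  The Krein form composed with \<open>M + M\<^sup>-\<^sup>1 - 2 \<mu>\<close>, where \<open>\<mu>\<close> is the largest eigenvalue of \<open>A\<close>: this
  kills the eigenspace of \<open>\<mu>\<close> and only sees the other eigenvalue.
\<close>

definition side_form :: "real^(2+2)^(2+2) \<Rightarrow> real^(2+2) \<Rightarrow> real" where
  "side_form M v = omega v ((M - sinv M) *v
     ((M + sinv M) *v v - (tr_inv M + sqrt ((tr_inv M)\<^sup>2 - 4 * det_inv M)) *\<^sub>R v))"

lemma Sp_act_vector: "S \<in> Sp \<Longrightarrow> Sp_act S M *v (S *v v) = S *v (M *v v)"
  by (simp add: Sp_act_sinv matrix_vector_mul_assoc matrix_mul_assoc [symmetric] Sp_sinv)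

lemma Sp_act_add: "Sp_act S (M + N) = Sp_act S M + Sp_act S N"
  by (simp add: Sp_act_def matrix_add_ldistrib matrix_add_rdistrib)

lemma Sp_act_diff: "Sp_act S (M - N) = Sp_act S M - Sp_act S N"
  by (simp add: Sp_act_def matrix_diff_mult)

lemma krein_Sp_act: "S \<in> Sp \<Longrightarrow> krein (Sp_act S M) (S *v v) = krein M v"
  by (simp add: krein_def sinv_Sp_act Sp_act_diff [symmetric] Sp_act_vector omega_Sp)

lemma side_form_Sp_act: "S \<in> Sp \<Longrightarrow> side_form (Sp_act S M) (S *v v) = side_form M v"
  by (simp add: side_form_def sinv_Sp_act Sp_act_diff [symmetric] Sp_act_add [symmetric]
      Sp_act_vector omega_Sp
      inv_Sp_act matrix_vector_mult_scaleR [symmetric] matrix_vector_mult_diff_distrib [symmetric])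

lemma gap_Sp_act: "S \<in> Sp \<Longrightarrow> gap_minus (Sp_act S M) = gap_minus M" "S \<in> Sp \<Longrightarrow> gap_plus (Sp_act S M) =
    gap_plus M"
  by (simp_all add: gap_minus_def gap_plus_def inv_Sp_act)

lemma Sp_regular_act: "S \<in> Sp \<Longrightarrow> M \<in> Sp.regular \<Longrightarrow> Sp_act S M \<in> Sp.regular"
  by (simp add: Sp_regular_iff Sp_act_in gap_Sp_act)

definition clopen_invariant :: "(real^(2+2)^(2+2)) set \<Rightarrow> bool" where
  "clopen_invariant V \<longleftrightarrow> V \<subseteq> Sp.regular \<and> openin (top_of_set Sp) V \<and>
     openin (top_of_set Sp) (Sp.regular - V) \<and> (\<forall>S\<in>Sp. \<forall>M\<in>V. Sp_act S M \<in> V)"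

lemma openin_Sp_regular: "openin (top_of_set Sp) Sp.regular"
  using openin_continuous_map_preimage [OF Sp.f_cont Sp.U_open] by (simp add: Sp.regular_def)

lemma openin_regular_Int: "open W \<Longrightarrow> openin (top_of_set Sp) (Sp.regular \<inter> W)"
proof -
  assume "open W"
  then have "openin (top_of_set Sp) (Sp.regular \<inter> (Sp \<inter> W))"
    by (rule openin_Int [OF openin_Sp_regular openin_open_Int])
  moreover have "Sp.regular \<inter> (Sp \<inter> W) = Sp.regular \<inter> W"
    by (auto simp: Sp_regular_iff)
  ultimately show ?thesis
    by simp
qed

lemma clopen_invariantI:
  assumes "open W" "open W'"
    and "\<And>M. M \<in> Sp.regular \<Longrightarrow> P M \<longleftrightarrow> M \<in> W" "\<And>M. M \<in> Sp.regular \<Longrightarrow> \<not> P M \<longleftrightarrow> M \<in> W'"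
    and inv: "\<And>S M. S \<in> Sp \<Longrightarrow> M \<in> Sp.regular \<Longrightarrow> P M \<Longrightarrow> P (Sp_act S M)"
  shows "clopen_invariant {M \<in> Sp.regular. P M}"
proof -
  have "{M \<in> Sp.regular. P M} = Sp.regular \<inter> W" "Sp.regular - {M \<in> Sp.regular. P M} = Sp.regular \<inter> W'"
    using assms by blast+
  then show ?thesis
    unfolding clopen_invariant_def using assms openin_regular_Int Sp_regular_act by auto
qed

lemma clopen_invariant_Int:
  assumes "clopen_invariant {M \<in> Sp.regular. P M}" "clopen_invariant {M \<in> Sp.regular. Q M}"
  shows "clopen_invariant {M \<in> Sp.regular. P M \<and> Q M}"
proof -
  have eq: "{M \<in> Sp.regular. P M \<and> Q M} = {M \<in> Sp.regular. P M} \<inter> {M \<in> Sp.regular. Q M}"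
    "Sp.regular - {M \<in> Sp.regular. P M \<and> Q M} =
      (Sp.regular - {M \<in> Sp.regular. P M}) \<union> (Sp.regular - {M \<in> Sp.regular. Q M})"
    by auto
  show ?thesis
    unfolding clopen_invariant_def eq(2) using assms unfolding clopen_invariant_def
    by (auto simp: eq(1))
qed

lemma inv_uminus:
  "tr_inv (- M) = - tr_inv M" "det_inv (- M) = det_inv M" "sinv (- M) = - sinv M"
  "gap_minus (- N) = gap_plus N" "gap_plus (- N) = gap_minus N" "Sp_act S (- M) = - Sp_act S M"
  by (simp_all add: tr_inv_def det_inv_def sinv_def trace_def gap_minus_def gap_plus_def sum_negf
      Sp_act_def matrix_calc)

lemma regular_uminus: "- M \<in> Sp.regular \<longleftrightarrow> M \<in> Sp.regular"
  using Sp_uminus [of M] Sp_uminus [of "- M"] by (auto simp: Sp_regular_iff inv_uminus)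

text \<open>Negation is a homeomorphism of the regular part that commutes with conjugation. As it
  exchanges the two gaps, it turns invariants for eigenvalues beyond \<open>1\<close> into
  invariants for eigenvalues beyond \<open>-1\<close>.\<close>

lemma clopen_invariant_uminus:
  assumes "clopen_invariant {M \<in> Sp.regular. P M}"
  shows "clopen_invariant {M \<in> Sp.regular. P (- M)}"
proof -
  have *: "openin (top_of_set Sp) (uminus ` V)" if "openin (top_of_set Sp) V" for V ::
      "(real^(2+2)^(2+2)) set"
  proof -
    obtain T where T: "open T" "V = Sp \<inter> T"
      using \<open>openin (top_of_set Sp) V\<close> by (auto simp: openin_open)
    have "uminus ` V = Sp \<inter> uminus ` T"
      using Sp_uminus by (force simp: T(2))
    then show ?thesis
      using T(1) by (simp add: open_negations openin_open_Int)
  qed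
  have eq: "{M \<in> Sp.regular. P (- M)} = uminus ` {M \<in> Sp.regular. P M}"
    "Sp.regular - {M \<in> Sp.regular. P (- M)} = uminus ` (Sp.regular - {M \<in> Sp.regular. P M})"
    using regular_uminus by (force simp: image_iff)+
  have inv: "P (Sp_act S M)" if "S \<in> Sp" "M \<in> Sp.regular" "P M" for S M
    using assms that unfolding clopen_invariant_def by blast
  have "Sp_act S M \<in> {M \<in> Sp.regular. P (- M)}" if "S \<in> Sp" "M \<in> {M \<in> Sp.regular. P (- M)}" for S M
    using that inv [of S "- M"] by (simp add: inv_uminus regular_uminus Sp_regular_act)
  moreover have "openin (top_of_set Sp) {M \<in> Sp.regular. P (- M)}"
    unfolding eq(1) using assms * by (simp only: clopen_invariant_def)
  moreover have "openin (top_of_set Sp) (Sp.regular - {M \<in> Sp.regular. P (- M)})"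
    unfolding eq(2) using assms * by (simp only: clopen_invariant_def)
  ultimately show ?thesis
    unfolding clopen_invariant_def by blast
qed

lemma clopen_invariant_gap:
  "clopen_invariant {M \<in> Sp.regular. gap_minus M > 0}"
  "clopen_invariant {M \<in> Sp.regular. gap_minus M < 0}"
  "clopen_invariant {M \<in> Sp.regular. gap_plus M > 0}"
proof -
  have cont: "continuous_on UNIV gap_minus" "continuous_on UNIV gap_plus"
    unfolding gap_minus_def gap_plus_def by (intro continuous_intros)+
  then have op: "open {M. gap_minus M > 0}" "open {M. gap_minus M < 0}" "open {M. gap_plus M > 0}"
      "open {M. gap_plus M < 0}"
    by (intro open_Collect_less continuous_intros; simp)+
  show "clopen_invariant {M \<in> Sp.regular. gap_minus M > 0}"
    by (rule clopen_invariantI [OF op(1,2)]) (auto simp: Sp_regular_iff gap_Sp_act)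
  show "clopen_invariant {M \<in> Sp.regular. gap_minus M < 0}"
    by (rule clopen_invariantI [OF op(2,1)]) (auto simp: Sp_regular_iff gap_Sp_act)
  show "clopen_invariant {M \<in> Sp.regular. gap_plus M > 0}"
    by (rule clopen_invariantI [OF op(3,4)]) (auto simp: Sp_regular_iff gap_Sp_act)
qed

text \<open>A null vector of a semidefinite form lies in its radical. For the Krein form this is the
  kernel of \<open>Y\<close>, which \<open>kernel_Y\<close> shows to be trivial on the regular
  part.\<close>

lemma krein_definite:
  assumes M: "M \<in> Sp.regular" and psd: "\<And>v. krein M v \<ge> 0" and v: "krein M v = 0"
  shows "v = 0"
proof (rule ccontr)
  assume "v \<noteq> 0"
  have MSp: "M \<in> Sp" and gap: "gap_minus M \<noteq> 0" "gap_plus M \<noteq> 0"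
    using M by (simp_all add: Sp_regular_iff)
  interpret symplectic_pencil omega "\<lambda>v. (1/2) *\<^sub>R ((M + sinv M) *v v)" "\<lambda>v. (M - sinv M) *v v"
    "tr_inv M" "det_inv M"
    using MSp by (rule symplectic_pencil_Sp)
  let ?Y = "\<lambda>v. (M - sinv M) *v v"
  have "omega u (?Y v) = 0" for u
  proof (rule ccontr)
    assume nz: "omega u (?Y v) \<noteq> 0"
    define a b where "a = omega u (?Y v)" and "b = krein M u"
    have expand: "krein M (v + s *\<^sub>R u) = 2 * s * a + s\<^sup>2 * b" for s
      by (simp add: krein_def lin a_def b_def power2_eq_square Y_form_sym [of v u] v [unfolded
          krein_def]
          distrib_left)
    have "b \<ge> 0"
      using psd by (simp add: b_def)
    \<comment> \<open>The shift \<open>s = - a / (b + 1)\<close> makes the expansion negative; the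
      \<open>+ 1\<close> covers the case \<open>b = 0\<close>.\<close>
    have "2 * (- a / (b + 1)) * a + (- a / (b + 1))\<^sup>2 * b = - (a\<^sup>2 * (b + 2)) / (b + 1)\<^sup>2"
      using \<open>b \<ge> 0\<close> by (simp add: divide_simps power2_eq_square) (simp add: algebra_simps)
    also have "\<dots> < 0"
      using nz \<open>b \<ge> 0\<close> by (simp add: a_def divide_neg_pos)
    finally show False
      using psd [of "v + (- a / (b + 1)) *\<^sub>R u"] unfolding expand by simp
  qed
  then have "?Y v = 0"
    using nondeg [of "?Y v"] antisym [of "?Y v"] by simp
  then show False
    using kernel_Y [OF _ \<open>v \<noteq> 0\<close>] gap by (simp add: gap_minus_def gap_plus_def)
qed

lemma krein_scaleR: "krein M (k *\<^sub>R v) = k\<^sup>2 * krein M v"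
  by (simp add: krein_def matrix_vector_mult_scaleR omega_def power2_eq_square)

text \<open>A negative value persists under small changes of \<open>M\<close>. Conversely, a
  nonnegative Krein form is positive definite on the regular part, and positivity on the compact
  unit sphere is an open condition on \<open>M\<close>.\<close>

lemma clopen_invariant_krein: "clopen_invariant {M \<in> Sp.regular. \<exists>v. krein M v < 0}"
proof (rule clopen_invariantI)
  have "open {M. krein M v < 0}" for v
    unfolding krein_def by (intro open_Collect_less continuous_intros)
  then have "open (\<Union>v. {M. krein M v < 0})"
    by blast
  then show "open {M. \<exists>v. krein M v < 0}"
    by (simp add: Collect_ex_eq)
  have "closed {x :: (real^(2+2)) \<times> (real^(2+2)^(2+2)). krein (snd x) (fst x) \<le> 0}"
    unfolding krein_def by (intro closed_Collect_le continuous_intros)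
  then have "closed {M. \<exists>v. v \<in> sphere 0 1 \<and> (v, M) \<in> {x. krein (snd x) (fst x) \<le> 0}}"
    by (intro closed_compact_projection) simp_all
  then show "open (- {M. \<exists>v. v \<in> sphere 0 1 \<and> (v, M) \<in> {x. krein (snd x) (fst x) \<le> 0}})"
    by (rule open_Compl)
  show "\<not> (\<exists>v. krein M v < 0) \<longleftrightarrow> M \<in> - {M. \<exists>v. v \<in> sphere 0 1 \<and> (v, M) \<in> {x. krein (snd x) (fst x) \<le> 0}}"
    if M: "M \<in> Sp.regular" for M
  proof
    assume "\<not> (\<exists>v. krein M v < 0)"
    then have psd: "krein M v \<ge> 0" for v
      by (simp add: not_less)
    have "krein M v > 0" if "norm v = 1" for v
      using krein_definite [OF M psd, of v] psd [of v] that by fastforce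
    then show "M \<in> - {M. \<exists>v. v \<in> sphere 0 1 \<and> (v, M) \<in> {x. krein (snd x) (fst x) \<le> 0}}"
      by fastforce
  next
    assume R: "M \<in> - {M. \<exists>v. v \<in> sphere 0 1 \<and> (v, M) \<in> {x. krein (snd x) (fst x) \<le> 0}}"
    show "\<not> (\<exists>v. krein M v < 0)"
    proof
      assume "\<exists>v. krein M v < 0"
      then obtain v where v: "krein M v < 0"
        by blast
      then have "v \<noteq> 0"
        by (auto simp: krein_def omega_def)
      define u where "u = (1 / norm v) *\<^sub>R v"
      have "norm u = 1" "krein M u < 0"
        using v \<open>v \<noteq> 0\<close> by (simp_all add: u_def krein_scaleR mult_pos_neg)
      then show False
        using R by (auto simp: less_imp_le)
    qed
  qed
  show "\<exists>v. krein (Sp_act S M) v < 0" if "S \<in> Sp" "\<exists>v. krein M v < 0" for S M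
    using that krein_Sp_act by metis
qed simp

section \<open>Block vectors and the sign of the elliptic block beside a hyperbolic one\<close>

definition bvec :: "real^'n::finite \<Rightarrow> real^'n \<Rightarrow> real^('n + 'n)" where
  "bvec x y = (\<chi> i. case i of Inl k \<Rightarrow> x $ k | Inr k \<Rightarrow> y $ k)"

lemma bvec_nth [simp]: "bvec x y $ Inl k = x $ k" "bvec x y $ Inr k = y $ k"
  by (simp_all add: bvec_def)

lemma bvec_eqI:
  assumes "\<And>k. u $ Inl k = v $ Inl k" "\<And>k. u $ Inr k = v $ Inr k"
  shows "u = v"
proof -
  have "u $ i = v $ i" for i
    by (cases i) (simp_all add: assms)
  then show ?thesis
    by (simp add: vec_eq_iff)
qed

lemma bvec_cases: obtains x y where "v = bvec x y"
proof
  show "v = bvec (\<chi> k. v $ Inl k) (\<chi> k. v $ Inr k)"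
    by (rule bvec_eqI) simp_all
qed

lemma bvec_diff: "bvec x y - bvec x' y' = bvec (x - x') (y - y')"
  by (rule bvec_eqI) simp_all

lemma bvec_scaleR: "k *\<^sub>R bvec x y = bvec (k *\<^sub>R x) (k *\<^sub>R y)"
  by (rule bvec_eqI) simp_all

lemma sum_Plus_UNIV:
  "(\<Sum>k\<in>(UNIV :: ('n::finite + 'n) set). f k) = (\<Sum>k\<in>UNIV. f (Inl k)) + (\<Sum>k\<in>UNIV. f (Inr k) :: real)"
  using sum.Plus [of "UNIV :: 'n set" "UNIV :: 'n set" f] by (simp add: comp_def)

lemma block_mat_bvec:
  "block_mat A B C D *v bvec x y = bvec (A *v x + B *v y) (C *v x + D *v y)"
  by (rule bvec_eqI) (simp_all add: matrix_vector_mult_def sum_Plus_UNIV)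

lemma omega_bvec: "omega (bvec x y) (bvec u w) = x \<bullet> w - y \<bullet> u"
proof -
  have "J_mat *v bvec u w = bvec w (- u)"
    by (simp add: J_mat_def block_mat_bvec matrix_vector_minus)
  then show ?thesis
    by (simp add: omega_def inner_vec_def sum_Plus_UNIV sum_negf)
qed

lemma M_ABC_sinv:
  assumes "M_ABC A B C \<in> Sp_I"
  shows "M_ABC A B C - sinv (M_ABC A B C) = block_mat 0 (2 *\<^sub>R B) (2 *\<^sub>R C) 0"
    "M_ABC A B C + sinv (M_ABC A B C) = block_mat (2 *\<^sub>R A) 0 0 (2 *\<^sub>R transpose A)"
proof -
  have "transpose B = B" "transpose C = C"
    using assms unfolding Sp_I_iff_M_ABC by (auto simp: M_ABC_def block_mat_eq_iff)
  then show "M_ABC A B C - sinv (M_ABC A B C) = block_mat 0 (2 *\<^sub>R B) (2 *\<^sub>R C) 0"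
    "M_ABC A B C + sinv (M_ABC A B C) = block_mat (2 *\<^sub>R A) 0 0 (2 *\<^sub>R transpose A)"
    by (simp_all add: M_ABC_def sinv_block_mat block_mat_diff block_mat_add block_mat_eq_iff scaleR_2)
qed

lemma krein_M_ABC:
  assumes "M_ABC A B C \<in> Sp_I"
  shows "krein (M_ABC A B C) (bvec x y) = 2 * (x \<bullet> (C *v x) - y \<bullet> (B *v y))"
  unfolding krein_def M_ABC_sinv [OF assms] block_mat_bvec omega_bvec
  by (simp add: scaleR_matrix_vector_assoc [symmetric] algebra_simps)

lemma side_form_M_ABC:
  assumes "M_ABC A B C \<in> Sp_I" and m: "2 * m = tr_inv (M_ABC A B C) + sqrt ((tr_inv (M_ABC A B C))\<^sup>2
      - 4 * det_inv (M_ABC A B C))"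
  shows "side_form (M_ABC A B C) (bvec x y) =
    4 * (x \<bullet> (C *v (A *v x - m *\<^sub>R x)) - y \<bullet> (B *v (transpose A *v y - m *\<^sub>R y)))"
  unfolding side_form_def M_ABC_sinv [OF assms(1)] m [symmetric] block_mat_bvec bvec_scaleR
      bvec_diff omega_bvec
  by (simp add: scaleR_matrix_vector_assoc [symmetric] matrix_vector_mult_diff_distrib
      matrix_vector_mult_scaleR
      inner_diff_right algebra_simps)

definition qform :: "sym2 \<Rightarrow> real^2 \<Rightarrow> real" where
  "qform z y = y \<bullet> (symm z *v y)"

lemma qform_eq: "qform (a, b, c) y = a * (y $ 1)\<^sup>2 + 2 * b * (y $ 1) * (y $ 2) + c * (y $ 2)\<^sup>2"
  by (simp add: qform_def symm_def inner_vec_def sum_2 matrix_vector_mult_def power2_eq_square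
      algebra_simps)

text \<open>Up to a factor the form is a square: \<open>a * qform z y\<close> is the square of
  \<open>a * y1 + b * y2\<close>, and for \<open>a = 0\<close> only \<open>c * y2^2\<close>
  remains.\<close>

lemma qform_degenerate:
  assumes "det2 z = 0" "z \<noteq> 0"
  shows "((\<forall>y. qform z y \<ge> 0) \<and> (\<exists>y. qform z y > 0)) \<or> ((\<forall>y. qform z y \<le> 0) \<and> (\<exists>y. qform z y < 0))"
proof -
  obtain a b c where z: "z = (a, b, c)"
    by (cases z)
  have D: "a * c = b\<^sup>2"
    using assms by (simp add: z det2_def)
  let ?e1 = "vector [1, 0] :: real^2" and ?e2 = "vector [0, 1] :: real^2"
  have a: "a * qform z y = (a * y $ 1 + b * y $ 2)\<^sup>2" for y
    using D by (simp add: z qform_eq power2_eq_square algebra_simps)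
  show ?thesis
  proof (cases "a = 0")
    case True
    then have "b = 0" "c \<noteq> 0"
      using D assms(2) by (auto simp: z zero_prod_def)
    then have "qform z y = c * (y $ 2)\<^sup>2" for y
      using True by (simp add: z qform_eq)
    then show ?thesis
      using \<open>c \<noteq> 0\<close> by (cases "c > 0") (auto simp: mult_nonpos_nonneg intro!: exI [of _ ?e2])
  next
    case False
    have e1: "qform z ?e1 = a"
      by (simp add: z qform_eq)
    have "0 \<le> a * qform z y" for y
      unfolding a by simp
    then show ?thesis
      using False e1 by (cases "a > 0") (auto simp: zero_le_mult_iff intro!: exI [of _ ?e1])
  qed
qed

text \<open>The gaps place the roots at \<open>-1 < m' < 1 < m\<close>, and \<open>z\<close> is the
  form of \<open>(A - m) B\<close>. By Cayley-Hamilton \<open>A (A - m) = m' (A - m)\<close>, so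
  \<open>C (A - m)\<close> is \<open>- (1 - m'^2)\<close> times the transform of \<open>z\<close> by
  the inverse of \<open>B\<close>. Both halves of the side form thus carry the same degenerate form,
  with the positive weight \<open>k = 1 - m'^2\<close>.\<close>

lemma side_form_pencil_mat:
  fixes P Q
  defines "t \<equiv> tr_inv (pencil_mat (P, Q))" and "d \<equiv> det_inv (pencil_mat (P, Q))"
  assumes PQ: "(P, Q) \<in> Pencils" and gap: "1 - t + d < 0" "1 + t + d > 0"
  defines "m \<equiv> (t + sqrt (t\<^sup>2 - 4 * d)) / 2"
  defines "z \<equiv> P + 2 *\<^sub>R Q - m *\<^sub>R P"
  obtains k where "k > 0" "det2 z = 0" "z \<noteq> 0"
    "\<And>x y. side_form (pencil_mat (P, Q)) (bvec x y) = - 4 * (k * qform z (symm_inv P *v x) + qform z y)"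
proof -
  define r where "r = sqrt (t\<^sup>2 - 4 * d)"
  \<comment> \<open>The assumption \<open>d < t - 1\<close> makes the discriminant larger than
    \<open>(t - 2)^2\<close>.\<close>
  have "(t - 2)\<^sup>2 \<ge> 0"
    by simp
  then have disc: "t\<^sup>2 - 4 * d > 0"
    using gap(1) by (simp add: power2_eq_square algebra_simps)
  then have r: "r > 0" "r\<^sup>2 = t\<^sup>2 - 4 * d"
    by (simp_all add: r_def)
  define m' where "m' = (t - r) / 2"
  have m: "m = (t + r) / 2"
    by (simp add: m_def r_def)
  have mm: "m + m' = t" "m * m' = d" "m' < m"
    using r by (simp_all add: m m'_def field_simps power2_eq_square)
  have "(1 - m) * (1 - m') < 0" "(1 + m) * (1 + m') > 0"
    using gap mm(1,2) by (simp_all add: algebra_simps)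
  then have "m' < 1" "m' > - 1"
    using mm(3) by (auto simp: mult_less_0_iff zero_less_mult_iff)
  then have k: "1 - m'\<^sup>2 > 0"
    using abs_square_less_1 [of m'] by linarith
  have P0: "det2 P \<noteq> 0"
    using PQ by (auto simp: Pencils_def)
  define B N K where "B = symm P" and "N = symm_inv P" and "K = symm (P + 2 *\<^sub>R Q)"
  define A C where "A = K ** N" and "C = N ** K ** N ** K ** N - N"
  have M: "pencil_mat (P, Q) = M_ABC A B C"
    by (simp add: pencil_mat_def B_def N_def K_def A_def C_def Let_def)
  have MI: "M_ABC A B C \<in> Sp_I"
    using pencil_mat_in [OF P0, of Q] by (simp add: M)
  have BN: "B ** N = mat 1" "N ** B = mat 1"
    using symm_inv [OF P0] by (simp_all add: B_def N_def)
  have trans: "transpose N = N" "transpose K = K"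
    by (simp_all add: N_def K_def transpose_symm)
  have td: "t = trace A" "d = det A"
    using inv_M_ABC [OF MI] by (simp_all add: t_def d_def M)
  have Z: "symm z = K - m *\<^sub>R B"
    unfolding z_def K_def B_def
    by (cases P; cases Q) (simp add: symm_def m2_simps)
  have AB: "A ** B = K"
    by (simp add: A_def matrix_mul_assoc [symmetric] BN)
  have BA: "B ** transpose A = K"
    by (simp add: A_def matrix_transpose_mul trans matrix_mul_assoc BN)
  have ZN: "symm z ** N = A - m *\<^sub>R mat 1"
    by (simp add: Z matrix_diff_mult A_def matrix_scaleR_mult BN)
  have CH: "A ** A = t *\<^sub>R A - d *\<^sub>R mat 1"
    unfolding td by (cases A rule: m2_cases) (simp add: m2_simps m2_one m2_eq_iff algebra_simps)
  have "A ** (A - m *\<^sub>R mat 1) = m' *\<^sub>R (A - m *\<^sub>R mat 1)"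
    by (simp add: matrix_diff_mult CH mm(1,2) [symmetric] matrix_scaleR_mult algebra_simps)
  then have AZ: "A ** (symm z ** N) = m' *\<^sub>R (symm z ** N)"
    by (simp add: ZN)
  have C: "C = N ** A ** A - N"
    by (simp add: C_def A_def matrix_mul_assoc)
  have CZ: "C ** (symm z ** N) = - (1 - m'\<^sup>2) *\<^sub>R (N ** symm z ** N)"
  proof -
    have "C ** (symm z ** N) = N ** (A ** (A ** (symm z ** N))) - N ** (symm z ** N)"
      by (simp add: C matrix_diff_mult matrix_mul_assoc)
    also have "\<dots> = (m'\<^sup>2) *\<^sub>R (N ** (symm z ** N)) - N ** (symm z ** N)"
      by (simp add: AZ matrix_scaleR_mult power2_eq_square)
    also have "\<dots> = - (1 - m'\<^sup>2) *\<^sub>R (N ** symm z ** N)"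
      by (simp add: matrix_mul_assoc algebra_simps)
    finally show ?thesis .
  qed
  have "det (A - m *\<^sub>R mat 1) = m\<^sup>2 - t * m + d"
    unfolding td by (cases A rule: m2_cases) (simp add: m2_simps m2_one power2_eq_square algebra_simps)
  also have "\<dots> = 0"
    using mm by (simp add: power2_eq_square algebra_simps mm(1,2) [symmetric])
  finally have "det (symm z ** N) = 0"
    by (simp add: ZN)
  moreover have "det N \<noteq> 0"
    using BN(1) by (metis det_I det_mul mult_zero_right zero_neq_one)
  ultimately have z0: "det2 z = 0"
    by (simp add: det_mul det_symm)
  have "z \<noteq> 0"
  proof
    assume "z = 0"
    then have "symm z = 0"
      by (simp add: symm_def zero_prod_def m2_zero)
    then have "A = m *\<^sub>R mat 1"
      using ZN by (simp add: matrix_zero_mult)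
    then have "t = 2 * m"
      by (simp add: td m2_one m2_simps)
    then show False
      using mm by simp
  qed
  have tv: "A *v x - m *\<^sub>R x = symm z ** N *v x" for x
    by (simp add: ZN matrix_vector_mult_diff_rdistrib scaleR_matrix_vector_assoc [symmetric])
  have tv': "B *v (transpose A *v y - m *\<^sub>R y) = symm z *v y" for y
    by (simp add: Z matrix_vector_mult_diff_distrib matrix_vector_mul_assoc BA matrix_vector_mult_scaleR
        matrix_vector_mult_diff_rdistrib scaleR_matrix_vector_assoc [symmetric] del:
            transpose_matrix_vector)
  have tm: "2 * m = tr_inv (M_ABC A B C) + sqrt ((tr_inv (M_ABC A B C))\<^sup>2 - 4 * det_inv (M_ABC A B C))"
    by (simp add: m_def t_def d_def M)
  have "side_form (pencil_mat (P, Q)) (bvec x y) = - 4 * ((1 - m'\<^sup>2) * qform z (symm_inv P *v x) +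
      qform z y)" for x y
  proof -
    have "x \<bullet> (N ** symm z ** N *v x) = qform z (N *v x)"
      by (simp add: qform_def inner_matrix_transpose trans matrix_vector_mul_assoc matrix_mul_assoc)
    then have "x \<bullet> (C *v (A *v x - m *\<^sub>R x)) = - (1 - m'\<^sup>2) * qform z (N *v x)"
      unfolding tv matrix_vector_mul_assoc CZ scaleR_matrix_vector_assoc [symmetric]
          inner_scaleR_right by simp
    then show ?thesis
      unfolding M side_form_M_ABC [OF MI tm] tv'
      by (simp add: qform_def N_def algebra_simps)
  qed
  then show ?thesis
    using that k z0 \<open>z \<noteq> 0\<close> by blast
qed

lemma Sp_regular_conjugate:
  assumes "M \<in> Sp.regular"
  obtains S x where "S \<in> Sp" "x \<in> Pencils" "Sp_act S M = pencil_mat x"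
proof -
  obtain S where S: "S \<in> Sp" "Sp_act S M \<in> Sp_I"
    using Sp_conjugate_Sp_I [of M] assms by (auto simp: Sp_regular_iff)
  have "Sp_act S M \<in> GL.regular"
    using Sp_regular_act [OF S(1) assms] S(2) by (simp add: GL.regular_def Sp.regular_def)
  then obtain x where "x \<in> Pencils" "Sp_act S M = pencil_mat x"
    by (rule regular_pencil_mat)
  then show ?thesis
    using that S(1) by blast
qed

text \<open>On this region the side form is semidefinite and not zero, so exactly one sign occurs.
  Hence the failure of \<open>right_positive\<close> is an open condition as well.\<close>

lemma side_form_sign:
  assumes M: "M \<in> Sp.regular" and gap: "gap_minus M < 0" "gap_plus M > 0"
  shows "\<not> (\<exists>v. side_form M v > 0) \<longleftrightarrow> (\<exists>v. side_form M v < 0)"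
proof -
  obtain S x where S: "S \<in> Sp" "x \<in> Pencils" "Sp_act S M = pencil_mat x"
    using Sp_regular_conjugate [OF M] .
  obtain P Q where x: "x = (P, Q)"
    by (cases x)
  have g: "1 - tr_inv (pencil_mat (P, Q)) + det_inv (pencil_mat (P, Q)) < 0"
    "1 + tr_inv (pencil_mat (P, Q)) + det_inv (pencil_mat (P, Q)) > 0"
    using gap gap_Sp_act [OF S(1), of M] by (simp_all add: S(3) x gap_minus_def gap_plus_def)
  obtain k z where k: "k > 0" and z: "det2 z = 0" "z \<noteq> 0"
    and eq: "\<And>x y. side_form (pencil_mat (P, Q)) (bvec x y) = - 4 * (k * qform z (symm_inv P *v x) +
        qform z y)"
    using side_form_pencil_mat [OF _ g] S(2) unfolding x by metis
  have side: "side_form (pencil_mat (P, Q)) (bvec x y) = - 4 * (k * qform z (symm_inv P *v x) +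
      qform z y)" for x y
    by (rule eq)
  have q0: "qform z 0 = 0"
    by (simp add: qform_def)
  have "\<not> (\<exists>v. side_form (pencil_mat x) v > 0) \<longleftrightarrow> (\<exists>v. side_form (pencil_mat x) v < 0)"
    using qform_degenerate [OF z]
  proof
    assume h: "(\<forall>y. qform z y \<ge> 0) \<and> (\<exists>y. qform z y > 0)"
    then obtain y where y: "qform z y > 0"
      by blast
    have "side_form (pencil_mat x) v \<le> 0" for v
    proof -
      obtain a b where v: "v = bvec a b"
        by (rule bvec_cases)
      have "k * qform z (symm_inv P *v a) \<ge> 0"
        using h k by simp
      moreover have "qform z b \<ge> 0"
        using h by blast
      ultimately show ?thesis
        by (simp add: x side v)
    qed
    moreover have "side_form (pencil_mat x) (bvec 0 y) < 0"
      using y by (simp add: x side q0)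
    ultimately show ?thesis
      by (meson not_less)
  next
    assume h: "(\<forall>y. qform z y \<le> 0) \<and> (\<exists>y. qform z y < 0)"
    then obtain y where y: "qform z y < 0"
      by blast
    have "side_form (pencil_mat x) v \<ge> 0" for v
    proof -
      obtain a b where v: "v = bvec a b"
        by (rule bvec_cases)
      have "k * qform z (symm_inv P *v a) \<le> 0"
        using h k by (simp add: mult_nonneg_nonpos)
      moreover have "qform z b \<le> 0"
        using h by blast
      ultimately show ?thesis
        by (simp add: x side v)
    qed
    moreover have "side_form (pencil_mat x) (bvec 0 y) > 0"
      using y by (simp add: x side q0)
    ultimately show ?thesis
      by (meson not_less)
  qed
  moreover have iff: "(\<exists>v. R (side_form M v)) \<longleftrightarrow> (\<exists>v. R (side_form (pencil_mat x) v))" for R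
  proof
    assume "\<exists>v. R (side_form M v)"
    then show "\<exists>v. R (side_form (pencil_mat x) v)"
      using side_form_Sp_act [OF S(1), of M] S(3) by metis
  next
    assume "\<exists>v. R (side_form (pencil_mat x) v)"
    then obtain v where v: "R (side_form (pencil_mat x) v)"
      by blast
    have "Sp_act (sinv S) (pencil_mat x) = M"
      using Sp_act_inverse [OF S(1)] S(3) by metis
    then show "\<exists>v. R (side_form M v)"
      using side_form_Sp_act [OF Sp_sinv_in [OF S(1)], of "pencil_mat x" v] v by metis
  qed
  ultimately show ?thesis
    using iff [of "\<lambda>a. a > 0"] iff [of "\<lambda>a. a < 0"] by simp
qed

text \<open>For a diagonal representative with these gaps this means that the elliptic entry of
  \<open>B\<close> is positive: the factor \<open>m' - m\<close> in \<open>z\<close> and the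
  constant \<open>- 4\<close> of the side form are both negative.\<close>

definition right_positive :: "real^(2+2)^(2+2) \<Rightarrow> bool" where
  "right_positive M \<longleftrightarrow> gap_minus M < 0 \<and> gap_plus M > 0 \<and> (\<exists>v. side_form M v > 0)"

lemma clopen_invariant_right: "clopen_invariant {M \<in> Sp.regular. right_positive M}"
proof (rule clopen_invariantI)
  let ?r = "{M. gap_minus M < 0} \<inter> {M. gap_plus M > 0}"
  have cont: "continuous_on UNIV gap_minus" "continuous_on UNIV gap_plus" "continuous_on UNIV (\<lambda>M.
      side_form M v)" for v
    unfolding gap_minus_def gap_plus_def side_form_def by (intro continuous_intros)+
  then have op: "open ?r" "open {M. gap_minus M > 0}" "open {M. gap_plus M < 0}"
    "open {M. side_form M v > 0}" "open {M. side_form M v < 0}" for v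
    by (intro open_Int open_Collect_less continuous_intros; simp)+
  then show "open (?r \<inter> (\<Union>v. {M. side_form M v > 0}))"
    by (intro open_Int [of ?r] open_UN) auto
  show "open ({M. gap_minus M > 0} \<union> {M. gap_plus M < 0} \<union> (?r \<inter> (\<Union>v. {M. side_form M v < 0})))"
    using op by (intro open_Int [of ?r] open_Un open_UN) auto
  show "right_positive M \<longleftrightarrow> M \<in> ?r \<inter> (\<Union>v. {M. side_form M v > 0})" for M
    by (auto simp: right_positive_def)
  show "\<not> right_positive M \<longleftrightarrow>
      M \<in> {M. gap_minus M > 0} \<union> {M. gap_plus M < 0} \<union> (?r \<inter> (\<Union>v. {M. side_form M v < 0}))"
    if "M \<in> Sp.regular" for M
    using side_form_sign [OF that] that by (auto simp: right_positive_def Sp_regular_iff)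
  show "right_positive (Sp_act S M)" if "S \<in> Sp" "right_positive M" for S M
  proof -
    have "\<exists>v. side_form (Sp_act S M) v > 0"
      using that side_form_Sp_act [OF that(1), of M] unfolding right_positive_def by metis
    then show ?thesis
      using that by (simp add: right_positive_def gap_Sp_act)
  qed
qed

section \<open>Components of the quotient by the symplectic group\<close>

lemma pencil_mat_diag:
  assumes "s1 \<noteq> 0" "s2 \<noteq> 0"
  shows "pencil_mat (diag_pencil s1 k1 s2 k2) = M_ABC (m2 (1 + k1) 0 0 (1 + k2)) (m2 (2 * s1) 0 0 (2
      * s2))
    (m2 (k1 * (k1 + 2) / (2 * s1)) 0 0 (k2 * (k2 + 2) / (2 * s2)))"
proof -
  have inv: "symm_inv (2 * s1, 0, 2 * s2) = m2 (1 / (2 * s1)) 0 0 (1 / (2 * s2))"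
    using assms by (simp add: symm_inv_def det2_def m2_eq_iff)
  have "(2 * s1 + 2 * (s1 * k1)) * (1 / (2 * s1)) = 1 + k1" "(2 * s2 + 2 * (s2 * k2)) * (1 / (2 *
      s2)) = 1 + k2"
    using assms by (simp_all add: field_simps)
  moreover have "(1 + k) * (2 * s + 2 * (s * k)) / (4 * (s * s)) - 1 / (2 * s) = k * (k + 2) / (2 * s)"
    if "s \<noteq> 0" for s k :: real
    using that by (simp add: divide_simps) (simp add: algebra_simps)
  ultimately show ?thesis
    using assms by (simp only: pencil_mat_def diag_pencil_def prod.case Let_def inv symm_def
        scaleR_prod_def
        fst_conv snd_conv plus_prod_def m2_simps)
      (simp add: m2_eq_iff M_ABC_def block_mat_eq_iff)
qed

definition Sp_linked :: "sym2 \<times> sym2 \<Rightarrow> sym2 \<times> sym2 \<Rightarrow> bool" where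
  "Sp_linked x y \<longleftrightarrow> connected_component_of Sp.regular_quotient (Sp.cls (pencil_mat x)) (Sp.cls
      (pencil_mat y))"

lemma Sp_linked_trans: "Sp_linked x y \<Longrightarrow> Sp_linked y z \<Longrightarrow> Sp_linked x z"
  unfolding Sp_linked_def by (rule connected_component_of_trans)

lemma Sp_linked_type: "x \<in> Pencils \<Longrightarrow> y \<in> Pencils \<Longrightarrow> pencil_type x = pencil_type y \<Longrightarrow> Sp_linked x y"
  unfolding Sp_linked_def by (intro Sp_pencil_component pencil_equiv)

text \<open>
  Conjugation by the symplectic quarter turn in one coordinate plane replaces \<open>b\<close> by \<open>-c\<close> there,
  which reverses the sign of a hyperbolic block (where \<open>b c > 0\<close>) but not that of an elliptic one.
\<close>

lemma Sp_linked_flip2: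
  assumes "s1 \<noteq> 0" "k1 \<noteq> 0" "k1 \<noteq> -2" and s: "s = 1 \<or> s = -1" and k: "k = 2 \<or> k = -4"
  shows "Sp_linked (diag_pencil s1 k1 s k) (diag_pencil s1 k1 (- s) k)"
proof -
  define F where "F = block_mat (m2 1 0 0 0) (m2 0 0 0 1) (m2 0 0 0 (-1)) (m2 1 0 0 0)"
  have F: "F \<in> Sp"
    by (simp add: F_def Sp_iff_sinv sinv_block_mat block_mat_mult m2_simps mat_one_block m2_one m2_zero)
  have nz: "s \<noteq> 0" "- 2 * s \<noteq> 0" "- s \<noteq> 0"
    using s by auto
  have in_P: "diag_pencil s1 k1 s k \<in> Pencils" "diag_pencil s1 k1 (- 2 * s) k \<in> Pencils"
      "diag_pencil s1 k1 (- s) k \<in> Pencils"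
    using assms nz by (auto intro!: diag_pencil_in)
  \<comment> \<open>In the second plane \<open>b = 2 s\<close>, and \<open>k * (k + 2) = 8\<close>
    for both values of \<open>k\<close>, so \<open>c = 4 / s = 4 s\<close>. The turn puts
    \<open>- c = 2 * (- 2 s)\<close> in the place of \<open>b\<close>, whence the parameter
    \<open>- 2 * s\<close>; equality of types then replaces it by \<open>- s\<close>.\<close>
  have "F ** pencil_mat (diag_pencil s1 k1 s k) = pencil_mat (diag_pencil s1 k1 (- 2 * s) k) ** F"
    unfolding pencil_mat_diag [OF assms(1) nz(1)] pencil_mat_diag [OF assms(1) nz(2)] F_def M_ABC_def
    using s k by (auto simp: block_mat_mult m2_simps block_mat_eq_iff m2_eq_iff)
  then have "Sp_act F (pencil_mat (diag_pencil s1 k1 s k)) = pencil_mat (diag_pencil s1 k1 (- 2 * s) k)"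
    by (rule Sp_act_eqI [OF F])
  moreover have "pencil_mat (diag_pencil s1 k1 s k) \<in> Sp"
    using pencil_mat_regular [OF in_P(1)] GL_regular_subset_Sp_regular by (auto simp: Sp_regular_iff)
  ultimately have "Sp.cls (pencil_mat (diag_pencil s1 k1 s k)) = Sp.cls (pencil_mat (diag_pencil s1
      k1 (- 2 * s) k))"
    using Sp.cls_act [OF F, of "pencil_mat (diag_pencil s1 k1 s k)"] by simp
  moreover have "pencil_type (diag_pencil s1 k1 (- 2 * s) k) = pencil_type (diag_pencil s1 k1 (- s) k)"
    using s k by (auto simp: pencil_type_def diag_pencil_def posdef_def negdef_def det2_def
        zero_less_mult_iff)
  then have "Sp_linked (diag_pencil s1 k1 (- 2 * s) k) (diag_pencil s1 k1 (- s) k)"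
    by (intro Sp_linked_type in_P)
  ultimately show ?thesis
    by (simp add: Sp_linked_def)
qed

lemma Sp_linked_swap:
  assumes "diag_pencil s1 k1 s2 k2 \<in> Pencils"
  shows "Sp_linked (diag_pencil s1 k1 s2 k2) (diag_pencil s2 k2 s1 k1)"
proof -
  have "pencil_rel (diag_pencil s1 k1 s2 k2) (pencil_congr 0 1 1 0 (diag_pencil s1 k1 s2 k2))"
    using assms by (intro pencil_rel_congr) simp_all
  moreover have "pencil_congr 0 1 1 0 (diag_pencil s1 k1 s2 k2) = diag_pencil s2 k2 s1 k1"
    by (simp add: pencil_congr_def diag_pencil_def congr_def)
  ultimately show ?thesis
    unfolding Sp_linked_def using assms by (intro Sp_pencil_component) (simp_all add: pencil_rel_def)
qed

lemma Sp_linked_flip1: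
  assumes "s2 \<noteq> 0" "k2 \<noteq> 0" "k2 \<noteq> -2" and s: "s = 1 \<or> s = -1" and k: "k = 2 \<or> k = -4"
  shows "Sp_linked (diag_pencil s k s2 k2) (diag_pencil (- s) k s2 k2)"
proof -
  have "diag_pencil s k s2 k2 \<in> Pencils" "diag_pencil s2 k2 (- s) k \<in> Pencils"
    using assms by (auto intro!: diag_pencil_in)
  then show ?thesis
    using Sp_linked_swap Sp_linked_flip2 [OF assms] Sp_linked_trans by metis
qed

text \<open>The signs of the two gaps group the list: three with both positive, two with only
  \<open>gap_plus\<close> positive, two with only \<open>gap_minus\<close> positive, one with both
  negative.\<close>

definition Sp_reps :: "(sym2 \<times> sym2) list" where
  "Sp_reps =
    [diag_pencil 1 (-1) 1 (-1), diag_pencil (-1) (-1) (-1) (-1), diag_pencil 1 (-1) (-1) (-1),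
     diag_pencil 1 2 1 (-1), diag_pencil 1 2 (-1) (-1),
     diag_pencil 1 (-1) 1 (-4), diag_pencil (-1) (-1) 1 (-4), diag_pencil 1 2 1 (-4)]"

lemma Sp_reps_subset: "set Sp_reps \<subseteq> Pencils"
  by (simp add: Sp_reps_def diag_pencil_in)

text \<open>Both pencils have three indefinite forms. The connection runs through a pencil whose
  \<open>A\<close> has nonreal eigenvalues, so two hyperbolic blocks of opposite sign can turn into
  two elliptic ones.\<close>

lemma Sp_linked_indefinite:
  assumes "k = 2 \<or> k = -4"
  shows "Sp_linked (diag_pencil 1 k (-1) k) (diag_pencil 1 (-1) (-1) (-1))"
  using assms
  by (intro Sp_linked_type)
    (auto simp: Pencils_def pencil_type_def diag_pencil_def posdef_def negdef_def det2_def)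

lemma GL_reps_linked:
  assumes "x \<in> set GL_reps"
  shows "\<exists>y\<in>set Sp_reps. Sp_linked x y"
proof -
  have "\<forall>y\<in>set Sp_reps. Sp_linked y y"
    using Sp_linked_type Sp_reps_subset by blast
  then have refl: "list_all (\<lambda>y. Sp_linked y y) Sp_reps"
    by (simp only: list_all_iff)
  have "Sp_linked (diag_pencil 1 2 1 2) (diag_pencil 1 2 (-1) 2)"
    "Sp_linked (diag_pencil (-1) 2 (-1) 2) (diag_pencil 1 2 (-1) 2)"
    "Sp_linked (diag_pencil 1 (-4) 1 (-4)) (diag_pencil 1 (-4) (-1) (-4))"
    "Sp_linked (diag_pencil (-1) (-4) (-1) (-4)) (diag_pencil 1 (-4) (-1) (-4))"
    using Sp_linked_flip2 [of 1 2 1 2] Sp_linked_flip1 [of "-1" 2 "-1" 2]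
      Sp_linked_flip2 [of 1 "-4" 1 "-4"] Sp_linked_flip1 [of "-1" "-4" "-1" "-4"] by simp_all
  then have "Sp_linked (diag_pencil 1 2 1 2) (diag_pencil 1 (-1) (-1) (-1))"
    "Sp_linked (diag_pencil (-1) 2 (-1) 2) (diag_pencil 1 (-1) (-1) (-1))"
    "Sp_linked (diag_pencil 1 (-4) 1 (-4)) (diag_pencil 1 (-1) (-1) (-1))"
    "Sp_linked (diag_pencil (-1) (-4) (-1) (-4)) (diag_pencil 1 (-1) (-1) (-1))"
    using Sp_linked_indefinite [of 2] Sp_linked_indefinite [of "-4"] by (meson Sp_linked_trans)+
  moreover have "Sp_linked (diag_pencil (-1) 2 1 (-1)) (diag_pencil 1 2 1 (-1))"
    "Sp_linked (diag_pencil (-1) 2 (-1) (-1)) (diag_pencil 1 2 (-1) (-1))"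
    using Sp_linked_flip1 [of 1 "-1" "-1" 2] Sp_linked_flip1 [of "-1" "-1" "-1" 2] by simp_all
  moreover have h: "Sp_linked (diag_pencil 1 2 (-1) (-4)) (diag_pencil 1 2 1 (-4))"
    "Sp_linked (diag_pencil (-1) 2 1 (-4)) (diag_pencil 1 2 1 (-4))"
    "Sp_linked (diag_pencil (-1) 2 (-1) (-4)) (diag_pencil 1 2 (-1) (-4))"
    using Sp_linked_flip2 [of 1 2 "-1" "-4"] Sp_linked_flip1 [of 1 "-4" "-1" 2] Sp_linked_flip1 [of
        "-1" "-4" "-1" 2]
    by simp_all
  moreover have "Sp_linked (diag_pencil (-1) 2 (-1) (-4)) (diag_pencil 1 2 1 (-4))"
    using Sp_linked_trans [OF h(3) h(1)] .
  moreover have "Sp_linked (diag_pencil 1 (-1) (-1) (-4)) (diag_pencil 1 (-1) 1 (-4))"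
    "Sp_linked (diag_pencil (-1) (-1) (-1) (-4)) (diag_pencil (-1) (-1) 1 (-4))"
    using Sp_linked_flip2 [of 1 "-1" "-1" "-4"] Sp_linked_flip2 [of "-1" "-1" "-1" "-4"] by simp_all
  ultimately show ?thesis
    using assms refl
    unfolding GL_reps_def Sp_reps_def list.set insert_iff empty_iff bex_simps list.pred_inject
    by (elim disjE) simp_all
qed

text \<open>For \<open>- M\<close> the condition asks for a positive value of the Krein form of
  \<open>M\<close>, as negation reverses that form and exchanges the gaps. Using both tests
  separates definite from indefinite Krein forms.\<close>

definition top_negative :: "real^(2+2)^(2+2) \<Rightarrow> bool" where
  "top_negative M \<longleftrightarrow> (gap_minus M > 0 \<and> gap_plus M > 0) \<and> (\<exists>v. krein M v < 0)"

definition Sp_preds :: "(real^(2+2)^(2+2) \<Rightarrow> bool) list" where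
  "Sp_preds = [\<lambda>M. gap_minus M > 0, \<lambda>M. gap_plus M > 0, top_negative, \<lambda>M. top_negative (- M),
     right_positive, \<lambda>M. right_positive (- M)]"

lemma clopen_invariant_Sp_preds:
  assumes "p \<in> set Sp_preds"
  shows "clopen_invariant {M \<in> Sp.regular. p M}"
proof -
  have "clopen_invariant {M \<in> Sp.regular. top_negative M}"
    unfolding top_negative_def
    by (intro clopen_invariant_Int clopen_invariant_gap clopen_invariant_krein)
  then show ?thesis
    using assms clopen_invariant_gap(1,3) clopen_invariant_right
    by (auto simp: Sp_preds_def intro: clopen_invariant_uminus)
qed

lemma gap_pencil_mat:
  assumes "(P, Q) \<in> Pencils"
  shows "gap_minus (pencil_mat (P, Q)) = 4 * det2 Q / det2 P"
    "gap_plus (pencil_mat (P, Q)) = 4 * det2 (P + Q) / det2 P"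
  using assms invariants_pencil_mat [of P Q] by (auto simp: Pencils_def gap_minus_def gap_plus_def)

lemma krein_diag:
  assumes "s1 \<noteq> 0" "s2 \<noteq> 0"
  shows "krein (pencil_mat (diag_pencil s1 (-1) s2 (-1))) (bvec x y) =
    - ((x $ 1)\<^sup>2 / s1 + (x $ 2)\<^sup>2 / s2) - 4 * (s1 * (y $ 1)\<^sup>2 + s2 * (y $ 2)\<^sup>2)"
proof -
  have "diag_pencil s1 (-1) s2 (-1) \<in> Pencils"
    using assms by (simp add: diag_pencil_in)
  then have "pencil_mat (diag_pencil s1 (-1) s2 (-1)) \<in> Sp_I"
    using pencil_mat_regular GL.regular_subset by fastforce
  then show ?thesis
    unfolding pencil_mat_diag [OF assms]
    by (subst krein_M_ABC) (use assms in \<open>simp_all add: inner_vec_def sum_2 matrix_vector_mult_def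
        power2_eq_square field_simps\<close>)
qed

lemma krein_uminus: "krein (- M) v = - krein M v"
proof -
  have "(- M - sinv (- M)) *v v = - ((M - sinv M) *v v)"
    unfolding inv_uminus matrix_vector_mult_diff_rdistrib matrix_vector_minus by simp
  then show ?thesis
    by (simp add: krein_def omega_def linear_neg [OF matrix_vector_mul_linear])
qed

text \<open>Negation replaces \<open>B\<close> by \<open>- B\<close> and exchanges
  \<open>(A - 1) B\<close> with \<open>(A + 1) B\<close>.\<close>

lemma uminus_pencil_mat:
  assumes "(P, Q) \<in> Pencils"
  shows "- pencil_mat (P, Q) = pencil_mat (- P, P + Q)"
proof -
  have P: "det2 P \<noteq> 0"
    using assms by (auto simp: Pencils_def)
  define N where "N = symm_inv P"
  have inv: "symm_inv (- P) = - N"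
    by (cases P) (simp add: symm_inv_def N_def m2_simps det2_def)
  have "- P + 2 *\<^sub>R (P + Q) = P + 2 *\<^sub>R Q"
    by (simp add: scaleR_2)
  moreover have "symm (- P) = - symm P"
    by (cases P) (simp add: symm_def m2_simps)
  ultimately show ?thesis
    by (simp add: pencil_mat_def Let_def inv N_def [symmetric] M_ABC_def block_mat_uminus
        block_mat_eq_iff
        matrix_calc)
qed

text \<open>The prescribed gaps \<open>- 2\<close> and \<open>4\<close> mean trace \<open>3\<close>
  and determinant \<open>0\<close>, that is, eigenvalues \<open>3\<close> and \<open>0\<close> of
  \<open>A\<close>, as in the representatives with \<open>k = 2\<close> and \<open>k = -1\<close>.
  So the larger root is \<open>3\<close>, and \<open>P + 2 Q - 3 P = 2 (Q - P)\<close>.\<close>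

lemma right_positive_pencil:
  assumes PQ: "(P, Q) \<in> Pencils" and gap: "4 * det2 Q / det2 P = - 2" "4 * det2 (P + Q) / det2 P = 4"
  shows "(\<And>y. qform (2 *\<^sub>R (Q - P)) y \<le> 0) \<Longrightarrow> right_positive (pencil_mat (P, Q))"
    "(\<And>y. qform (2 *\<^sub>R (Q - P)) y \<ge> 0) \<Longrightarrow> \<not> right_positive (pencil_mat (P, Q))"
proof -
  have "1 - tr_inv (pencil_mat (P, Q)) + det_inv (pencil_mat (P, Q)) = - 2"
    "1 + tr_inv (pencil_mat (P, Q)) + det_inv (pencil_mat (P, Q)) = 4"
    using gap_pencil_mat [OF PQ] gap by (simp_all add: gap_minus_def gap_plus_def)
  then have td: "tr_inv (pencil_mat (P, Q)) = 3" "det_inv (pencil_mat (P, Q)) = 0"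
    by linarith+
  have m: "(3 + sqrt (3\<^sup>2 - 4 * 0)) / 2 = (3 :: real)"
    by simp
  have z: "P + 2 *\<^sub>R Q - 3 *\<^sub>R P = 2 *\<^sub>R (Q - P)"
    by (cases P; cases Q) simp
  have g: "1 - tr_inv (pencil_mat (P, Q)) + det_inv (pencil_mat (P, Q)) < 0"
    "1 + tr_inv (pencil_mat (P, Q)) + det_inv (pencil_mat (P, Q)) > 0"
    by (simp_all add: td)
  obtain k where k: "k > 0" "det2 (2 *\<^sub>R (Q - P)) = 0" "2 *\<^sub>R (Q - P) \<noteq> 0"
    "\<And>x y. side_form (pencil_mat (P, Q)) (bvec x y) =
      - 4 * (k * qform (2 *\<^sub>R (Q - P)) (symm_inv P *v x) + qform (2 *\<^sub>R (Q - P)) y)"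
    by (rule side_form_pencil_mat [OF PQ g, unfolded td m z]) blast
  have gap': "gap_minus (pencil_mat (P, Q)) < 0" "gap_plus (pencil_mat (P, Q)) > 0"
    by (simp_all add: gap_minus_def gap_plus_def td)
  have q0: "qform (2 *\<^sub>R (Q - P)) 0 = 0"
    by (simp add: qform_def)
  show "right_positive (pencil_mat (P, Q))" if "\<And>y. qform (2 *\<^sub>R (Q - P)) y \<le> 0"
  proof -
    obtain y where "qform (2 *\<^sub>R (Q - P)) y < 0"
      using qform_degenerate [OF k(2,3)] \<open>\<And>y. qform (2 *\<^sub>R (Q - P)) y \<le> 0\<close> by (meson not_less)
    then have "side_form (pencil_mat (P, Q)) (bvec 0 y) > 0"
      by (simp add: k(4) q0)
    then show ?thesis
      using gap' by (auto simp: right_positive_def)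
  qed
  show "\<not> right_positive (pencil_mat (P, Q))" if "\<And>y. qform (2 *\<^sub>R (Q - P)) y \<ge> 0"
  proof -
    have "side_form (pencil_mat (P, Q)) v \<le> 0" for v
    proof -
      obtain a b where v: "v = bvec a b"
        by (rule bvec_cases)
      have "k * qform (2 *\<^sub>R (Q - P)) (symm_inv P *v a) \<ge> 0" "qform (2 *\<^sub>R (Q - P)) b \<ge> 0"
        using that k(1) by simp_all
      then show ?thesis
        by (simp add: v k(4))
    qed
    then show ?thesis
      by (auto simp: right_positive_def not_less)
  qed
qed

lemma qform_diag:
  "qform (a, 0, b) y = a * (y $ 1)\<^sup>2 + b * (y $ 2)\<^sup>2" "qform (a, 0) y = a * (y $ 1)\<^sup>2"
  by (simp_all add: zero_prod_def qform_eq)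

text \<open>In the first three rows the Krein form is negative definite, positive definite and
  indefinite. The next two pairs differ in the sign of the elliptic block.\<close>

lemma Sp_reps_preds:
  "map (\<lambda>x. map (\<lambda>p. p (pencil_mat x)) Sp_preds) Sp_reps =
    [[True, True, True, False, False, False], [True, True, False, True, False, False],
     [True, True, True, True, False, False],
     [False, True, False, False, True, False], [False, True, False, False, False, False],
     [True, False, False, False, False, False], [True, False, False, False, False, True],
     [False, False, False, False, False, False]]"
proof -
  have gap: "gap_minus (pencil_mat (diag_pencil s1 k1 s2 k2)) = k1 * k2"
    "gap_plus (pencil_mat (diag_pencil s1 k1 s2 k2)) = (k1 + 2) * (k2 + 2)"
    if "s1 \<noteq> 0" "s2 \<noteq> 0" "k1 \<noteq> 0" "k2 \<noteq> 0" "k1 \<noteq> - 2" "k2 \<noteq> - 2" for s1 k1 s2 k2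
  proof -
    have "pencil_mat (diag_pencil s1 k1 s2 k2) \<in> Sp_I"
      using pencil_mat_regular [OF diag_pencil_in [OF that]] GL.regular_subset by auto
    then show "gap_minus (pencil_mat (diag_pencil s1 k1 s2 k2)) = k1 * k2"
      "gap_plus (pencil_mat (diag_pencil s1 k1 s2 k2)) = (k1 + 2) * (k2 + 2)"
      unfolding pencil_mat_diag [OF that(1,2)] gap_minus_def gap_plus_def
      by (simp_all add: inv_M_ABC m2_simps algebra_simps)
  qed
  have krein: "(\<exists>v. krein (pencil_mat (diag_pencil s1 (-1) s2 (-1))) v < 0) \<longleftrightarrow> s1 > 0 \<or> s2 > 0"
    "(\<exists>v. krein (- pencil_mat (diag_pencil s1 (-1) s2 (-1))) v < 0) \<longleftrightarrow> s1 < 0 \<or> s2 < 0"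
    if s: "s1 = 1 \<or> s1 = -1" "s2 = 1 \<or> s2 = -1" for s1 s2
  proof -
    define M where "M = pencil_mat (diag_pencil s1 (-1) s2 (-1))"
    have nz: "s1 \<noteq> 0" "s2 \<noteq> 0"
      using s by auto
    have kr: "krein M (bvec x y) = - ((x $ 1)\<^sup>2 / s1 + (x $ 2)\<^sup>2 / s2) - 4 * (s1 * (y $ 1)\<^sup>2 + s2 *
        (y $ 2)\<^sup>2)" for x y
      unfolding M_def by (rule krein_diag [OF nz])
    have e: "krein M (bvec 0 (vector [1, 0])) = - 4 * s1" "krein M (bvec 0 (vector [0, 1])) = - 4 * s2"
      by (simp_all add: kr)
    have "krein M v \<ge> 0" if "s1 = -1" "s2 = -1" for v
    proof -
      obtain x y where "v = bvec x y"
        by (rule bvec_cases)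
      then have "krein M v = ((x $ 1)\<^sup>2 + (x $ 2)\<^sup>2) + 4 * ((y $ 1)\<^sup>2 + (y $ 2)\<^sup>2)"
        by (simp add: kr that)
      then show ?thesis
        by simp
    qed
    moreover have "krein M v \<le> 0" if "s1 = 1" "s2 = 1" for v
    proof -
      obtain x y where "v = bvec x y"
        by (rule bvec_cases)
      then have "krein M v = - (((x $ 1)\<^sup>2 + (x $ 2)\<^sup>2) + 4 * ((y $ 1)\<^sup>2 + (y $ 2)\<^sup>2))"
        by (simp add: kr that)
      then show ?thesis
        by (simp only: neg_le_0_iff_le) simp
    qed
    ultimately show "(\<exists>v. krein M v < 0) \<longleftrightarrow> s1 > 0 \<or> s2 > 0" "(\<exists>v. krein (- M) v < 0) \<longleftrightarrow> s1 < 0 \<or> s2 < 0"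
      unfolding krein_uminus using s e
      by (auto simp: not_less) (smt (verit) e)+
  qed
  have right: "right_positive (pencil_mat (diag_pencil 1 2 1 (-1)))"
    "\<not> right_positive (pencil_mat (diag_pencil 1 2 (-1) (-1)))"
    "\<not> right_positive (pencil_mat (diag_pencil (-1) (-1) (-1) 2))"
    "right_positive (pencil_mat (diag_pencil 1 (-1) (-1) 2))"
    unfolding diag_pencil_def
    by (rule right_positive_pencil; simp add: Pencils_def det2_def qform_diag)+
  \<comment> \<open>Negation takes the eigenvalues \<open>0\<close>, \<open>-3\<close> of
    \<open>A\<close> to \<open>0\<close>, \<open>3\<close>, where
    \<open>right_positive_pencil\<close> applies.\<close>
  have um: "- pencil_mat (diag_pencil 1 (-1) 1 (-4)) = pencil_mat (diag_pencil (-1) (-1) (-1) 2)"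
    "- pencil_mat (diag_pencil (-1) (-1) 1 (-4)) = pencil_mat (diag_pencil 1 (-1) (-1) 2)"
    unfolding diag_pencil_def by (subst uminus_pencil_mat; simp add: Pencils_def det2_def)+
  have gapless: "\<not> right_positive M" if "\<not> (gap_minus M < 0 \<and> gap_plus M > 0)" for M
    using that by (auto simp: right_positive_def)
  show ?thesis
    unfolding Sp_reps_def Sp_preds_def list.map
    by (simp add: gap top_negative_def inv_uminus krein right um gapless)
qed

lemma Sp_reps_distinct: "distinct (map (\<lambda>x. map (\<lambda>p. p (pencil_mat x)) Sp_preds) Sp_reps)"
  unfolding Sp_reps_preds by simp

theorem card_components_Sp: "card (connected_components_of Sp.regular_quotient) = 8"
proof -
  let ?Reps = "pencil_mat ` set Sp_reps"
  have reg: "?Reps \<subseteq> Sp.regular"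
    using Sp_reps_subset pencil_mat_regular GL_regular_subset_Sp_regular by blast
  have "card (connected_components_of Sp.regular_quotient) = card ?Reps"
  proof (rule Sp.card_components [OF reg])
    show "\<exists>r\<in>?Reps. connected_component_of Sp.regular_quotient (Sp.cls M) (Sp.cls r)" if M: "M \<in>
        Sp.regular" for M
    proof -
      obtain S x where S: "S \<in> Sp" "x \<in> Pencils" "Sp_act S M = pencil_mat x"
        using Sp_regular_conjugate [OF M] .
      have cls: "Sp.cls M = Sp.cls (pencil_mat x)"
        using Sp.cls_act [OF S(1), of M] M by (simp add: S(3) Sp_regular_iff)
      obtain y where y: "y \<in> set GL_reps" "pencil_type x = pencil_type y"
        using pencil_type_in [OF S(2)] .
      obtain w where w: "w \<in> set Sp_reps" "Sp_linked y w"
        using GL_reps_linked [OF y(1)] by blast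
      have "Sp_linked x y"
        using Sp_linked_type [OF S(2) _ y(2)] y(1) GL_reps_subset by blast
      then have "Sp_linked x w"
        using w(2) by (rule Sp_linked_trans)
      then show ?thesis
        using w(1) unfolding Sp_linked_def cls by blast
    qed
    show "\<exists>V. openin (top_of_set Sp) V \<and> V \<subseteq> Sp.regular \<and> openin (top_of_set Sp) (Sp.regular - V) \<and>
        (\<forall>g\<in>Sp. \<forall>x\<in>V. Sp_act g x \<in> V) \<and> (r \<in> V \<longleftrightarrow> s \<notin> V)"
      if rs: "r \<in> ?Reps" "s \<in> ?Reps" "r \<noteq> s" for r s
    proof -
      obtain x y where xy: "x \<in> set Sp_reps" "y \<in> set Sp_reps" "r = pencil_mat x" "s = pencil_mat y"
          "x \<noteq> y"
        using rs by blast
      have "map (\<lambda>p. p r) Sp_preds \<noteq> map (\<lambda>p. p s) Sp_preds"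
        using Sp_reps_distinct xy by (auto simp: distinct_map inj_on_def)
      then obtain p where p: "p \<in> set Sp_preds" "p r \<noteq> p s"
        unfolding map_eq_conv by blast
      show ?thesis
        using clopen_invariant_Sp_preds [OF p(1)] p(2) rs(1,2) reg
        by (intro exI [of _ "{M \<in> Sp.regular. p M}"]) (auto simp: clopen_invariant_def)
    qed
  qed
  also have "card ?Reps = card (set Sp_reps)"
  proof (rule card_image, rule inj_onI)
    fix x y assume "x \<in> set Sp_reps" "y \<in> set Sp_reps" "pencil_mat x = pencil_mat y"
    then show "x = y"
      using Sp_reps_subset mat_pencil_pencil_mat by (metis subsetD)
  qed
  also have "\<dots> = length Sp_reps"
    using Sp_reps_distinct by (simp add: distinct_card distinct_map)
  also have "\<dots> = 8"
    by (simp add: Sp_reps_def)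
  finally show ?thesis .
qed

theorem mainTheorem1:
  shows "card (connected_components_of
           (subtopology Sp_quotient (topspace Sp_quotient - bifurcation_locus_1))) = 8 \<and>
         card (connected_components_of
           (subtopology Sp_I_quotient (topspace Sp_I_quotient - bifurcation_locus_2))) = 19"
  unfolding Sp_quotient_regular Sp_I_quotient_regular
  using card_components_Sp card_components_Sp_I by blast

end
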